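(* Let $A$ be an $N\times N$ irreducible, non-permutation matrix with entries in $\{0,1\}$. There exists an isomorphism $\Phi:\widetilde{\mathcal R}_A\otimes\mathcal K\to\mathcal O_{A^t}\otimes\mathcal O_A\otimes\mathcal K$ of $C^*$-algebras such that the induced isomorphism $\Phi_*:K_0(\widetilde{\mathcal R}_A)\to K_0(\mathcal O_{A^t}\otimes\mathcal O_A)$ satisfies $\Phi_*([1_{\widetilde{\mathcal R}_A}])=[E_A]$.
   Context: $\mathcal K$ is the $C^*$-algebra of compact operators on $\ell^2(\mathbb N)$. $\mathcal O_A$ is the Cuntz–Krieger algebra with generating partial isometries $S_i$: $\sum_iS_iS_i^*=1$, $S_i^*S_i=\sum_jA(i,j)S_jS_j^*$; $\mathcal O_{A^t}$ has generators $T_i$: $\sum_iT_iT_i^*=1$, $T_i^*T_i=\sum_jA(j,i)T_jT_j^*$. $E_A=\sum_{i=1}^NT_i^*T_i\otimes S_iS_i^*$ is a projection in $\mathcal O_{A^t}\otimes\mathcal O_A$, and $\widetilde{\mathcal R}_A=E_A(\mathcal O_{A^t}\otimes\mathcal O_A)E_A$, whose unit is $E_A$. $K_0$ of a stabilization is identified with $K_0$ of the algebra via a rank one projection. *)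

theory Defs
  imports
    "HOL-Analysis.Analysis"
    "HOL-Combinatorics.Permutations"
    "HOL-Algebra.Coset"
    "Jordan_Normal_Form.Matrix"
begin

section \<open>Unital star-algebras and unital C*-algebras\<close>

class scaleC =
  fixes scaleC :: "complex \<Rightarrow> 'a \<Rightarrow> 'a"  (infixr \<open>*\<^sub>C\<close> 75)

class star_algebra = ring_1 + scaleC +
  fixes star :: "'a \<Rightarrow> 'a"
  assumes scaleC_add_right: "c *\<^sub>C (x + y) = c *\<^sub>C x + c *\<^sub>C y"
    and scaleC_add_left: "(c + d) *\<^sub>C x = c *\<^sub>C x + d *\<^sub>C x"
    and scaleC_scaleC: "c *\<^sub>C d *\<^sub>C x = (c * d) *\<^sub>C x"
    and scaleC_one: "1 *\<^sub>C x = x"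
    and mult_scaleC_left: "(c *\<^sub>C x) * y = c *\<^sub>C (x * y)"
    and mult_scaleC_right: "x * (c *\<^sub>C y) = c *\<^sub>C (x * y)"
    and star_add: "star (x + y) = star x + star y"
    and star_scaleC: "star (c *\<^sub>C x) = cnj c *\<^sub>C star x"
    and star_mult: "star (x * y) = star y * star x"
    and star_star: "star (star x) = x"

class cstar_algebra = star_algebra + real_normed_algebra_1 + complete_space +
  assumes scaleR_scaleC: "r *\<^sub>R x = complex_of_real r *\<^sub>C x"
    and norm_star_mult: "norm (star x * x) = (norm x)\<^sup>2"

instantiation complex :: star_algebra
begin
definition scaleC_complex :: "complex \<Rightarrow> complex \<Rightarrow> complex" where
  "scaleC_complex c x = c * x"
definition star_complex :: "complex \<Rightarrow> complex" where
  "star_complex = cnj"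
instance
  by standard (auto simp: scaleC_complex_def star_complex_def algebra_simps)
end


section \<open>The C*-algebra of bounded operators on a Hilbert space\<close>

text \<open>Up to unitary equivalence the Hilbert spaces are the spaces of square summable families
  over an index set; here the index set is a type.\<close>

typedef 'i ell2 = "{f :: 'i \<Rightarrow> complex. (\<lambda>i. (cmod (f i))\<^sup>2) summable_on UNIV}"
  morphisms ell2_coord Abs_ell2
  by (rule exI[of _ "\<lambda>_. 0"]) simp

setup_lifting type_definition_ell2

lemma square_summable_add:
  assumes "(\<lambda>i. (cmod (f i))\<^sup>2) summable_on A" "(\<lambda>i. (cmod (g i))\<^sup>2) summable_on A"
  shows "(\<lambda>i. (cmod (f i + g i))\<^sup>2) summable_on A"
proof (rule summable_on_comparison_test)
  show "(\<lambda>i. 2 * (cmod (f i))\<^sup>2 + 2 * (cmod (g i))\<^sup>2) summable_on A"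
    by (intro summable_on_add summable_on_cmult_right assms)
  fix i
  have "(cmod (f i + g i))\<^sup>2 \<le> (cmod (f i) + cmod (g i))\<^sup>2"
    by (intro power_mono norm_triangle_ineq) auto
  also have "\<dots> \<le> 2 * (cmod (f i))\<^sup>2 + 2 * (cmod (g i))\<^sup>2"
    using sum_squares_bound[of "cmod (f i)" "cmod (g i)"] by (simp add: power2_sum)
  finally show "(cmod (f i + g i))\<^sup>2 \<le> 2 * (cmod (f i))\<^sup>2 + 2 * (cmod (g i))\<^sup>2" .
qed auto

lemma square_summable_scale:
  assumes "(\<lambda>i. (cmod (f i))\<^sup>2) summable_on A"
  shows "(\<lambda>i. (cmod (c * f i))\<^sup>2) summable_on A"
  using summable_on_cmult_right[OF assms, of "(cmod c)\<^sup>2"] by (simp add: norm_mult power_mult_distrib)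

instantiation ell2 :: (type) "{ab_group_add, scaleC, scaleR}"
begin
lift_definition zero_ell2 :: "'a ell2" is "\<lambda>_. 0" by simp
lift_definition plus_ell2 :: "'a ell2 \<Rightarrow> 'a ell2 \<Rightarrow> 'a ell2" is "\<lambda>f g i. f i + g i"
  by (rule square_summable_add)
lift_definition uminus_ell2 :: "'a ell2 \<Rightarrow> 'a ell2" is "\<lambda>f i. - f i" by simp
lift_definition minus_ell2 :: "'a ell2 \<Rightarrow> 'a ell2 \<Rightarrow> 'a ell2" is "\<lambda>f g i. f i - g i"
  using square_summable_add[of _ UNIV "\<lambda>i. - _ i"] by simp
lift_definition scaleC_ell2 :: "complex \<Rightarrow> 'a ell2 \<Rightarrow> 'a ell2" is "\<lambda>c f i. c * f i"
  by (rule square_summable_scale)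
definition scaleR_ell2 :: "real \<Rightarrow> 'a ell2 \<Rightarrow> 'a ell2" where
  "scaleR_ell2 r x = complex_of_real r *\<^sub>C x"
instance
  by standard (transfer; auto simp: fun_eq_iff)+
end

lemma inner_summable:
  "(\<lambda>i. inner (ell2_coord x i) (ell2_coord y i)) summable_on UNIV"
proof (rule abs_summable_summable, rule summable_on_comparison_test)
  show "(\<lambda>i. (cmod (ell2_coord x i))\<^sup>2 + (cmod (ell2_coord y i))\<^sup>2) summable_on UNIV"
    using ell2_coord[of x] ell2_coord[of y] by (intro summable_on_add) auto
  fix i
  have "norm (inner (ell2_coord x i) (ell2_coord y i)) \<le> cmod (ell2_coord x i) * cmod (ell2_coord y i)"
    using Cauchy_Schwarz_ineq2 by auto
  also have "\<dots> \<le> (cmod (ell2_coord x i))\<^sup>2 + (cmod (ell2_coord y i))\<^sup>2"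
    using sum_squares_bound[of "cmod (ell2_coord x i)" "cmod (ell2_coord y i)"]
      mult_nonneg_nonneg[OF norm_ge_zero norm_ge_zero, of "ell2_coord x i" "ell2_coord y i"] by linarith
  finally show "norm (inner (ell2_coord x i) (ell2_coord y i)) \<le> (cmod (ell2_coord x i))\<^sup>2 + (cmod (ell2_coord y i))\<^sup>2" .
qed auto

instantiation ell2 :: (type) real_inner
begin
definition inner_ell2 :: "'a ell2 \<Rightarrow> 'a ell2 \<Rightarrow> real" where
  "inner_ell2 x y = (\<Sum>\<^sub>\<infinity>i. inner (ell2_coord x i) (ell2_coord y i))"
definition norm_ell2 :: "'a ell2 \<Rightarrow> real" where
  "norm_ell2 x = sqrt (\<Sum>\<^sub>\<infinity>i. (cmod (ell2_coord x i))\<^sup>2)"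
definition dist_ell2 :: "'a ell2 \<Rightarrow> 'a ell2 \<Rightarrow> real" where
  "dist_ell2 x y = norm (x - y)"
definition sgn_ell2 :: "'a ell2 \<Rightarrow> 'a ell2" where
  "sgn_ell2 x = x /\<^sub>R norm x"
definition uniformity_ell2 :: "('a ell2 \<times> 'a ell2) filter" where
  "uniformity_ell2 = (INF e\<in>{0 <..}. principal {(x, y). dist x y < e})"
definition open_ell2 :: "'a ell2 set \<Rightarrow> bool" where
  "open_ell2 U \<longleftrightarrow> (\<forall>x\<in>U. eventually (\<lambda>(x', y). x' = x \<longrightarrow> y \<in> U) uniformity)"
instance
proof
  fix x y z :: "'a ell2" and r s :: real
  show "dist x y = norm (x - y)" by (rule dist_ell2_def)
  show "sgn x = x /\<^sub>R norm x" by (rule sgn_ell2_def)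
  show "uniformity = (INF e\<in>{0 <..}. principal {(x :: 'a ell2, y). dist x y < e})"
    by (rule uniformity_ell2_def)
  show "open U \<longleftrightarrow> (\<forall>x\<in>U. \<forall>\<^sub>F (x', y) in uniformity. x' = x \<longrightarrow> y \<in> U)" for U :: "'a ell2 set"
    by (rule open_ell2_def)
  show "r *\<^sub>R (x + y) = r *\<^sub>R x + r *\<^sub>R y" "(r + s) *\<^sub>R x = r *\<^sub>R x + s *\<^sub>R x"
    "r *\<^sub>R s *\<^sub>R x = (r * s) *\<^sub>R x" "1 *\<^sub>R x = x"
    unfolding scaleR_ell2_def by (transfer; auto simp: fun_eq_iff algebra_simps)+
  show "inner x y = inner y x"
    unfolding inner_ell2_def by (simp add: inner_commute)
  show "inner (x + y) z = inner x z + inner y z"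
    unfolding inner_ell2_def
    by (subst infsum_add[symmetric]) (auto simp: plus_ell2.rep_eq inner_add_left intro: inner_summable)
  show "inner (r *\<^sub>R x) y = r * inner x y"
    unfolding inner_ell2_def scaleR_ell2_def
    by (subst infsum_cmult_right'[symmetric])
      (simp add: scaleC_ell2.rep_eq inner_complex_def algebra_simps)
  show "0 \<le> inner x x"
    unfolding inner_ell2_def by (rule infsum_nonneg) auto
  show "inner x x = 0 \<longleftrightarrow> x = 0"
  proof
    assume *: "inner x x = 0"
    have "ell2_coord x i = 0" for i
      using nonneg_infsum_le_0D[of "\<lambda>i. inner (ell2_coord x i) (ell2_coord x i)" UNIV i] *
      by (auto simp: inner_ell2_def intro: inner_summable)
    then show "x = 0" by (auto simp: ell2_coord_inject[symmetric] zero_ell2.rep_eq)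
  qed (simp add: inner_ell2_def zero_ell2.rep_eq)
  show "norm x = sqrt (inner x x)"
    by (simp add: norm_ell2_def inner_ell2_def power2_norm_eq_inner)
qed
end

lemma norm_ell2_coord_le: "cmod (ell2_coord x i) \<le> norm x"
  and sum_ell2_coord_le: "finite F \<Longrightarrow> (\<Sum>i\<in>F. (cmod (ell2_coord x i))\<^sup>2) \<le> (norm x)\<^sup>2"
proof -
  show *: "(\<Sum>i\<in>F. (cmod (ell2_coord x i))\<^sup>2) \<le> (norm x)\<^sup>2" if "finite F" for F
    unfolding norm_ell2_def using ell2_coord[of x] that
    by (auto intro!: finite_sum_le_infsum simp: infsum_nonneg)
  show "cmod (ell2_coord x i) \<le> norm x"
    using *[of "{i}"] by (simp add: abs_le_square_iff[symmetric])
qed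

lemma ell2I_bounded:
  assumes "\<And>F. finite F \<Longrightarrow> (\<Sum>i\<in>F. (cmod (f i))\<^sup>2) \<le> c\<^sup>2" "c \<ge> 0"
  shows "f \<in> {f. (\<lambda>i. (cmod (f i))\<^sup>2) summable_on UNIV}" "norm (Abs_ell2 f) \<le> c"
proof -
  have *: "(\<lambda>i. (cmod (f i))\<^sup>2) summable_on UNIV"
    by (rule nonneg_bdd_above_summable_on) (auto intro!: bdd_aboveI[of _ "c\<^sup>2"] assms)
  then show "f \<in> {f. (\<lambda>i. (cmod (f i))\<^sup>2) summable_on UNIV}" by simp
  show "norm (Abs_ell2 f) \<le> c"
    unfolding norm_ell2_def using * assms
    by (auto simp: Abs_ell2_inverse intro!: real_le_lsqrt infsum_nonneg infsum_le_finite_sums)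
qed

instance ell2 :: (type) complete_space
proof
  fix X :: "nat \<Rightarrow> 'a ell2" assume X: "Cauchy X"
  have "Cauchy (\<lambda>n. ell2_coord (X n) i)" for i
  proof (rule metric_CauchyI)
    fix e :: real assume "e > 0"
    then obtain M where "\<And>m n. m \<ge> M \<Longrightarrow> n \<ge> M \<Longrightarrow> dist (X m) (X n) < e"
      using metric_CauchyD[OF X] by metis
    then have "dist (ell2_coord (X m) i) (ell2_coord (X n) i) < e" if "m \<ge> M" "n \<ge> M" for m n
      using norm_ell2_coord_le[of "X m - X n" i] that le_less_trans
      unfolding dist_norm minus_ell2.rep_eq by blast
    then show "\<exists>M. \<forall>m\<ge>M. \<forall>n\<ge>M. dist (ell2_coord (X m) i) (ell2_coord (X n) i) < e" by blast
  qed
  then have g: "(\<lambda>n. ell2_coord (X n) i) \<longlonglongrightarrow> lim (\<lambda>n. ell2_coord (X n) i)" for i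
    by (simp add: Cauchy_convergent_iff convergent_LIMSEQ_iff)
  define g where "g = (\<lambda>i. lim (\<lambda>n. ell2_coord (X n) i))"
  note g = g[folded fun_cong[OF g_def]]
  have bound: "(\<Sum>i\<in>F. (cmod (ell2_coord (X n) i - g i))\<^sup>2) \<le> e\<^sup>2"
    if M: "\<And>m n. m \<ge> M \<Longrightarrow> n \<ge> M \<Longrightarrow> dist (X m) (X n) < e" and "e > 0" "n \<ge> M" "finite F" for M e n F
  proof (rule tendsto_upperbound)
    show "(\<lambda>m. \<Sum>i\<in>F. (cmod (ell2_coord (X n) i - ell2_coord (X m) i))\<^sup>2) \<longlonglongrightarrow>
        (\<Sum>i\<in>F. (cmod (ell2_coord (X n) i - g i))\<^sup>2)"
      by (intro tendsto_intros g)
    show "\<forall>\<^sub>F m in sequentially. (\<Sum>i\<in>F. (cmod (ell2_coord (X n) i - ell2_coord (X m) i))\<^sup>2) \<le> e\<^sup>2"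
      unfolding eventually_sequentially
    proof (intro exI allI impI)
      fix m assume "M \<le> m"
      have "(\<Sum>i\<in>F. (cmod (ell2_coord (X n) i - ell2_coord (X m) i))\<^sup>2) \<le> (norm (X n - X m))\<^sup>2"
        using sum_ell2_coord_le[OF \<open>finite F\<close>, of "X n - X m"] by (simp add: minus_ell2.rep_eq)
      also have "\<dots> \<le> e\<^sup>2"
        using M[OF \<open>n \<ge> M\<close> \<open>M \<le> m\<close>] by (intro power_mono) (auto simp: dist_norm)
      finally show "(\<Sum>i\<in>F. (cmod (ell2_coord (X n) i - ell2_coord (X m) i))\<^sup>2) \<le> e\<^sup>2" .
    qed
  qed simp
  have diff: "(\<lambda>i. ell2_coord (X n) i - g i) \<in> {f. (\<lambda>i. (cmod (f i))\<^sup>2) summable_on UNIV}"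
    "norm (Abs_ell2 (\<lambda>i. ell2_coord (X n) i - g i)) \<le> e"
    if M: "\<And>m n. m \<ge> M \<Longrightarrow> n \<ge> M \<Longrightarrow> dist (X m) (X n) < e" and "e > 0" "n \<ge> M" for M e n
    using bound[OF M \<open>e > 0\<close> \<open>n \<ge> M\<close>] \<open>e > 0\<close> ell2I_bounded[of "\<lambda>i. ell2_coord (X n) i - g i" e] by auto
  have "\<exists>M. \<forall>m\<ge>M. \<forall>n\<ge>M. dist (X m) (X n) < 1"
    by (rule metric_CauchyD[OF X]) simp
  then obtain M1 where M1: "\<And>m n. m \<ge> M1 \<Longrightarrow> n \<ge> M1 \<Longrightarrow> dist (X m) (X n) < 1"
    by metis
  define G where "G = X M1 - Abs_ell2 (\<lambda>i. ell2_coord (X M1) i - g i)"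
  have G: "ell2_coord G = g"
    unfolding G_def using diff(1)[OF M1, of M1] by (auto simp: minus_ell2.rep_eq Abs_ell2_inverse fun_eq_iff)
  have "X \<longlonglongrightarrow> G"
  proof (rule metric_LIMSEQ_I)
    fix e :: real assume "e > 0"
    then obtain M where M: "\<And>m n. m \<ge> M \<Longrightarrow> n \<ge> M \<Longrightarrow> dist (X m) (X n) < e / 2"
      using metric_CauchyD[OF X, of "e / 2"] half_gt_zero by metis
    have "dist (X n) G < e" if "n \<ge> M" for n
    proof -
      have "X n - G = Abs_ell2 (\<lambda>i. ell2_coord (X n) i - g i)"
        using diff(1)[OF M, of n] that \<open>e > 0\<close> G
        by (auto simp: ell2_coord_inject[symmetric] Abs_ell2_inverse minus_ell2.rep_eq fun_eq_iff)
      then show ?thesis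
        using diff(2)[OF M _ that] \<open>e > 0\<close> by (simp add: dist_norm)
    qed
    then show "\<exists>M. \<forall>n\<ge>M. dist (X n) G < e" by blast
  qed
  then show "convergent X" by (auto simp: convergent_def)
qed

lemma ell2_coord_simps [simp]:
  "ell2_coord 0 i = 0"
  "ell2_coord (x + y) i = ell2_coord x i + ell2_coord y i"
  "ell2_coord (x - y) i = ell2_coord x i - ell2_coord y i"
  "ell2_coord (- x) i = - ell2_coord x i"
  "ell2_coord (c *\<^sub>C x) i = c * ell2_coord x i"
  "ell2_coord (r *\<^sub>R x) i = r * ell2_coord x i"
  by (auto simp: zero_ell2.rep_eq plus_ell2.rep_eq minus_ell2.rep_eq uminus_ell2.rep_eq
      scaleC_ell2.rep_eq scaleR_ell2_def)

lemma ell2_eqI: "(\<And>i. ell2_coord x i = ell2_coord y i) \<Longrightarrow> x = y"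
  by (simp add: ell2_coord_inject[symmetric] fun_eq_iff)

lemma ell2_scaleC_rules:
  fixes x y :: "'i ell2"
  shows "c *\<^sub>C (x + y) = c *\<^sub>C x + c *\<^sub>C y" "c *\<^sub>C (x - y) = c *\<^sub>C x - c *\<^sub>C y"
    "(c + d) *\<^sub>C x = c *\<^sub>C x + d *\<^sub>C x" "c *\<^sub>C d *\<^sub>C x = (c * d) *\<^sub>C x" "1 *\<^sub>C x = x"
    "c *\<^sub>C (0 :: 'i ell2) = 0" "c *\<^sub>C (- x) = - (c *\<^sub>C x)" "r *\<^sub>R x = complex_of_real r *\<^sub>C x"
  by (auto intro!: ell2_eqI simp: algebra_simps)

lemma norm_scaleC_ell2: "norm (c *\<^sub>C x) = cmod c * norm (x :: 'i ell2)"
proof -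
  have "(\<Sum>\<^sub>\<infinity>i. (cmod (c * ell2_coord x i))\<^sup>2) = (cmod c)\<^sup>2 * (\<Sum>\<^sub>\<infinity>i. (cmod (ell2_coord x i))\<^sup>2)"
    by (simp add: norm_mult power_mult_distrib infsum_cmult_right')
  then show ?thesis by (simp add: norm_ell2_def real_sqrt_mult)
qed

text \<open>The inner product is conjugate linear in the first variable.\<close>
definition cinner :: "'i ell2 \<Rightarrow> 'i ell2 \<Rightarrow> complex" where
  "cinner x y = (\<Sum>\<^sub>\<infinity>i. cnj (ell2_coord x i) * ell2_coord y i)"

lemma cinner_eq_inner: "cinner x y = Complex (inner x y) (inner (\<i> *\<^sub>C x) y)"
proof -
  have "((\<lambda>i. complex_of_real (inner (ell2_coord x i) (ell2_coord y i)) +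
      \<i> * complex_of_real (inner (ell2_coord (\<i> *\<^sub>C x) i) (ell2_coord y i))) has_sum
      (complex_of_real (inner x y) + \<i> * complex_of_real (inner (\<i> *\<^sub>C x) y))) UNIV"
    unfolding inner_ell2_def
    by (intro has_sum_add has_sum_cmult_right has_sum_of_real has_sum_infsum inner_summable)
  also have "(\<lambda>i. complex_of_real (inner (ell2_coord x i) (ell2_coord y i)) +
      \<i> * complex_of_real (inner (ell2_coord (\<i> *\<^sub>C x) i) (ell2_coord y i))) =
      (\<lambda>i. cnj (ell2_coord x i) * ell2_coord y i)"
    by (auto simp: inner_complex_def complex_eq_iff)
  finally show ?thesis
    by (simp add: cinner_def infsumI Complex_eq)
qed

lemma inner_scaleC_swap: "inner (c *\<^sub>C x) (y :: 'i ell2) = inner x (cnj c *\<^sub>C y)"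
  unfolding inner_ell2_def by (rule infsum_cong) (simp add: inner_complex_def algebra_simps)

lemma Re_cinner: "Re (cinner x y) = inner x y"
  by (simp add: cinner_eq_inner)

lemma cinner_eqI: "(\<And>x. inner x y = inner x z) \<Longrightarrow> y = z"
  by (metis inner_eq_zero_iff inner_diff_right right_minus_eq)

lift_definition unit_ell2 :: "'i \<Rightarrow> 'i ell2" is "\<lambda>i j. if j = i then 1 else 0"
proof -
  fix i :: 'i
  have "(\<lambda>j. (cmod (if j = i then 1 else 0))\<^sup>2) summable_on {i}" by simp
  then show "(\<lambda>j. (cmod (if j = i then 1 else 0))\<^sup>2) summable_on UNIV"
    by (rule summable_on_cong_neutral[THEN iffD1, rotated -1]) auto
qed

lemma cinner_unit_ell2 [simp]: "cinner (unit_ell2 i) x = ell2_coord x i"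
proof -
  have "cinner (unit_ell2 i) x = (\<Sum>\<^sub>\<infinity>j\<in>{i}. ell2_coord x j)"
    unfolding cinner_def by (rule infsum_cong_neutral) (auto simp: unit_ell2.rep_eq)
  then show ?thesis by simp
qed

lemma norm_unit_ell2 [simp]: "norm (unit_ell2 i) = 1"
proof -
  have "(\<Sum>\<^sub>\<infinity>j. (cmod (ell2_coord (unit_ell2 i) j))\<^sup>2) = (\<Sum>\<^sub>\<infinity>j\<in>{i}. 1)"
    by (rule infsum_cong_neutral) (auto simp: unit_ell2.rep_eq)
  then show ?thesis by (simp add: norm_ell2_def)
qed

lemma ell2_coord_sum [simp]: "ell2_coord (\<Sum>k\<in>F. f k) i = (\<Sum>k\<in>F. ell2_coord (f k) i)"
  by (induction F rule: infinite_finite_induct) auto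

lemma has_sum_unit_ell2: "((\<lambda>i. ell2_coord x i *\<^sub>C unit_ell2 i) has_sum x) UNIV"
  unfolding has_sum_def
proof (rule tendstoI)
  fix e :: real assume "e > 0"
  have sm: "((\<lambda>i. (cmod (ell2_coord x i))\<^sup>2) has_sum (norm x)\<^sup>2) UNIV"
    using ell2_coord[of x] by (simp add: norm_ell2_def infsum_nonneg has_sum_infsum)
  then have "\<forall>\<^sub>F F in finite_subsets_at_top UNIV. dist (\<Sum>i\<in>F. (cmod (ell2_coord x i))\<^sup>2) ((norm x)\<^sup>2) < e\<^sup>2"
    using \<open>e > 0\<close> unfolding has_sum_def tendsto_iff by auto
  moreover have "\<forall>\<^sub>F F :: 'a set in finite_subsets_at_top UNIV. finite F"
    by (simp add: eventually_finite_subsets_at_top_weakI)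
  ultimately show "\<forall>\<^sub>F F in finite_subsets_at_top UNIV. dist (\<Sum>i\<in>F. ell2_coord x i *\<^sub>C unit_ell2 i) x < e"
  proof eventually_elim
    case (elim F)
    define y where "y = (\<Sum>i\<in>F. ell2_coord x i *\<^sub>C unit_ell2 i)"
    have y: "ell2_coord y j = (if j \<in> F then ell2_coord x j else 0)" for j
      using elim(2) by (simp add: y_def unit_ell2.rep_eq if_distrib cong: if_cong)
    have "(norm (y - x))\<^sup>2 = (\<Sum>\<^sub>\<infinity>i. (cmod (ell2_coord (y - x) i))\<^sup>2)"
      by (simp add: norm_ell2_def infsum_nonneg)
    also have "\<dots> = (\<Sum>\<^sub>\<infinity>i\<in>UNIV - F. (cmod (ell2_coord x i))\<^sup>2)"
      by (rule infsum_cong_neutral) (auto simp: y)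
    also have "\<dots> = (norm x)\<^sup>2 - (\<Sum>i\<in>F. (cmod (ell2_coord x i))\<^sup>2)"
      by (rule infsumI, rule has_sum_Diff[OF sm has_sum_finite]) (use elim in auto)
    also have "\<dots> < e\<^sup>2" using elim(1) by (simp add: dist_real_def)
    finally have "norm (y - x) < e"
      using \<open>e > 0\<close> by (simp add: power_less_imp_less_base)
    then show ?case by (simp add: y_def dist_norm)
  qed
qed

typedef 'i bop = "{T :: 'i ell2 \<Rightarrow>\<^sub>L 'i ell2. \<forall>c x. T (c *\<^sub>C x) = c *\<^sub>C T x}"
  morphisms blinfun_of_bop Abs_bop
  by (rule exI[of _ 0]) (simp add: ell2_scaleC_rules)

setup_lifting type_definition_bop

definition bop_apply :: "'i bop \<Rightarrow> 'i ell2 \<Rightarrow> 'i ell2"  (infixr \<open>\<cdot>\<close> 75) where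
  "T \<cdot> x = blinfun_apply (blinfun_of_bop T) x"

lemma bop_eqI: "(\<And>x. S \<cdot> x = T \<cdot> x) \<Longrightarrow> S = T"
  by (simp add: bop_apply_def blinfun_of_bop_inject[symmetric] blinfun_eqI)

lemma bounded_linear_scaleC_ell2: "bounded_linear (\<lambda>x :: 'i ell2. c *\<^sub>C x)"
  by (rule bounded_linear_intro[where K = "cmod c"])
    (simp_all add: ell2_scaleC_rules norm_scaleC_ell2 mult.commute)

definition scaleC_blinfun :: "complex \<Rightarrow> 'i ell2 \<Rightarrow>\<^sub>L 'i ell2" where
  "scaleC_blinfun c = Blinfun (\<lambda>x. c *\<^sub>C x)"

lemma scaleC_blinfun_apply [simp]: "blinfun_apply (scaleC_blinfun c) x = c *\<^sub>C x"
  by (simp add: scaleC_blinfun_def bounded_linear_Blinfun_apply bounded_linear_scaleC_ell2)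

instantiation bop :: (type) "{zero, one, plus, minus, uminus, times, scaleC, scaleR, norm}"
begin
lift_definition zero_bop :: "'a bop" is 0 by (simp add: ell2_scaleC_rules)
lift_definition one_bop :: "'a bop" is id_blinfun by simp
lift_definition plus_bop :: "'a bop \<Rightarrow> 'a bop \<Rightarrow> 'a bop" is "(+)"
  by (simp add: blinfun.add_left ell2_scaleC_rules)
lift_definition minus_bop :: "'a bop \<Rightarrow> 'a bop \<Rightarrow> 'a bop" is "(-)"
  by (simp add: blinfun.diff_left ell2_scaleC_rules)
lift_definition uminus_bop :: "'a bop \<Rightarrow> 'a bop" is uminus
  by (simp add: blinfun.minus_left ell2_scaleC_rules)
lift_definition times_bop :: "'a bop \<Rightarrow> 'a bop \<Rightarrow> 'a bop" is "(o\<^sub>L)" by simp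
lift_definition scaleR_bop :: "real \<Rightarrow> 'a bop \<Rightarrow> 'a bop" is "(*\<^sub>R)"
  by (simp add: blinfun.scaleR_left ell2_scaleC_rules mult.commute)
lift_definition scaleC_bop :: "complex \<Rightarrow> 'a bop \<Rightarrow> 'a bop" is "\<lambda>c T. scaleC_blinfun c o\<^sub>L T"
  by (simp add: scaleC_blinfun_apply ell2_scaleC_rules mult.commute)
lift_definition norm_bop :: "'a bop \<Rightarrow> real" is norm .
instance ..
end

lemma bop_apply_simps [simp]:
  "0 \<cdot> x = 0" "1 \<cdot> x = x" "(S + T) \<cdot> x = S \<cdot> x + T \<cdot> x" "(S - T) \<cdot> x = S \<cdot> x - T \<cdot> x"
  "(- T) \<cdot> x = - (T \<cdot> x)" "(S * T) \<cdot> x = S \<cdot> T \<cdot> x" "(r *\<^sub>R T) \<cdot> x = r *\<^sub>R (T \<cdot> x)"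
  "(c *\<^sub>C T) \<cdot> x = c *\<^sub>C (T \<cdot> x)"
  by (simp_all add: bop_apply_def zero_bop.rep_eq one_bop.rep_eq plus_bop.rep_eq minus_bop.rep_eq
      uminus_bop.rep_eq times_bop.rep_eq scaleR_bop.rep_eq scaleC_bop.rep_eq scaleC_blinfun_apply
      blinfun.add_left blinfun.diff_left blinfun.minus_left blinfun.scaleR_left)

lemma bop_apply_linear [simp]:
  "T \<cdot> 0 = 0" "T \<cdot> (x + y) = T \<cdot> x + T \<cdot> y" "T \<cdot> (x - y) = T \<cdot> x - T \<cdot> y" "T \<cdot> (- x) = - (T \<cdot> x)"
  "T \<cdot> (r *\<^sub>R x) = r *\<^sub>R (T \<cdot> x)" "T \<cdot> (c *\<^sub>C x) = c *\<^sub>C (T \<cdot> x)"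
  using blinfun_of_bop[of T]
  by (simp_all add: bop_apply_def blinfun.zero_right blinfun.add_right blinfun.diff_right
      blinfun.minus_right blinfun.scaleR_right)

lemma bounded_linear_bop_apply: "bounded_linear (\<lambda>x. T \<cdot> x)"
  unfolding bop_apply_def by (rule blinfun.bounded_linear_right)

lemma bopI:
  assumes "\<And>x y. f (x + y) = f x + f y" "\<And>c x. f (c *\<^sub>C x) = c *\<^sub>C f x"
    and "\<And>x. norm (f x) \<le> K * norm x"
  obtains T :: "'i bop" where "\<And>x. T \<cdot> x = f x"
proof
  have "bounded_linear f"
    using assms by (intro bounded_linear_intro[where K = K]) (auto simp: ell2_scaleC_rules mult.commute)
  then show "Abs_bop (Blinfun f) \<cdot> x = f x" for x
    using assms(2) by (simp add: bop_apply_def Abs_bop_inverse bounded_linear_Blinfun_apply)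
qed

lemma norm_id_blinfun_ell2: "norm (id_blinfun :: 'i ell2 \<Rightarrow>\<^sub>L 'i ell2) = 1"
proof (rule antisym)
  show "norm (id_blinfun :: 'i ell2 \<Rightarrow>\<^sub>L 'i ell2) \<le> 1"
    by (rule norm_blinfun_id_le)
  show "1 \<le> norm (id_blinfun :: 'i ell2 \<Rightarrow>\<^sub>L 'i ell2)"
    using norm_blinfun[of "id_blinfun :: 'i ell2 \<Rightarrow>\<^sub>L 'i ell2" "unit_ell2 undefined"] by simp
qed

instantiation bop :: (type) real_normed_algebra_1
begin
definition dist_bop :: "'a bop \<Rightarrow> 'a bop \<Rightarrow> real" where
  "dist_bop S T = norm (S - T)"
definition sgn_bop :: "'a bop \<Rightarrow> 'a bop" where
  "sgn_bop T = T /\<^sub>R norm T"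
definition uniformity_bop :: "('a bop \<times> 'a bop) filter" where
  "uniformity_bop = (INF e\<in>{0 <..}. principal {(S, T). dist S T < e})"
definition open_bop :: "'a bop set \<Rightarrow> bool" where
  "open_bop U \<longleftrightarrow> (\<forall>S\<in>U. eventually (\<lambda>(S', T). S' = S \<longrightarrow> T \<in> U) uniformity)"
instance
proof
  fix S T U :: "'a bop" and r s :: real
  show "dist S T = norm (S - T)" by (rule dist_bop_def)
  show "sgn S = S /\<^sub>R norm S" by (rule sgn_bop_def)
  show "uniformity = (INF e\<in>{0 <..}. principal {(S :: 'a bop, T). dist S T < e})"
    by (rule uniformity_bop_def)
  show "open V \<longleftrightarrow> (\<forall>S\<in>V. \<forall>\<^sub>F (S', T) in uniformity. S' = S \<longrightarrow> T \<in> V)" for V :: "'a bop set"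
    by (rule open_bop_def)
  show "S + T + U = S + (T + U)" "S + T = T + S" "0 + S = S" "- S + S = 0" "S - T = S + - T"
    "S * T * U = S * (T * U)" "1 * S = S" "S * 1 = S" "(S + T) * U = S * U + T * U"
    "S * (T + U) = S * T + S * U"
    "r *\<^sub>R (S + T) = r *\<^sub>R S + r *\<^sub>R T" "(r + s) *\<^sub>R S = r *\<^sub>R S + s *\<^sub>R S"
    "r *\<^sub>R s *\<^sub>R S = (r * s) *\<^sub>R S" "1 *\<^sub>R S = S"
    "(r *\<^sub>R S) * T = r *\<^sub>R (S * T)" "S * (r *\<^sub>R T) = r *\<^sub>R (S * T)"
    by (auto intro!: bop_eqI simp: scaleR_add_right scaleR_add_left)
  show "norm (S * T) \<le> norm S * norm T"
    by (transfer, rule norm_blinfun_compose)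
  show "norm S = 0 \<longleftrightarrow> S = 0" "norm (S + T) \<le> norm S + norm T" "norm (r *\<^sub>R S) = \<bar>r\<bar> * norm S"
    by (transfer, simp add: norm_triangle_ineq)+
  show "norm (1 :: 'a bop) = 1"
    by (transfer, rule norm_id_blinfun_ell2)
  moreover have "norm (0 :: 'a bop) = 0"
    by (transfer, simp)
  ultimately show "(0 :: 'a bop) \<noteq> 1"
    by (metis zero_neq_one)
qed
end

lemma norm_bop_apply_le: "norm (T \<cdot> x) \<le> norm T * norm x"
  by (simp add: bop_apply_def norm_bop.rep_eq norm_blinfun)

lemma norm_bop_bound: "b \<ge> 0 \<Longrightarrow> (\<And>x. norm (T \<cdot> x) \<le> b * norm x) \<Longrightarrow> norm T \<le> b"
  unfolding bop_apply_def norm_bop.rep_eq by (rule norm_blinfun_bound)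

lemma cinner_eq_iff: "(\<forall>x. cinner x y = cinner x z) \<longleftrightarrow> y = z"
  by (metis Re_cinner cinner_eqI)

lemma cinner_add: "cinner (x + y) z = cinner x z + cinner y z" "cinner x (y + z) = cinner x y + cinner x z"
  by (simp_all add: cinner_eq_inner ell2_scaleC_rules inner_add_left inner_add_right complex_eq_iff)

lemma cinner_scaleC:
  "cinner (c *\<^sub>C x) y = cnj c * cinner x y" "cinner x (c *\<^sub>C y) = c * cinner x y"
  by (simp_all add: cinner_def algebra_simps infsum_cmult_right')

lemma cinner_commute: "cinner y x = cnj (cinner x y)"
  unfolding cinner_def by (subst infsum_cnj[symmetric]) (simp add: mult.commute)

lemma bounded_linear_cinner_left: "bounded_linear (\<lambda>y. cinner x y)"
proof -
  have "bounded_linear (\<lambda>y. complex_of_real (inner x y) + \<i> * complex_of_real (inner (\<i> *\<^sub>C x) y))"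
    by (intro bounded_linear_add bounded_linear_const_mult bounded_linear_compose[OF bounded_linear_of_real]
        bounded_linear_inner_right)
  then show ?thesis by (simp add: cinner_eq_inner Complex_eq)
qed

lemma ex1_adjoint: "\<exists>!S :: 'i bop. \<forall>x y. cinner (S \<cdot> x) y = cinner x (T \<cdot> y)"
proof -
  define c where "c y i = cinner (T \<cdot> unit_ell2 i) y" for y i
  have c: "(\<Sum>i\<in>F. (cmod (c y i))\<^sup>2) \<le> (norm T * norm y)\<^sup>2" if "finite F" for F y
  proof -
    define x where "x = (\<Sum>i\<in>F. c y i *\<^sub>C unit_ell2 i)"
    define s where "s = (\<Sum>i\<in>F. (cmod (c y i))\<^sup>2)"
    have cx: "ell2_coord x j = (if j \<in> F then c y j else 0)" for j
      using that by (simp add: x_def unit_ell2.rep_eq if_distrib cong: if_cong)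
    have "(\<Sum>\<^sub>\<infinity>i. (cmod (ell2_coord x i))\<^sup>2) = (\<Sum>\<^sub>\<infinity>i\<in>F. (cmod (c y i))\<^sup>2)"
      by (rule infsum_cong_neutral) (auto simp: cx)
    then have nx: "norm x = sqrt s"
      using that by (simp add: norm_ell2_def s_def)
    have "cinner (T \<cdot> x) y = (\<Sum>i\<in>F. cnj (c y i) * c y i)"
      using that unfolding x_def c_def
      by (induction F rule: finite_induct) (auto simp: cinner_add cinner_scaleC cinner_eq_inner[of 0] ell2_scaleC_rules complex_eq_iff)
    also have "\<dots> = complex_of_real s"
      by (simp add: s_def complex_norm_square mult.commute del: of_real_power)
    finally have "s = inner (T \<cdot> x) y"
      by (metis Re_cinner Re_complex_of_real)
    also have "\<dots> \<le> norm (T \<cdot> x) * norm y"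
      by (rule norm_cauchy_schwarz)
    also have "\<dots> \<le> norm T * norm x * norm y"
      by (intro mult_right_mono norm_bop_apply_le) auto
    finally have "s \<le> sqrt s * (norm T * norm y)"
      by (simp add: nx mult_ac)
    moreover have s0: "s \<ge> 0" by (simp add: s_def sum_nonneg)
    ultimately have le: "sqrt s * sqrt s \<le> sqrt s * (norm T * norm y)" by simp
    have "sqrt s \<le> norm T * norm y"
    proof (cases "s = 0")
      case False
      then have "sqrt s > 0" using s0 by simp
      then show ?thesis using mult_left_le_imp_le[OF le] by blast
    qed simp
    then have "(sqrt s)\<^sup>2 \<le> (norm T * norm y)\<^sup>2"
      by (intro power_mono) (use s0 in auto)
    then show ?thesis using s0 by (simp add: s_def)
  qed
  define f where "f y = Abs_ell2 (c y)" for y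
  have f: "ell2_coord (f y) = c y" "norm (f y) \<le> norm T * norm y" for y
    using ell2I_bounded[OF c, of y] by (auto simp: f_def Abs_ell2_inverse)
  obtain S :: "'i bop" where S: "\<And>y. S \<cdot> y = f y"
    by (rule bopI[of f "norm T"])
      (auto intro!: ell2_eqI simp: f c_def cinner_add cinner_scaleC)
  have *: "cinner x (S \<cdot> y) = cinner (T \<cdot> x) y" for x y
  proof -
    have "((\<lambda>i. cinner y (T \<cdot> (ell2_coord x i *\<^sub>C unit_ell2 i))) has_sum cinner y (T \<cdot> x)) UNIV"
      by (intro has_sum_bounded_linear[OF bounded_linear_cinner_left]
          has_sum_bounded_linear[OF bounded_linear_bop_apply] has_sum_unit_ell2)
    moreover have "((\<lambda>i. cinner (S \<cdot> y) (ell2_coord x i *\<^sub>C unit_ell2 i)) has_sum cinner (S \<cdot> y) x) UNIV"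
      by (intro has_sum_bounded_linear[OF bounded_linear_cinner_left] has_sum_unit_ell2)
    moreover have "cinner y (T \<cdot> (ell2_coord x i *\<^sub>C unit_ell2 i)) =
        cinner (S \<cdot> y) (ell2_coord x i *\<^sub>C unit_ell2 i)" for i
      using cinner_commute[of y "T \<cdot> unit_ell2 i"] cinner_commute[of "S \<cdot> y" "unit_ell2 i"]
      by (simp add: cinner_scaleC S f c_def)
    ultimately have "cinner y (T \<cdot> x) = cinner (S \<cdot> y) x"
      by (simp add: has_sum_unique)
    then show ?thesis by (metis cinner_commute)
  qed
  show ?thesis
  proof (rule ex1I[of _ S])
    show "\<forall>x y. cinner (S \<cdot> x) y = cinner x (T \<cdot> y)"
      using * by (metis cinner_commute)
    fix S' assume "\<forall>x y. cinner (S' \<cdot> x) y = cinner x (T \<cdot> y)"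
    then have "\<forall>z. cinner z (S' \<cdot> x) = cinner z (S \<cdot> x)" for x
      using * by (metis cinner_commute)
    then show "S' = S"
      by (intro bop_eqI) (simp add: cinner_eq_iff)
  qed
qed

lemma bop_star_eqI:
  assumes "\<And>x y. cinner (S \<cdot> x) y = cinner x (T \<cdot> y)" "\<And>x y. cinner (S' \<cdot> x) y = cinner x (T \<cdot> y)"
  shows "S = S'"
  using assms ex1_adjoint[of T] by blast

instance ell2 :: (type) banach ..

instance bop :: (type) complete_space
proof
  fix X :: "nat \<Rightarrow> 'a bop" assume X: "Cauchy X"
  have "Cauchy (\<lambda>n. blinfun_of_bop (X n))"
    using X unfolding Cauchy_def dist_norm norm_bop.rep_eq minus_bop.rep_eq .
  then obtain L where L: "(\<lambda>n. blinfun_of_bop (X n)) \<longlonglongrightarrow> L"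
    by (metis Cauchy_convergent_iff convergent_def)
  have lim: "(\<lambda>n. X n \<cdot> x) \<longlonglongrightarrow> blinfun_apply L x" for x
    unfolding bop_apply_def by (intro tendsto_intros L)
  have "blinfun_apply L (c *\<^sub>C x) = c *\<^sub>C blinfun_apply L x" for c x
  proof (rule LIMSEQ_unique)
    show "(\<lambda>n. X n \<cdot> c *\<^sub>C x) \<longlonglongrightarrow> blinfun_apply L (c *\<^sub>C x)" by (rule lim)
    show "(\<lambda>n. X n \<cdot> c *\<^sub>C x) \<longlonglongrightarrow> c *\<^sub>C blinfun_apply L x"
      using bounded_linear.tendsto[OF bounded_linear_scaleC_ell2 lim] by simp
  qed
  then have "blinfun_of_bop (Abs_bop L) = L" by (simp add: Abs_bop_inverse)
  then have "X \<longlonglongrightarrow> Abs_bop L"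
    using L unfolding LIMSEQ_iff norm_bop.rep_eq minus_bop.rep_eq by simp
  then show "convergent X" by (auto simp: convergent_def)
qed

instance bop :: (type) banach ..

instantiation bop :: (type) cstar_algebra
begin
definition star_bop :: "'a bop \<Rightarrow> 'a bop" where
  "star_bop T = (THE S. \<forall>x y. cinner (S \<cdot> x) y = cinner x (T \<cdot> y))"
instance
proof
  fix S T U :: "'a bop" and c d :: complex and r :: real
  have star: "cinner (star T \<cdot> x) y = cinner x (T \<cdot> y)" for T :: "'a bop" and x y
    unfolding star_bop_def using theI'[OF ex1_adjoint[of T]] by blast
  have star': "cinner (T \<cdot> x) y = cinner x (star T \<cdot> y)" for T :: "'a bop" and x y
    by (metis cinner_commute star)
  show "c *\<^sub>C (S + T) = c *\<^sub>C S + c *\<^sub>C T" "(c + d) *\<^sub>C S = c *\<^sub>C S + d *\<^sub>C S"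
    "c *\<^sub>C d *\<^sub>C S = (c * d) *\<^sub>C S" "1 *\<^sub>C S = S" "(c *\<^sub>C S) * T = c *\<^sub>C (S * T)"
    "S * (c *\<^sub>C T) = c *\<^sub>C (S * T)" "r *\<^sub>R S = complex_of_real r *\<^sub>C S"
    by (auto intro!: bop_eqI simp: ell2_scaleC_rules)
  show "star (S + T) = star S + star T"
    by (rule bop_star_eqI[of _ "S + T"]) (simp_all add: star cinner_add)
  show "star (c *\<^sub>C S) = cnj c *\<^sub>C star S"
    by (rule bop_star_eqI[of _ "c *\<^sub>C S"]) (simp_all add: star cinner_scaleC)
  show "star (S * T) = star T * star S"
    by (rule bop_star_eqI[of _ "S * T"]) (simp_all add: star)
  show "star (star S) = S"
    by (rule bop_star_eqI[of _ "star S"], rule star, rule star')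
  have inner_star: "inner (T \<cdot> x) y = inner x (star T \<cdot> y)" for T :: "'a bop" and x y
    using star'[of T x y] by (metis Re_cinner)
  have sq: "(norm (T \<cdot> x))\<^sup>2 \<le> norm (star T * T) * (norm x)\<^sup>2" for T :: "'a bop" and x
  proof -
    have "(norm (T \<cdot> x))\<^sup>2 = inner x ((star T * T) \<cdot> x)"
      by (simp add: power2_norm_eq_inner inner_star)
    also have "\<dots> \<le> norm x * norm ((star T * T) \<cdot> x)"
      by (rule norm_cauchy_schwarz)
    also have "\<dots> \<le> norm x * (norm (star T * T) * norm x)"
      by (intro mult_left_mono norm_bop_apply_le) auto
    finally show ?thesis by (simp add: power2_eq_square mult_ac)
  qed
  have le: "(norm T)\<^sup>2 \<le> norm (star T * T)" for T :: "'a bop"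
  proof -
    have "norm T \<le> sqrt (norm (star T * T))"
    proof (rule norm_bop_bound)
      fix x :: "'a ell2"
      show "norm (T \<cdot> x) \<le> sqrt (norm (star T * T)) * norm x"
        using real_le_rsqrt[OF sq[of T x]] by (simp add: real_sqrt_mult)
    qed simp
    then have "(norm T)\<^sup>2 \<le> (sqrt (norm (star T * T)))\<^sup>2" by (intro power_mono) auto
    then show ?thesis by simp
  qed
  have norm_le: "norm T \<le> norm (star T)" for T :: "'a bop"
  proof (cases "T = 0")
    case False
    have "norm T * norm T \<le> norm (star T) * norm T"
      using le[of T] norm_mult_ineq[of "star T" T] by (simp add: power2_eq_square)
    then show ?thesis using False by simp
  qed simp
  have "norm (star S) \<le> norm S"
    using norm_le[of "star S"] \<open>star (star S) = S\<close> by simp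
  then have "norm (star S * S) \<le> (norm S)\<^sup>2"
    using norm_mult_ineq[of "star S" S] mult_right_mono[of "norm (star S)" "norm S" "norm S"]
    by (simp add: power2_eq_square)
  then show "norm (star S * S) = (norm S)\<^sup>2"
    using le[of S] by simp
qed
end

section \<open>Tensor products of vectors and operators\<close>

lift_definition tensor_ell2 :: "'i ell2 \<Rightarrow> 'j ell2 \<Rightarrow> ('i \<times> 'j) ell2"
  is "\<lambda>f g (i, j). f i * g j"
proof -
  fix f :: "'i \<Rightarrow> complex" and g :: "'j \<Rightarrow> complex"
  assume f: "(\<lambda>i. (cmod (f i))\<^sup>2) summable_on UNIV" and g: "(\<lambda>j. (cmod (g j))\<^sup>2) summable_on UNIV"
  have fx: "ell2_coord (Abs_ell2 f) = f" and gx: "ell2_coord (Abs_ell2 g) = g"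
    using f g by (auto simp: Abs_ell2_inverse)
  have "(\<Sum>p\<in>F. (cmod (case p of (i, j) \<Rightarrow> f i * g j))\<^sup>2) \<le> (norm (Abs_ell2 f) * norm (Abs_ell2 g))\<^sup>2"
    if "finite F" for F
  proof -
    have "(\<Sum>p\<in>F. (cmod (case p of (i, j) \<Rightarrow> f i * g j))\<^sup>2)
        \<le> (\<Sum>p\<in>fst ` F \<times> snd ` F. (cmod (case p of (i, j) \<Rightarrow> f i * g j))\<^sup>2)"
      using that by (intro sum_mono2) (auto simp: image_iff, metis fst_conv, metis snd_conv)
    also have "\<dots> = (\<Sum>i\<in>fst ` F. (cmod (f i))\<^sup>2) * (\<Sum>j\<in>snd ` F. (cmod (g j))\<^sup>2)"
      by (simp add: sum_product sum.cartesian_product norm_mult power_mult_distrib case_prod_beta)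
    also have "\<dots> \<le> (norm (Abs_ell2 f))\<^sup>2 * (norm (Abs_ell2 g))\<^sup>2"
      using sum_ell2_coord_le[of "fst ` F" "Abs_ell2 f"] sum_ell2_coord_le[of "snd ` F" "Abs_ell2 g"] that
      by (intro mult_mono) (auto simp: fx gx sum_nonneg)
    finally show ?thesis by (simp add: power_mult_distrib)
  qed
  from ell2I_bounded(1)[OF this]
  show "(\<lambda>p. (cmod (case p of (i, j) \<Rightarrow> f i * g j))\<^sup>2) summable_on UNIV" by simp
qed

lemma ell2_coord_tensor [simp]: "ell2_coord (tensor_ell2 x y) (i, j) = ell2_coord x i * ell2_coord y j"
  by (simp add: tensor_ell2.rep_eq)

lemma ex_amplification:
  fixes S :: "'i bop" and h :: "'i \<times> 'j \<Rightarrow> 'k"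
  assumes h: "bij h"
  shows "\<exists>U :: 'k bop. \<forall>z i j.
    ell2_coord (U \<cdot> z) (h (i, j)) = ell2_coord (S \<cdot> Abs_ell2 (\<lambda>i. ell2_coord z (h (i, j)))) i"
proof -
  define sl :: "'k ell2 \<Rightarrow> 'j \<Rightarrow> 'i ell2" where "sl z j = Abs_ell2 (\<lambda>i. ell2_coord z (h (i, j)))" for z j
  have fin: "(\<Sum>i\<in>A. \<Sum>j\<in>B. (cmod (ell2_coord z (h (i, j))))\<^sup>2) \<le> (norm z)\<^sup>2" if "finite A" "finite B" for A B z
  proof -
    have "(\<Sum>i\<in>A. \<Sum>j\<in>B. (cmod (ell2_coord z (h (i, j))))\<^sup>2) = (\<Sum>k\<in>h ` (A \<times> B). (cmod (ell2_coord z k))\<^sup>2)"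
      using h by (subst sum.reindex) (auto simp: sum.cartesian_product case_prod_beta bij_def intro: inj_on_subset)
    also have "\<dots> \<le> (norm z)\<^sup>2" using that by (intro sum_ell2_coord_le) auto
    finally show ?thesis .
  qed
  have mem: "(\<lambda>i. ell2_coord z (h (i, j))) \<in> {f. (\<lambda>i. (cmod (f i))\<^sup>2) summable_on UNIV}" for z j
    by (rule ell2I_bounded(1)[where c = "norm z"]) (use fin[of _ "{j}"] in auto)
  have sl: "ell2_coord (sl z j) i = ell2_coord z (h (i, j))" for z i j
    using mem[of z j] by (simp add: sl_def Abs_ell2_inverse)
  have slices: "(\<Sum>j\<in>B. (norm (sl z j))\<^sup>2) \<le> (norm z)\<^sup>2" if "finite B" for B z
  proof (rule has_sum_le_finite_sums)
    have hs: "((\<lambda>i. (cmod (ell2_coord z (h (i, j))))\<^sup>2) has_sum (norm (sl z j))\<^sup>2) UNIV" for j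
      using mem[of z j] by (simp add: norm_ell2_def sl infsum_nonneg has_sum_infsum)
    show "((\<lambda>i. \<Sum>j\<in>B. (cmod (ell2_coord z (h (i, j))))\<^sup>2) has_sum (\<Sum>j\<in>B. (norm (sl z j))\<^sup>2)) UNIV"
      using that by (induction B rule: finite_induct) (auto intro!: has_sum_add hs)
    show "(\<Sum>i\<in>F. \<Sum>j\<in>B. (cmod (ell2_coord z (h (i, j))))\<^sup>2) \<le> (norm z)\<^sup>2" if "finite F" for F
      using fin that \<open>finite B\<close> by blast
  qed
  define g where "g = inv_into UNIV h"
  have gh: "g (h p) = p" for p using h by (simp add: g_def bij_def)
  have hg: "h (g k) = k" for k using h by (simp add: g_def bij_def surj_f_inv_f)
  define c where "c z k = ell2_coord (S \<cdot> sl z (snd (g k))) (fst (g k))" for z k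
  have c: "(\<Sum>k\<in>F. (cmod (c z k))\<^sup>2) \<le> (norm S * norm z)\<^sup>2" if "finite F" for F z
  proof -
    define A B where "A = fst ` g ` F" and "B = snd ` g ` F"
    have "k \<in> h ` (A \<times> B)" if "k \<in> F" for k
      using that by (intro image_eqI[of _ _ "g k"]) (auto simp: hg A_def B_def mem_Times_iff)
    then have AB: "finite A" "finite B" "F \<subseteq> h ` (A \<times> B)"
      using that by (auto simp: A_def B_def)
    have "(\<Sum>k\<in>F. (cmod (c z k))\<^sup>2) \<le> (\<Sum>k\<in>h ` (A \<times> B). (cmod (c z k))\<^sup>2)"
      using AB by (intro sum_mono2) auto
    also have "\<dots> = (\<Sum>(i, j)\<in>A \<times> B. (cmod (ell2_coord (S \<cdot> sl z j) i))\<^sup>2)"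
      using h by (subst sum.reindex) (auto simp: c_def gh case_prod_beta bij_def intro: inj_on_subset)
    also have "\<dots> = (\<Sum>j\<in>B. \<Sum>i\<in>A. (cmod (ell2_coord (S \<cdot> sl z j) i))\<^sup>2)"
      by (subst sum.swap) (simp add: sum.cartesian_product)
    also have "\<dots> \<le> (\<Sum>j\<in>B. (norm S * norm (sl z j))\<^sup>2)"
    proof (rule sum_mono)
      fix j
      have "(\<Sum>i\<in>A. (cmod (ell2_coord (S \<cdot> sl z j) i))\<^sup>2) \<le> (norm (S \<cdot> sl z j))\<^sup>2"
        by (rule sum_ell2_coord_le) fact
      also have "\<dots> \<le> (norm S * norm (sl z j))\<^sup>2"
        by (intro power_mono norm_bop_apply_le) auto
      finally show "(\<Sum>i\<in>A. (cmod (ell2_coord (S \<cdot> sl z j) i))\<^sup>2) \<le> (norm S * norm (sl z j))\<^sup>2" .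
    qed
    also have "\<dots> = (norm S)\<^sup>2 * (\<Sum>j\<in>B. (norm (sl z j))\<^sup>2)"
      by (simp add: power_mult_distrib sum_distrib_left)
    also have "\<dots> \<le> (norm S)\<^sup>2 * (norm z)\<^sup>2"
      by (intro mult_left_mono slices AB) auto
    finally show ?thesis by (simp add: power_mult_distrib)
  qed
  define f where "f z = Abs_ell2 (c z)" for z
  have f: "ell2_coord (f z) = c z" "norm (f z) \<le> norm S * norm z" for z
    using ell2I_bounded[OF c, of z] by (auto simp: f_def Abs_ell2_inverse)
  have sl_lin: "sl (x + y) j = sl x j + sl y j" "sl (a *\<^sub>C x) j = a *\<^sub>C sl x j" for x y a j
    by (auto intro!: ell2_eqI simp: sl)
  obtain U :: "'k bop" where U: "\<And>z. U \<cdot> z = f z"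
    by (rule bopI[of f "norm S"]) (auto intro!: ell2_eqI simp: f c_def sl_lin)
  show ?thesis
    by (intro exI[of _ U]) (simp add: U f c_def gh sl_def)
qed

lemma Abs_ell2_scale:
  "Abs_ell2 (\<lambda>i. a * ell2_coord x i) = a *\<^sub>C x" "Abs_ell2 (\<lambda>i. ell2_coord x i * a) = a *\<^sub>C x"
proof -
  have "Abs_ell2 (ell2_coord (a *\<^sub>C x)) = a *\<^sub>C x" by (rule ell2_coord_inverse)
  moreover have "ell2_coord (a *\<^sub>C x) = (\<lambda>i. a * ell2_coord x i)" by (rule ext) simp
  moreover have "ell2_coord (a *\<^sub>C x) = (\<lambda>i. ell2_coord x i * a)" by (rule ext) simp
  ultimately show "Abs_ell2 (\<lambda>i. a * ell2_coord x i) = a *\<^sub>C x"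
    "Abs_ell2 (\<lambda>i. ell2_coord x i * a) = a *\<^sub>C x" by simp_all
qed

lemma ex1_tensor_bop:
  "\<exists>!U :: ('i \<times> 'j) bop. \<forall>x y. U \<cdot> tensor_ell2 x y = tensor_ell2 (S \<cdot> x) (T \<cdot> y)"
proof -
  have "bij (\<lambda>p :: 'i \<times> 'j. p)" by (simp add: bij_def)
  from ex_amplification[OF this, of S] obtain U1 :: "('i \<times> 'j) bop" where U1:
    "\<And>z i j. ell2_coord (U1 \<cdot> z) (i, j) = ell2_coord (S \<cdot> Abs_ell2 (\<lambda>i. ell2_coord z (i, j))) i"
    by blast
  from ex_amplification[OF bij_swap, of T] obtain U2 :: "('i \<times> 'j) bop" where U2:
    "\<And>z j i. ell2_coord (U2 \<cdot> z) (i, j) = ell2_coord (T \<cdot> Abs_ell2 (\<lambda>j. ell2_coord z (i, j))) j"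
    unfolding swap_simp by blast
  have ex: "(U1 * U2) \<cdot> tensor_ell2 x y = tensor_ell2 (S \<cdot> x) (T \<cdot> y)" for x y
  proof -
    have 2: "U2 \<cdot> tensor_ell2 x y = tensor_ell2 x (T \<cdot> y)"
    proof (rule ell2_eqI, clarify)
      show "ell2_coord (U2 \<cdot> tensor_ell2 x y) (i, j) = ell2_coord (tensor_ell2 x (T \<cdot> y)) (i, j)" for i j
        by (simp only: U2 ell2_coord_tensor Abs_ell2_scale bop_apply_linear ell2_coord_simps)
    qed
    have 1: "U1 \<cdot> tensor_ell2 x w = tensor_ell2 (S \<cdot> x) w" for w
    proof (rule ell2_eqI, clarify)
      show "ell2_coord (U1 \<cdot> tensor_ell2 x w) (i, j) = ell2_coord (tensor_ell2 (S \<cdot> x) w) (i, j)" for i j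
        by (simp only: U1 ell2_coord_tensor Abs_ell2_scale bop_apply_linear ell2_coord_simps mult.commute)
    qed
    show ?thesis by (simp add: 1 2)
  qed
  have unit: "tensor_ell2 (unit_ell2 i) (unit_ell2 j) = unit_ell2 (i, j)" for i :: 'i and j :: 'j
    by (rule ell2_eqI, clarify) (simp only: ell2_coord_tensor unit_ell2.rep_eq, auto)
  have "U = U1 * U2" if U: "\<forall>x y. U \<cdot> tensor_ell2 x y = tensor_ell2 (S \<cdot> x) (T \<cdot> y)" for U
  proof (rule bop_eqI)
    fix z
    have "U \<cdot> unit_ell2 p = (U1 * U2) \<cdot> unit_ell2 p" for p
      using U ex unit[of "fst p" "snd p"] by (metis prod.collapse)
    then have eq: "U \<cdot> ell2_coord z p *\<^sub>C unit_ell2 p = (U1 * U2) \<cdot> ell2_coord z p *\<^sub>C unit_ell2 p" for p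
      by simp
    have hs: "((\<lambda>p. V \<cdot> ell2_coord z p *\<^sub>C unit_ell2 p) has_sum V \<cdot> z) UNIV" for V
      by (rule has_sum_bounded_linear[OF bounded_linear_bop_apply has_sum_unit_ell2])
    show "U \<cdot> z = (U1 * U2) \<cdot> z"
      by (rule has_sum_unique[OF hs[of U, unfolded eq] hs[of "U1 * U2"]])
  qed
  then show ?thesis using ex by blast
qed

text \<open>Operators on the Hilbert space tensor product of \<open>\<ell>\<^sup>2(I)\<close> and \<open>\<ell>\<^sup>2(J)\<close>, which is
  \<open>\<ell>\<^sup>2(I \<times> J)\<close>.\<close>
definition tensor_bop :: "'i bop \<Rightarrow> 'j bop \<Rightarrow> ('i \<times> 'j) bop"  (infixr \<open>\<otimes>\<^sub>B\<close> 70) where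
  "S \<otimes>\<^sub>B T = (THE U. \<forall>x y. U \<cdot> tensor_ell2 x y = tensor_ell2 (S \<cdot> x) (T \<cdot> y))"

lemma tensor_bop_apply: "(S \<otimes>\<^sub>B T) \<cdot> tensor_ell2 x y = tensor_ell2 (S \<cdot> x) (T \<cdot> y)"
  unfolding tensor_bop_def using theI'[OF ex1_tensor_bop[of S T]] by blast


section \<open>C*-subalgebras, isomorphisms, tensor products, compact operators\<close>

definition cstar_subalgebra :: "'a :: cstar_algebra set \<Rightarrow> bool" where
  "cstar_subalgebra B \<longleftrightarrow>
    0 \<in> B \<and> (\<forall>x\<in>B. \<forall>y\<in>B. x + y \<in> B) \<and> (\<forall>c. \<forall>x\<in>B. c *\<^sub>C x \<in> B) \<and>
    (\<forall>x\<in>B. \<forall>y\<in>B. x * y \<in> B) \<and> (\<forall>x\<in>B. star x \<in> B) \<and> closed B"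

text \<open>By the Gelfand--Naimark theorem every C*-algebra is of the form \<open>B\<close> for some
  \<open>cstar_subalgebra B\<close>, \<open>B :: 'i bop set\<close>. The unit of \<open>B\<close>, if any, need not be the identity operator.\<close>

definition alg_unit :: "'a :: star_algebra set \<Rightarrow> 'a" where
  "alg_unit B = (THE u. u \<in> B \<and> (\<forall>x\<in>B. u * x = x \<and> x * u = x))"

definition star_hom :: "'a :: star_algebra set \<Rightarrow> 'b :: star_algebra set \<Rightarrow> ('a \<Rightarrow> 'b) \<Rightarrow> bool" where
  "star_hom B C f \<longleftrightarrow>
    (\<forall>x\<in>B. f x \<in> C) \<and> (\<forall>x\<in>B. \<forall>y\<in>B. f (x + y) = f x + f y) \<and> (\<forall>c. \<forall>x\<in>B. f (c *\<^sub>C x) = c *\<^sub>C f x) \<and>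
    (\<forall>x\<in>B. \<forall>y\<in>B. f (x * y) = f x * f y) \<and> (\<forall>x\<in>B. f (star x) = star (f x))"

definition star_iso :: "'a :: star_algebra set \<Rightarrow> 'b :: star_algebra set \<Rightarrow> ('a \<Rightarrow> 'b) \<Rightarrow> bool" where
  "star_iso B C f \<longleftrightarrow> star_hom B C f \<and> bij_betw f B C"

definition is_projection :: "'a :: star_algebra \<Rightarrow> bool" where
  "is_projection p \<longleftrightarrow> p * p = p \<and> star p = p"

definition corner :: "'a :: star_algebra \<Rightarrow> 'a set \<Rightarrow> 'a set" where
  "corner p B = {p * x * p | x. x \<in> B}"

text \<open>The spatial tensor product. All algebras to which it is applied below are nuclear, so that it is
  the only C*-tensor product.\<close>
definition cstar_tensor :: "'i bop set \<Rightarrow> 'j bop set \<Rightarrow> ('i \<times> 'j) bop set"  (infixr \<open>\<otimes>\<^sub>C\<close> 70) where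
  "B \<otimes>\<^sub>C C = cstar_subalgebra hull {b \<otimes>\<^sub>B c | b c. b \<in> B \<and> c \<in> C}"

definition compact_operators :: "'i bop set" where
  "compact_operators = {T. compact (closure ((\<lambda>x. T \<cdot> x) ` cball 0 1))}"

abbreviation \<K> :: "nat bop set" where
  "\<K> \<equiv> compact_operators"

definition rank_one_projection :: "'i bop \<Rightarrow> bool" where
  "rank_one_projection e \<longleftrightarrow>
    is_projection e \<and> (\<exists>x. x \<noteq> 0 \<and> range (\<lambda>y. e \<cdot> y) = range (\<lambda>c. c *\<^sub>C x))"


section \<open>Cuntz--Krieger algebras\<close>

definition irreducible_matrix :: "nat mat \<Rightarrow> bool" where
  "irreducible_matrix A \<longleftrightarrow> square_mat A \<and> (\<forall>i<dim_row A. \<forall>j<dim_row A. \<exists>k>0. (A ^\<^sub>m k) $$ (i, j) > 0)"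

definition permutation_matrix :: "nat mat \<Rightarrow> bool" where
  "permutation_matrix A \<longleftrightarrow>
    (\<exists>\<pi>. \<pi> permutes {..<dim_row A} \<and>
      A = mat (dim_row A) (dim_row A) (\<lambda>(i, j). if j = \<pi> i then 1 else 0))"

definition cuntz_krieger_family :: "nat mat \<Rightarrow> (nat \<Rightarrow> 'a :: star_algebra) \<Rightarrow> bool" where
  "cuntz_krieger_family A S \<longleftrightarrow>
    (\<forall>i<dim_row A. S i * star (S i) * S i = S i) \<and>
    (\<Sum>i<dim_row A. S i * star (S i)) = 1 \<and>
    (\<forall>i<dim_row A. star (S i) * S i = (\<Sum>j<dim_row A. of_nat (A $$ (i, j)) * (S j * star (S j))))"

text \<open>\<open>B\<close> is the universal C*-algebra generated by partial isometries \<open>S i\<close> that satisfy the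
  Cuntz--Krieger relations for \<open>A\<close>. In the universal property it is enough to consider families of
  operators on \<open>\<ell>\<^sup>2(\<nat>)\<close>: a unital C*-algebra generated by finitely many elements is separable, hence
  (unless it is \<open>0\<close>) it has a faithful unital representation on \<open>\<ell>\<^sup>2(\<nat>)\<close>.\<close>
definition cuntz_krieger_algebra :: "nat mat \<Rightarrow> 'a :: cstar_algebra set \<Rightarrow> (nat \<Rightarrow> 'a) \<Rightarrow> bool" where
  "cuntz_krieger_algebra A B S \<longleftrightarrow>
    cuntz_krieger_family A S \<and> B = cstar_subalgebra hull (S ` {..<dim_row A}) \<and>
    (\<forall>R :: nat \<Rightarrow> nat bop. cuntz_krieger_family A R \<longrightarrow>
      (\<exists>\<rho>. star_hom B UNIV \<rho> \<and> (\<forall>i<dim_row A. \<rho> (S i) = R i)))"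


section \<open>The group K0\<close>

text \<open>The unitization of a star-algebra: \<open>Unitization b \<lambda>\<close> is the formal sum \<open>b + \<lambda>1\<close> with a new unit \<open>1\<close>,
  also if the algebra already has a unit.\<close>
datatype 'a unitization = Unitization (alg_part: 'a) (scalar_part: complex)

instantiation unitization :: (star_algebra) star_algebra
begin
definition zero_unitization :: "'a unitization" where
  "0 = Unitization 0 0"
definition one_unitization :: "'a unitization" where
  "1 = Unitization 0 1"
definition plus_unitization :: "'a unitization \<Rightarrow> 'a unitization \<Rightarrow> 'a unitization" where
  "u + v = Unitization (alg_part u + alg_part v) (scalar_part u + scalar_part v)"
definition minus_unitization :: "'a unitization \<Rightarrow> 'a unitization \<Rightarrow> 'a unitization" where
  "u - v = Unitization (alg_part u - alg_part v) (scalar_part u - scalar_part v)"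
definition uminus_unitization :: "'a unitization \<Rightarrow> 'a unitization" where
  "- u = Unitization (- alg_part u) (- scalar_part u)"
definition times_unitization :: "'a unitization \<Rightarrow> 'a unitization \<Rightarrow> 'a unitization" where
  "u * v = Unitization
    (alg_part u * alg_part v + scalar_part u *\<^sub>C alg_part v + scalar_part v *\<^sub>C alg_part u)
    (scalar_part u * scalar_part v)"
definition scaleC_unitization :: "complex \<Rightarrow> 'a unitization \<Rightarrow> 'a unitization" where
  "c *\<^sub>C u = Unitization (c *\<^sub>C alg_part u) (c * scalar_part u)"
definition star_unitization :: "'a unitization \<Rightarrow> 'a unitization" where
  "star u = Unitization (star (alg_part u)) (cnj (scalar_part u))"
instance
proof
  have z1: "c *\<^sub>C (0 :: 'a) = 0" for c
    using scaleC_add_right[of c "0 :: 'a" 0] by simp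
  have z2: "0 *\<^sub>C x = 0" for x :: 'a
    using scaleC_add_left[of 0 0 x] by simp
  fix u v w :: "'a unitization" and c d :: complex
  note defs = zero_unitization_def one_unitization_def plus_unitization_def minus_unitization_def
    uminus_unitization_def times_unitization_def scaleC_unitization_def star_unitization_def
  note rules = scaleC_add_right scaleC_add_left scaleC_scaleC scaleC_one mult_scaleC_left
    mult_scaleC_right star_add star_scaleC star_mult star_star z1 z2
  show "u + v + w = u + (v + w)" "u + v = v + u" "0 + u = u" "- u + u = 0" "u - v = u + - v"
    "u * v * w = u * (v * w)" "1 * u = u" "u * 1 = u" "(u + v) * w = u * w + v * w"
    "u * (v + w) = u * v + u * w" "(0 :: 'a unitization) \<noteq> 1"
    "c *\<^sub>C (u + v) = c *\<^sub>C u + c *\<^sub>C v" "(c + d) *\<^sub>C u = c *\<^sub>C u + d *\<^sub>C u"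
    "c *\<^sub>C d *\<^sub>C u = (c * d) *\<^sub>C u" "1 *\<^sub>C u = u" "(c *\<^sub>C u) * v = c *\<^sub>C (u * v)"
    "u * (c *\<^sub>C v) = c *\<^sub>C (u * v)" "star (u + v) = star u + star v"
    "star (c *\<^sub>C u) = cnj c *\<^sub>C star u" "star (u * v) = star v * star u" "star (star u) = u"
    by (simp_all add: defs rules algebra_simps)
qed
end

definition unitize :: "'a set \<Rightarrow> 'a unitization set" where
  "unitize B = {u. alg_part u \<in> B}"

definition unitize_map :: "('a \<Rightarrow> 'b) \<Rightarrow> 'a unitization \<Rightarrow> 'b unitization" where
  "unitize_map f u = Unitization (f (alg_part u)) (scalar_part u)"

definition mat_star :: "'a :: star_algebra mat \<Rightarrow> 'a mat" where
  "mat_star M = mat (dim_col M) (dim_row M) (\<lambda>(i, j). star (M $$ (j, i)))"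

definition mat_projections :: "'a :: star_algebra set \<Rightarrow> 'a mat set" where
  "mat_projections U = {p. square_mat p \<and> elements_mat p \<subseteq> U \<and> p * p = p \<and> mat_star p = p}"

text \<open>Murray--von Neumann equivalence of projections in matrix algebras of possibly different sizes.\<close>
definition mvn_equiv :: "'a :: star_algebra set \<Rightarrow> 'a mat \<Rightarrow> 'a mat \<Rightarrow> bool" where
  "mvn_equiv U p q \<longleftrightarrow>
    (\<exists>v\<in>carrier_mat (dim_row q) (dim_row p).
      elements_mat v \<subseteq> U \<and> mat_star v * v = p \<and> v * mat_star v = q)"

abbreviation direct_sum :: "'a :: zero mat \<Rightarrow> 'a mat \<Rightarrow> 'a mat"  (infixr \<open>\<oplus>\<^sub>m\<close> 65) where
  "p \<oplus>\<^sub>m q \<equiv> diag_block_mat [p, q]"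

text \<open>For a subalgebra \<open>U\<close> that contains \<open>1\<close>, \<open>K0_unital U\<close> is the Grothendieck group of the semigroup
  of equivalence classes of projections in matrices over \<open>U\<close>; the pair \<open>(p, q)\<close> represents \<open>[p] - [q]\<close>.\<close>
definition K0_rel :: "'a :: star_algebra set \<Rightarrow> (('a mat \<times> 'a mat) \<times> ('a mat \<times> 'a mat)) set" where
  "K0_rel U = {((p, q), (p', q')).
    p \<in> mat_projections U \<and> q \<in> mat_projections U \<and> p' \<in> mat_projections U \<and> q' \<in> mat_projections U \<and>
    (\<exists>r\<in>mat_projections U. mvn_equiv U (p \<oplus>\<^sub>m q' \<oplus>\<^sub>m r) (p' \<oplus>\<^sub>m q \<oplus>\<^sub>m r))}"

definition K0_unital :: "'a :: star_algebra set \<Rightarrow> ('a mat \<times> 'a mat) set monoid" where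
  "K0_unital U = \<lparr>
    carrier = (mat_projections U \<times> mat_projections U) // K0_rel U,
    monoid.mult = (\<lambda>X Y. \<Union>(p, q)\<in>X. \<Union>(p', q')\<in>Y. K0_rel U `` {(p \<oplus>\<^sub>m p', q \<oplus>\<^sub>m q')}),
    one = K0_rel U `` {(0\<^sub>m 0 0, 0\<^sub>m 0 0)}\<rparr>"

text \<open>The map \<open>K0_unital U \<rightarrow> K0_unital V\<close> induced by a unital homomorphism \<open>f : U \<rightarrow> V\<close>.\<close>
definition K0_unital_map ::
    "'b :: star_algebra set \<Rightarrow> ('a :: star_algebra \<Rightarrow> 'b) \<Rightarrow> ('a mat \<times> 'a mat) set \<Rightarrow> ('b mat \<times> 'b mat) set" where
  "K0_unital_map V f X = (\<Union>(p, q)\<in>X. K0_rel V `` {(map_mat f p, map_mat f q)})"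

text \<open>\<open>K0 B\<close> is the kernel of the map that the projection of the unitization of \<open>B\<close> onto the scalars
  induces. \<open>K0_map C f\<close> is the map \<open>K0 B \<rightarrow> K0 C\<close> induced by \<open>f : B \<rightarrow> C\<close>.\<close>
definition K0 :: "'a :: star_algebra set \<Rightarrow> ('a unitization mat \<times> 'a unitization mat) set monoid" where
  "K0 B = (K0_unital (unitize B))\<lparr>carrier :=
    kernel (K0_unital (unitize B)) (K0_unital (UNIV :: complex set)) (K0_unital_map UNIV scalar_part)\<rparr>"

definition K0_map ::
    "'b :: star_algebra set \<Rightarrow> ('a :: star_algebra \<Rightarrow> 'b) \<Rightarrow>
      ('a unitization mat \<times> 'a unitization mat) set \<Rightarrow> ('b unitization mat \<times> 'b unitization mat) set" where
  "K0_map C f = K0_unital_map (unitize C) (unitize_map f)"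

definition K0_class ::
    "'a :: star_algebra set \<Rightarrow> 'a \<Rightarrow> ('a unitization mat \<times> 'a unitization mat) set" where
  "K0_class B p = K0_rel (unitize B) `` {(mat 1 1 (\<lambda>_. Unitization p 0), 0\<^sub>m 0 0)}"

text \<open>For a rank one projection \<open>e\<close> the homomorphism \<open>b \<mapsto> b \<otimes> e\<close> induces the isomorphism from \<open>K0 B\<close>
  to \<open>K0 (B \<otimes> \<K>)\<close> by which the two groups are identified. Under these identifications \<open>\<phi>\<close> is the
  isomorphism induced by the isomorphism \<open>\<Phi>\<close> of stabilizations.\<close>
definition induced_K0_iso ::
    "'i bop set \<Rightarrow> 'j bop set \<Rightarrow> (('i \<times> nat) bop \<Rightarrow> ('j \<times> nat) bop) \<Rightarrow>
      (('i bop unitization mat \<times> 'i bop unitization mat) set \<Rightarrow>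
       ('j bop unitization mat \<times> 'j bop unitization mat) set) \<Rightarrow> bool" where
  "induced_K0_iso B C \<Phi> \<phi> \<longleftrightarrow>
    \<phi> \<in> iso (K0 B) (K0 C) \<and>
    (\<forall>e. rank_one_projection e \<longrightarrow>
      (\<forall>x\<in>carrier (K0 B).
        K0_map (C \<otimes>\<^sub>C \<K>) (\<lambda>c. c \<otimes>\<^sub>B e) (\<phi> x) =
        K0_map (C \<otimes>\<^sub>C \<K>) \<Phi> (K0_map (B \<otimes>\<^sub>C \<K>) (\<lambda>b. b \<otimes>\<^sub>B e) x)))"


section \<open>The projection E_A\<close>

definition E_A :: "nat \<Rightarrow> (nat \<Rightarrow> 'j bop) \<Rightarrow> (nat \<Rightarrow> 'i bop) \<Rightarrow> ('j \<times> 'i) bop" where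
  "E_A N T S = (\<Sum>i<N. (star (T i) * T i) \<otimes>\<^sub>B (S i * star (S i)))"

end

theory Submission
  imports Defs
begin

text \<open>Since the graph of \<open>A\<close> is strongly connected and has a vertex with two outgoing edges, each range projection
  \<open>S\<^sub>i S\<^sub>i\<^sup>*\<close> of \<open>OA\<close> dominates the range of an isometry of \<open>OA\<close>, and similarly for \<open>OAt\<close>. The tensor product of
  two such isometries is an isometry \<open>w\<close> of \<open>D = OAt \<otimes> OA\<close> with \<open>w w\<^sup>* \<le> E\<close>. Hence compression by \<open>w\<close> is an
  inverse on \<open>K0\<close> of the inclusion of the corner \<open>R = E D E\<close> into \<open>D\<close>. As the stabilization of \<open>1\<close> absorbs that of
  \<open>f = E - w w\<^sup>*\<close>, there is an explicit isometry \<open>v\<close> on \<open>H \<otimes> \<ell>\<^sup>2(\<nat>)\<close> with range projection \<open>E \<otimes> 1\<close> which multiplies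
  \<open>D \<otimes> \<K>\<close>, and \<open>\<Phi> x = v\<^sup>* x v\<close> is an isomorphism of the stabilizations that induces the same map on \<open>K0\<close> as the
  inclusion.\<close>

section \<open>Projections in matrix algebras\<close>

text \<open>Both claims about K0 rest on one fact, \<open>K0_map_conj\<close>: conjugation by a
  partial isometry of the target algebra whose initial projection supports the image changes nothing
  on K0. The obstacle is that K0 is defined through unitizations. A conjugation extends to a map
  that fixes the scalars, which is no longer a conjugation, so the equivalence is built with an
  auxiliary summand that is cancelled afterwards. The isometry \<open>v\<close> is only a multiplier
  of the stabilized algebra, so that fact does not apply to it. Its adjoint cut down by
  \<open>E \<otimes>\<^sub>B e\<close> belongs to the algebra and acts in the same way on all
  elements \<open>b \<otimes>\<^sub>B e\<close> with \<open>b\<close> in the corner. The first legs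
  of \<open>E\<close> are initial projections \<open>star (T i) * T i\<close>, not range
  projections. Each of them dominates the range projection of \<open>T j\<close> for every edge from
  \<open>i\<close> to \<open>j\<close> in the transposed graph, so an isometry below that range
  projection, tensored with one below the range projection of \<open>S i\<close>, lies below
  \<open>E\<close>.\<close>

lemma star_algebra_zero [simp]:
  "c *\<^sub>C (0 :: 'a :: star_algebra) = 0" "0 *\<^sub>C x = (0 :: 'a)" "star (0 :: 'a) = 0"
proof -
  show "c *\<^sub>C (0 :: 'a) = 0"
    using scaleC_add_right[of c "0 :: 'a" 0] by simp
  show "0 *\<^sub>C x = (0 :: 'a)"
    using scaleC_add_left[of 0 0 x] by simp
  show "star (0 :: 'a) = 0"
    using star_add[of "0 :: 'a" 0] by simp
qed

lemma star_one [simp]: "star (1 :: 'a :: star_algebra) = 1"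
  by (metis mult_1 mult_1_right star_mult star_star)

lemma star_uminus: "star (- x) = - star (x :: 'a :: star_algebra)"
  using star_add[of x "- x"] by (simp add: eq_neg_iff_add_eq_0 add.commute)

lemma star_diff: "star (x - y) = star x - star (y :: 'a :: star_algebra)"
  using star_add[of x "- y"] by (simp add: star_uminus)

lemma star_sum: "star (sum f F) = (\<Sum>i\<in>F. star (f i :: 'a :: star_algebra))"
  by (induction F rule: infinite_finite_induct) (auto simp: star_add)

lemma scaleC_minus_one: "(-1) *\<^sub>C x = - (x :: 'a :: star_algebra)"
  using scaleC_add_left[of 1 "-1" x] by (simp add: scaleC_one eq_neg_iff_add_eq_0 add.commute)

section \<open>Star-closed subrings and matrices over them\<close>

definition star_subring :: "'a :: star_algebra set \<Rightarrow> bool" where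
  "star_subring U \<longleftrightarrow> 0 \<in> U \<and> 1 \<in> U \<and> (\<forall>x\<in>U. \<forall>y\<in>U. x + y \<in> U \<and> x * y \<in> U) \<and> (\<forall>x\<in>U. - x \<in> U \<and> star x \<in> U)"

lemma star_subringD:
  assumes "star_subring U"
  shows "0 \<in> U" "1 \<in> U" "x \<in> U \<Longrightarrow> y \<in> U \<Longrightarrow> x + y \<in> U" "x \<in> U \<Longrightarrow> y \<in> U \<Longrightarrow> x * y \<in> U"
    "x \<in> U \<Longrightarrow> - x \<in> U" "x \<in> U \<Longrightarrow> star x \<in> U" "x \<in> U \<Longrightarrow> y \<in> U \<Longrightarrow> x - y \<in> U"
  using assms unfolding star_subring_def diff_conv_add_uminus by blast+

lemma star_subring_sum:
  "star_subring U \<Longrightarrow> (\<And>i. i \<in> F \<Longrightarrow> f i \<in> U) \<Longrightarrow> sum f F \<in> U"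
  by (induction F rule: infinite_finite_induct) (auto simp: star_subringD)

lemma elements_mat_subset_iff:
  "elements_mat M \<subseteq> U \<longleftrightarrow> (\<forall>i<dim_row M. \<forall>j<dim_col M. M $$ (i, j) \<in> U)"
proof
  assume "elements_mat M \<subseteq> U"
  then show "\<forall>i<dim_row M. \<forall>j<dim_col M. M $$ (i, j) \<in> U"
    by (metis carrier_matI elements_matI subsetD)
qed (auto dest!: elements_matD)

lemma elements_mat_mult:
  assumes "star_subring U" "elements_mat P \<subseteq> U" "elements_mat Q \<subseteq> U" "dim_col P = dim_row Q"
  shows "elements_mat (P * Q) \<subseteq> U"
  using assms by (auto simp: elements_mat_subset_iff scalar_prod_def intro!: star_subring_sum star_subringD(4))

lemma mat_star_dim [simp]: "dim_row (mat_star M) = dim_col M" "dim_col (mat_star M) = dim_row M"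
  by (auto simp: mat_star_def)

lemma mat_star_index [simp]:
  "i < dim_col M \<Longrightarrow> j < dim_row M \<Longrightarrow> mat_star M $$ (i, j) = star (M $$ (j, i))"
  by (auto simp: mat_star_def)

lemma mat_star_carrier [simp]: "M \<in> carrier_mat m n \<Longrightarrow> mat_star M \<in> carrier_mat n m"
  by (intro carrier_matI) simp_all

lemma mat_star_star [simp]: "mat_star (mat_star M) = M"
  by (rule eq_matI) (auto simp: star_star)

lemma mat_star_zero [simp]: "mat_star (0\<^sub>m m n) = 0\<^sub>m n m"
  by (rule eq_matI) auto

lemma mat_star_mult: "dim_col P = dim_row Q \<Longrightarrow> mat_star (P * Q) = mat_star Q * mat_star P"
  by (rule eq_matI) (auto simp: scalar_prod_def star_sum star_mult)

lemma mat_star_four_block: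
  assumes "P \<in> carrier_mat a c" "Q \<in> carrier_mat a d" "R \<in> carrier_mat b c" "S \<in> carrier_mat b d"
  shows "mat_star (four_block_mat P Q R S) = four_block_mat (mat_star P) (mat_star R) (mat_star Q) (mat_star S)"
  by (rule eq_matI) (use assms in auto)

lemma elements_mat_star: "star_subring U \<Longrightarrow> elements_mat M \<subseteq> U \<Longrightarrow> elements_mat (mat_star M) \<subseteq> U"
  by (auto simp: elements_mat_subset_iff star_subringD)

lemma elements_four_block:
  assumes "P \<in> carrier_mat a c" "Q \<in> carrier_mat a d" "R \<in> carrier_mat b c" "S \<in> carrier_mat b d"
    and "elements_mat P \<subseteq> U" "elements_mat Q \<subseteq> U" "elements_mat R \<subseteq> U" "elements_mat S \<subseteq> U"
  shows "elements_mat (four_block_mat P Q R S) \<subseteq> U"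
  using assms by (auto simp: elements_mat_subset_iff)

lemma direct_sum_eq:
  "p \<oplus>\<^sub>m q = four_block_mat p (0\<^sub>m (dim_row p) (dim_col q)) (0\<^sub>m (dim_row q) (dim_col p)) q"
  by (simp only: diag_block_mat.simps(2)[of p "[q]"] diag_block_mat_singleton Let_def)

lemma diag_block_mat_Cons: "diag_block_mat (p # ps) = p \<oplus>\<^sub>m diag_block_mat ps"
  unfolding direct_sum_eq by (simp add: Let_def)

lemma diag_block_mat_append': "diag_block_mat (ps @ qs) = diag_block_mat ps \<oplus>\<^sub>m diag_block_mat qs"
  unfolding direct_sum_eq diag_block_mat_append by (simp add: Let_def)

text \<open>A direct sum abbreviates \<open>diag_block_mat\<close> of a two-element list, so this
  rule would rewrite every direct sum into block form.\<close>

declare diag_block_mat.simps(2) [simp del]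

lemma mat_projectionsD:
  assumes "p \<in> mat_projections U"
  shows "dim_col p = dim_row p" "elements_mat p \<subseteq> U" "p * p = p" "mat_star p = p"
  using assms unfolding mat_projections_def carrier_mat_def by simp_all

lemma mat_projectionsI:
  assumes "p \<in> carrier_mat n n" "elements_mat p \<subseteq> U" "p * p = p" "mat_star p = p"
  shows "p \<in> mat_projections U"
  using assms unfolding mat_projections_def carrier_mat_def by simp

lemma elements_mat_zero: "0 \<in> U \<Longrightarrow> elements_mat (0\<^sub>m m n) \<subseteq> U"
  by (simp add: elements_mat_subset_iff)

lemma mat_projections_direct_sum:
  assumes U: "star_subring U" and p: "p \<in> mat_projections U" and q: "q \<in> mat_projections U"
  shows "p \<oplus>\<^sub>m q \<in> mat_projections U"
proof -
  note P = mat_projectionsD[OF p] and Q = mat_projectionsD[OF q]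
  define m n where "m = dim_row p" and "n = dim_row q"
  have pc: "p \<in> carrier_mat m m" and qc: "q \<in> carrier_mat n n"
    using P(1) Q(1) by (auto intro!: carrier_matI simp: m_def n_def)
  have eq: "p \<oplus>\<^sub>m q = four_block_mat p (0\<^sub>m m n) (0\<^sub>m n m) q"
    using pc qc by (simp add: direct_sum_eq)
  show ?thesis
  proof (rule mat_projectionsI)
    show "p \<oplus>\<^sub>m q \<in> carrier_mat (m + n) (m + n)"
      unfolding eq using pc qc by simp
    show "elements_mat (p \<oplus>\<^sub>m q) \<subseteq> U"
      unfolding eq
      by (rule elements_four_block[OF pc _ _ qc P(2) _ _ Q(2)])
        (simp_all add: elements_mat_zero star_subringD(1)[OF U])
    show "(p \<oplus>\<^sub>m q) * (p \<oplus>\<^sub>m q) = p \<oplus>\<^sub>m q"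
      unfolding eq using pc qc P(3) Q(3)
      by (simp add: mult_four_block_mat[OF pc zero_carrier_mat zero_carrier_mat qc pc zero_carrier_mat zero_carrier_mat qc])
    show "mat_star (p \<oplus>\<^sub>m q) = p \<oplus>\<^sub>m q"
      unfolding eq using P(4) Q(4)
      by (simp add: mat_star_four_block[OF pc zero_carrier_mat zero_carrier_mat qc])
  qed
qed

lemma mat_projections_empty [simp]: "0\<^sub>m 0 0 \<in> mat_projections U"
  by (rule mat_projectionsI[of _ 0]) (auto simp: elements_mat_subset_iff)

lemma mat_projections_diag_block:
  "star_subring U \<Longrightarrow> set ps \<subseteq> mat_projections U \<Longrightarrow> diag_block_mat ps \<in> mat_projections U"
proof (induction ps)
  case (Cons p ps)
  then show ?case
    unfolding diag_block_mat_Cons[of p ps] by (intro mat_projections_direct_sum) simp_all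
qed simp

section \<open>Murray--von Neumann equivalence and direct sums\<close>

lemma mvn_equivI:
  assumes "v \<in> carrier_mat (dim_row q) (dim_row p)" "elements_mat v \<subseteq> U" "mat_star v * v = p" "v * mat_star v = q"
  shows "mvn_equiv U p q"
  using assms by (auto simp: mvn_equiv_def)

lemma mvn_refl: "p \<in> mat_projections U \<Longrightarrow> mvn_equiv U p p"
  using mat_projectionsD[of p U] by (intro mvn_equivI[of p] carrier_matI) simp_all

lemma mvn_sym:
  assumes "star_subring U" "mvn_equiv U p q"
  shows "mvn_equiv U q p"
proof -
  obtain v where "v \<in> carrier_mat (dim_row q) (dim_row p)" "elements_mat v \<subseteq> U"
    "mat_star v * v = p" "v * mat_star v = q"
    using assms by (auto simp: mvn_equiv_def)
  then show ?thesis
    using elements_mat_star[OF assms(1)] by (intro mvn_equivI[of "mat_star v"]) auto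
qed

text \<open>The witnesses compose to \<open>w * v\<close>. The middle projection is moved across by
  \<open>q * v = v * p\<close>, both sides being bracketings of \<open>v * mat_star v * v\<close>;
  the same holds for \<open>w\<close>.\<close>

lemma mvn_trans:
  assumes U: "star_subring U" and p: "p \<in> mat_projections U" and r: "r \<in> mat_projections U"
    and pq: "mvn_equiv U p q" and qr: "mvn_equiv U q r"
  shows "mvn_equiv U p r"
proof -
  define a b c where "a = dim_row p" and "b = dim_row q" and "c = dim_row r"
  obtain v where v: "v \<in> carrier_mat b a" "elements_mat v \<subseteq> U" "mat_star v * v = p" "v * mat_star v = q"
    using pq by (auto simp: mvn_equiv_def a_def b_def)
  obtain w where w: "w \<in> carrier_mat c b" "elements_mat w \<subseteq> U" "mat_star w * w = q" "w * mat_star w = r"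
    using qr by (auto simp: mvn_equiv_def c_def b_def)
  note [simp] = mat_star_carrier[OF v(1)] mat_star_carrier[OF w(1)] v(1) w(1)
  have [simp]: "w * v \<in> carrier_mat c a" "mat_star v * mat_star w \<in> carrier_mat a c"
    using mult_carrier_mat[OF w(1) v(1)] mult_carrier_mat[OF mat_star_carrier[OF v(1)] mat_star_carrier[OF w(1)]]
    by auto
  have st: "mat_star (w * v) = mat_star v * mat_star w"
    by (rule mat_star_mult) (simp only: carrier_matD[OF v(1)] carrier_matD[OF w(1)])
  have pc: "p \<in> carrier_mat a a" and rc: "r \<in> carrier_mat c c"
    using mat_projectionsD(1)[OF p] mat_projectionsD(1)[OF r] by (auto intro!: carrier_matI simp: a_def c_def)
  have q: "q \<in> carrier_mat b b" unfolding v(4)[symmetric] by (rule mult_carrier_mat[OF v(1) mat_star_carrier[OF v(1)]])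
  have "mat_star (w * v) * (w * v) = mat_star v * (mat_star w * (w * v))"
    unfolding st by (rule assoc_mult_mat[of _ a b _ c _ a]) simp_all
  also have "mat_star w * (w * v) = q * v"
    unfolding w(3)[symmetric] by (rule assoc_mult_mat[symmetric, of _ b c _ b _ a]) auto
  also have "q * v = v * p"
    unfolding v(3,4)[symmetric] by (rule assoc_mult_mat[of _ b a _ b _ a]) auto
  also have "mat_star v * (v * p) = p * p"
    using v(3) pc by (subst assoc_mult_mat[symmetric, of _ a b _ a _ a]) simp_all
  finally have 1: "mat_star (w * v) * (w * v) = p"
    using mat_projectionsD(3)[OF p] by simp
  have "(w * v) * mat_star (w * v) = w * (v * (mat_star v * mat_star w))"
    unfolding st by (rule assoc_mult_mat[of _ c b _ a _ c]) simp_all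
  also have "v * (mat_star v * mat_star w) = q * mat_star w"
    unfolding v(4)[symmetric] by (rule assoc_mult_mat[symmetric, of _ b a _ b _ c]) auto
  also have "q * mat_star w = mat_star w * r"
    unfolding w(3,4)[symmetric] by (rule assoc_mult_mat[of _ b c _ b _ c]) auto
  also have "w * (mat_star w * r) = r * r"
    using w(4) rc by (subst assoc_mult_mat[symmetric, of _ c b _ c _ c]) simp_all
  finally have 2: "(w * v) * mat_star (w * v) = r"
    using mat_projectionsD(3)[OF r] by simp
  show ?thesis
  proof (rule mvn_equivI[OF _ _ 1 2])
    show "w * v \<in> carrier_mat (dim_row r) (dim_row p)"
      unfolding a_def[symmetric] c_def[symmetric] by (rule mult_carrier_mat[OF w(1) v(1)])
    show "elements_mat (w * v) \<subseteq> U"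
      using carrier_matD(1)[OF v(1)] carrier_matD(2)[OF w(1)] by (intro elements_mat_mult[OF U w(2) v(2)]) (simp only:)
  qed
qed

lemma mvn_direct_sum:
  assumes U: "star_subring U" and "mvn_equiv U p p'" "mvn_equiv U q q'"
  shows "mvn_equiv U (p \<oplus>\<^sub>m q) (p' \<oplus>\<^sub>m q')"
proof -
  define a b c d where "a = dim_row p" and "b = dim_row q" and "c = dim_row p'" and "d = dim_row q'"
  obtain v where v: "v \<in> carrier_mat c a" "elements_mat v \<subseteq> U" "mat_star v * v = p" "v * mat_star v = p'"
    using assms by (auto simp: mvn_equiv_def a_def c_def)
  obtain w where w: "w \<in> carrier_mat d b" "elements_mat w \<subseteq> U" "mat_star w * w = q" "w * mat_star w = q'"
    using assms by (auto simp: mvn_equiv_def d_def b_def)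
  define V where "V = four_block_mat v (0\<^sub>m c b) (0\<^sub>m d a) w"
  have sV: "mat_star V = four_block_mat (mat_star v) (0\<^sub>m a d) (0\<^sub>m b c) (mat_star w)"
    unfolding V_def using v(1) w(1) by (subst mat_star_four_block) auto
  have dims: "dim_row p = a" "dim_col p = a" "dim_row q = b" "dim_col q = b"
    "dim_row p' = c" "dim_col p' = c" "dim_row q' = d" "dim_col q' = d"
    using v(1) w(1) by (auto simp: v(3,4)[symmetric] w(3,4)[symmetric])
  have pc: "p \<in> carrier_mat a a" "q \<in> carrier_mat b b" "p' \<in> carrier_mat c c" "q' \<in> carrier_mat d d"
    using dims by auto
  show ?thesis
  proof (rule mvn_equivI)
    show "V \<in> carrier_mat (dim_row (p' \<oplus>\<^sub>m q')) (dim_row (p \<oplus>\<^sub>m q))"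
      unfolding direct_sum_eq V_def using v(1) w(1) dims by auto
    show "elements_mat V \<subseteq> U"
      unfolding V_def using v w star_subringD(1)[OF U]
      by (intro elements_four_block) (auto simp: elements_mat_subset_iff)
    have "mat_star V * V = four_block_mat p (0\<^sub>m a b) (0\<^sub>m b a) q"
      unfolding sV unfolding V_def
      by (subst mult_four_block_mat[of _ a c _ d _ b _ _ a _ b]) (use v w pc in auto)
    then show "mat_star V * V = p \<oplus>\<^sub>m q" by (simp add: direct_sum_eq dims)
    have "V * mat_star V = four_block_mat p' (0\<^sub>m c d) (0\<^sub>m d c) q'"
      unfolding sV unfolding V_def
      by (subst mult_four_block_mat[of _ c a _ b _ d _ _ c _ d]) (use v w pc in auto)
    then show "V * mat_star V = p' \<oplus>\<^sub>m q'" by (simp add: direct_sum_eq dims)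
  qed
qed

text \<open>The witness is the flip of the two summands, cut down to the projections: its
  off-diagonal blocks are \<open>q\<close> and \<open>p\<close> themselves.\<close>

lemma mvn_direct_sum_commute:
  assumes U: "star_subring U" and p: "p \<in> mat_projections U" and q: "q \<in> mat_projections U"
  shows "mvn_equiv U (p \<oplus>\<^sub>m q) (q \<oplus>\<^sub>m p)"
proof -
  note P = mat_projectionsD[OF p] and Q = mat_projectionsD[OF q]
  define m n where "m = dim_row p" and "n = dim_row q"
  have pc: "p \<in> carrier_mat m m" and qc: "q \<in> carrier_mat n n"
    using P(1) Q(1) by (auto intro!: carrier_matI simp: m_def n_def)
  define V where "V = four_block_mat (0\<^sub>m n m) q p (0\<^sub>m m n)"
  have sV: "mat_star V = four_block_mat (0\<^sub>m m n) p q (0\<^sub>m n m)"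
    unfolding V_def using pc qc P(4) Q(4) by (subst mat_star_four_block) auto
  have pq: "p \<oplus>\<^sub>m q = four_block_mat p (0\<^sub>m m n) (0\<^sub>m n m) q"
    using pc qc by (simp add: direct_sum_eq)
  have qp: "q \<oplus>\<^sub>m p = four_block_mat q (0\<^sub>m n m) (0\<^sub>m m n) p"
    using pc qc by (simp add: direct_sum_eq)
  show ?thesis
  proof (rule mvn_equivI)
    show "V \<in> carrier_mat (dim_row (q \<oplus>\<^sub>m p)) (dim_row (p \<oplus>\<^sub>m q))"
      unfolding pq qp V_def using pc qc by auto
    show "elements_mat V \<subseteq> U"
      unfolding V_def using pc qc P(2) Q(2) star_subringD(1)[OF U]
      by (intro elements_four_block) (auto simp: elements_mat_subset_iff)
    show "mat_star V * V = p \<oplus>\<^sub>m q"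
      unfolding sV pq unfolding V_def
      by (subst mult_four_block_mat[of _ m n _ m _ n _ _ m _ n]) (use pc qc P Q in auto)
    show "V * mat_star V = q \<oplus>\<^sub>m p"
      unfolding sV qp unfolding V_def
      by (subst mult_four_block_mat[of _ n m _ n _ m _ _ n _ m]) (use pc qc P Q in auto)
  qed
qed

text \<open>This licenses the passage from lists of summands to multisets. In the induction the head
  \<open>p\<close> is moved past the summands \<open>as\<close> that precede its occurrence in
  \<open>qs\<close>.\<close>

lemma mvn_diag_block_perm:
  assumes U: "star_subring U"
  shows "mset ps = mset qs \<Longrightarrow> set ps \<subseteq> mat_projections U \<Longrightarrow> mvn_equiv U (diag_block_mat ps) (diag_block_mat qs)"
proof (induction ps arbitrary: qs)
  case Nil
  then show ?case by (auto intro: mvn_refl)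
next
  case (Cons p ps)
  have "p \<in> set qs" using Cons.prems(1) by (metis list.set_intros(1) set_mset_mset)
  then obtain as bs where qs: "qs = as @ p # bs" by (auto simp: in_set_conv_decomp)
  have ms: "mset ps = mset (as @ bs)" using Cons.prems(1) by (simp add: qs)
  have sets: "set ps \<subseteq> mat_projections U" "p \<in> mat_projections U" "set as \<subseteq> mat_projections U"
    "set bs \<subseteq> mat_projections U" "set qs \<subseteq> mat_projections U"
    using Cons.prems(2) mset_eq_setD[OF ms] mset_eq_setD[OF Cons.prems(1)] by auto
  note mem = mat_projections_diag_block[OF U] mat_projections_direct_sum[OF U]
  have 1: "mvn_equiv U (p \<oplus>\<^sub>m diag_block_mat ps) (p \<oplus>\<^sub>m diag_block_mat (as @ bs))"
    using Cons.IH[OF ms sets(1)] sets by (intro mvn_direct_sum U mvn_refl)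
  have 2: "p \<oplus>\<^sub>m diag_block_mat (as @ bs) = (p \<oplus>\<^sub>m diag_block_mat as) \<oplus>\<^sub>m diag_block_mat bs"
    unfolding diag_block_mat_Cons[of p as, symmetric] diag_block_mat_Cons[of p "as @ bs", symmetric]
      diag_block_mat_append'[symmetric] by simp
  have 3: "mvn_equiv U ((p \<oplus>\<^sub>m diag_block_mat as) \<oplus>\<^sub>m diag_block_mat bs) ((diag_block_mat as \<oplus>\<^sub>m p) \<oplus>\<^sub>m diag_block_mat bs)"
    using sets by (intro mvn_direct_sum U mvn_direct_sum_commute mvn_refl mem)
  have 4: "(diag_block_mat as \<oplus>\<^sub>m p) \<oplus>\<^sub>m diag_block_mat bs = diag_block_mat qs"
    using diag_block_mat_append'[of "as @ [p]" bs] diag_block_mat_append'[of as "[p]"]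
    by (simp only: qs diag_block_mat_singleton append_assoc append.simps)
  show ?case unfolding diag_block_mat_Cons[of p ps]
    by (rule mvn_trans[OF U _ _ 1]) (use 3 sets in \<open>auto simp: 2 4 intro!: mem\<close>)
qed

section \<open>The group K0\<close>

text \<open>This says that the sums of the classes of \<open>X\<close> and of \<open>Y\<close> agree in \<open>K0\<close>. With multisets, the commutativity of
  direct sums up to equivalence becomes an equality.\<close>
definition stably_equiv :: "'a :: star_algebra set \<Rightarrow> 'a mat multiset \<Rightarrow> 'a mat multiset \<Rightarrow> bool" where
  "stably_equiv U X Y \<longleftrightarrow>
    set_mset X \<subseteq> mat_projections U \<and> set_mset Y \<subseteq> mat_projections U \<and>
    (\<exists>Z xs ys. set_mset Z \<subseteq> mat_projections U \<and> mset xs = X + Z \<and> mset ys = Y + Z \<and>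
      mvn_equiv U (diag_block_mat xs) (diag_block_mat ys))"

lemma stably_equivE:
  assumes "stably_equiv U X Y"
  obtains Z xs ys where "set_mset X \<subseteq> mat_projections U" "set_mset Y \<subseteq> mat_projections U"
    "set_mset Z \<subseteq> mat_projections U" "mset xs = X + Z" "mset ys = Y + Z"
    "mvn_equiv U (diag_block_mat xs) (diag_block_mat ys)"
    "set xs \<subseteq> mat_projections U" "set ys \<subseteq> mat_projections U"
  using assms unfolding stably_equiv_def by (metis le_sup_iff set_mset_mset set_mset_union)

lemma stably_equivI:
  assumes "set xs \<subseteq> mat_projections U" "set ys \<subseteq> mat_projections U"
    and "mvn_equiv U (diag_block_mat xs) (diag_block_mat ys)"
    and "mset xs = X + Z" "mset ys = Y + Z"
  shows "stably_equiv U X Y"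
proof -
  have "set_mset X \<subseteq> mat_projections U" "set_mset Y \<subseteq> mat_projections U" "set_mset Z \<subseteq> mat_projections U"
    using assms(1,2) unfolding set_mset_mset[symmetric] assms(4,5) by simp_all
  with assms show ?thesis unfolding stably_equiv_def by blast
qed

lemma stably_equiv_mvn:
  assumes "set xs \<subseteq> mat_projections U" "set ys \<subseteq> mat_projections U"
    and "mvn_equiv U (diag_block_mat xs) (diag_block_mat ys)"
  shows "stably_equiv U (mset xs) (mset ys)"
  using assms by (rule stably_equivI[where Z = "{#}"]) simp_all

lemma stably_equiv_refl: "set_mset X \<subseteq> mat_projections U \<Longrightarrow> star_subring U \<Longrightarrow> stably_equiv U X X"
  by (metis ex_mset mat_projections_diag_block mvn_refl set_mset_mset stably_equiv_mvn)

lemma stably_equiv_sym: "star_subring U \<Longrightarrow> stably_equiv U X Y \<Longrightarrow> stably_equiv U Y X"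
  by (erule stably_equivE, rule stably_equivI) (auto intro: mvn_sym)

lemma stably_equiv_add:
  assumes U: "star_subring U" and "stably_equiv U X Y" "stably_equiv U X' Y'"
  shows "stably_equiv U (X + X') (Y + Y')"
proof -
  obtain Z xs ys where 1: "mset xs = X + Z" "mset ys = Y + Z"
    "mvn_equiv U (diag_block_mat xs) (diag_block_mat ys)"
    "set xs \<subseteq> mat_projections U" "set ys \<subseteq> mat_projections U"
    using assms(2) by (rule stably_equivE)
  obtain Z' xs' ys' where 2: "mset xs' = X' + Z'" "mset ys' = Y' + Z'"
    "mvn_equiv U (diag_block_mat xs') (diag_block_mat ys')"
    "set xs' \<subseteq> mat_projections U" "set ys' \<subseteq> mat_projections U"
    using assms(3) by (rule stably_equivE)
  show ?thesis
    by (rule stably_equivI[of "xs @ xs'" _ "ys @ ys'" _ "Z + Z'"])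
      (use 1 2 in \<open>auto simp: diag_block_mat_append' intro: mvn_direct_sum[OF U]\<close>)
qed

text \<open>The arbitrary multiset \<open>Z\<close> in the definition absorbs \<open>W\<close>;
  cancellation is built into stable equivalence.\<close>

lemma stably_equiv_cancel:
  assumes U: "star_subring U" and "stably_equiv U (X + W) (Y + W)"
  shows "stably_equiv U X Y"
proof -
  obtain Z xs ys where 1: "mset xs = X + W + Z" "mset ys = Y + W + Z"
    "mvn_equiv U (diag_block_mat xs) (diag_block_mat ys)"
    "set xs \<subseteq> mat_projections U" "set ys \<subseteq> mat_projections U"
    using assms(2) by (rule stably_equivE)
  then show ?thesis
    by (intro stably_equivI[of xs _ ys _ "W + Z"]) (simp_all add: ac_simps)
qed

text \<open>Adding the two equivalences gives \<open>X + Y\<close> against \<open>Y + W\<close>, and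
  \<open>Y\<close> cancels. The orders of the lists in the two witnesses never have to be
  matched.\<close>

lemma stably_equiv_trans:
  assumes U: "star_subring U" and "stably_equiv U X Y" "stably_equiv U Y W"
  shows "stably_equiv U X W"
  by (rule stably_equiv_cancel[OF U, of _ Y])
    (use stably_equiv_add[OF assms] in \<open>simp add: ac_simps\<close>)

lemma stably_equiv_direct_sum:
  assumes U: "star_subring U" and "p \<in> mat_projections U" "q \<in> mat_projections U"
  shows "stably_equiv U {#p \<oplus>\<^sub>m q#} {#p, q#}"
  using stably_equiv_mvn[of "[p \<oplus>\<^sub>m q]" U "[p, q]"] assms
  by (simp add: mat_projections_direct_sum mvn_refl)

lemma direct_sum_assoc3: "p \<oplus>\<^sub>m q \<oplus>\<^sub>m r = diag_block_mat [p, q, r]"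
  by (rule diag_block_mat_Cons[symmetric])

text \<open>The two descriptions differ in that \<open>K0_rel\<close> has one stabilizing projection
  and a fixed order of summands. The multiset \<open>Z\<close> is collapsed to the block sum of its
  members, and the fixed order is reached by permuting the summands on both sides.\<close>

lemma K0_rel_iff:
  assumes U: "star_subring U"
  shows "((p, q), (p', q')) \<in> K0_rel U \<longleftrightarrow>
    p \<in> mat_projections U \<and> q \<in> mat_projections U \<and> p' \<in> mat_projections U \<and> q' \<in> mat_projections U \<and>
    stably_equiv U {#p, q'#} {#p', q#}" (is "_ \<longleftrightarrow> ?P \<and> ?Q \<and> ?P' \<and> ?Q' \<and> ?S")
proof -
  have "(\<exists>r\<in>mat_projections U. mvn_equiv U (p \<oplus>\<^sub>m q' \<oplus>\<^sub>m r) (p' \<oplus>\<^sub>m q \<oplus>\<^sub>m r)) \<longleftrightarrow> ?S"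
    if P: ?P ?Q ?P' ?Q'
  proof
    assume "\<exists>r\<in>mat_projections U. mvn_equiv U (p \<oplus>\<^sub>m q' \<oplus>\<^sub>m r) (p' \<oplus>\<^sub>m q \<oplus>\<^sub>m r)"
    then obtain r where r: "r \<in> mat_projections U"
      and "mvn_equiv U (diag_block_mat [p, q', r]) (diag_block_mat [p', q, r])"
      by (auto simp: direct_sum_assoc3)
    then show ?S
      using P by (intro stably_equivI[of "[p, q', r]" _ "[p', q, r]" _ "{#r#}"]) auto
  next
    assume ?S
    then obtain Z xs ys where 1: "mset xs = {#p, q'#} + Z" "mset ys = {#p', q#} + Z"
      "mvn_equiv U (diag_block_mat xs) (diag_block_mat ys)" "set_mset Z \<subseteq> mat_projections U"
      "set xs \<subseteq> mat_projections U" "set ys \<subseteq> mat_projections U"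
      by (rule stably_equivE)
    obtain zs where zs: "mset zs = Z" using ex_mset by blast
    have zs': "set zs \<subseteq> mat_projections U" using 1(4) zs by (metis set_mset_mset)
    note mem = mat_projections_diag_block[OF U]
    have flat: "a \<oplus>\<^sub>m b \<oplus>\<^sub>m diag_block_mat zs = diag_block_mat (a # b # zs)" for a b
      by (simp only: diag_block_mat_Cons[of b zs] diag_block_mat_Cons[of a "b # zs"])
    have A: "set (p # q' # zs) \<subseteq> mat_projections U" and B: "set (p' # q # zs) \<subseteq> mat_projections U"
      using P zs' by auto
    have "mvn_equiv U (diag_block_mat (p # q' # zs)) (diag_block_mat xs)"
      using 1 zs zs' P by (intro mvn_diag_block_perm U) auto
    note mvn_trans[OF U mem[OF A] mem[OF 1(6)] this 1(3)]
    moreover have "mvn_equiv U (diag_block_mat ys) (diag_block_mat (p' # q # zs))"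
      using 1 zs zs' P by (intro mvn_diag_block_perm U) auto
    ultimately have "mvn_equiv U (diag_block_mat (p # q' # zs)) (diag_block_mat (p' # q # zs))"
      by (rule mvn_trans[OF U mem[OF A] mem[OF B]])
    then show "\<exists>r\<in>mat_projections U. mvn_equiv U (p \<oplus>\<^sub>m q' \<oplus>\<^sub>m r) (p' \<oplus>\<^sub>m q \<oplus>\<^sub>m r)"
      using mem[OF zs'] by (intro bexI[of _ "diag_block_mat zs"]) (simp_all only: flat)
  qed
  then show ?thesis
    unfolding K0_rel_def by blast
qed

lemma equiv_K0_rel:
  assumes U: "star_subring U"
  shows "equiv (mat_projections U \<times> mat_projections U) (K0_rel U)"
proof (rule equivI)
  show "K0_rel U \<subseteq> (mat_projections U \<times> mat_projections U) \<times> mat_projections U \<times> mat_projections U"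
    by (auto simp: K0_rel_def)
  show "refl_on (mat_projections U \<times> mat_projections U) (K0_rel U)"
    by (auto simp: refl_on_def K0_rel_iff[OF U] intro!: stably_equiv_refl U)
  show "sym (K0_rel U)"
  proof (rule symI)
    fix x y assume xy: "(x, y) \<in> K0_rel U"
    obtain p q p' q' where "x = (p, q)" "y = (p', q')" by fastforce
    then show "(y, x) \<in> K0_rel U"
      using xy K0_rel_iff[OF U, of p q p' q'] K0_rel_iff[OF U, of p' q' p q] stably_equiv_sym[OF U] by blast
  qed
  show "trans (K0_rel U)"
  proof (rule transI)
    fix x y z assume xy: "(x, y) \<in> K0_rel U" and yz: "(y, z) \<in> K0_rel U"
    obtain p q p' q' p'' q'' where eq: "x = (p, q)" "y = (p', q')" "z = (p'', q'')" by fastforce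
    have 1: "stably_equiv U {#p, q'#} {#p', q#}" "stably_equiv U {#p', q''#} {#p'', q'#}"
      using xy yz K0_rel_iff[OF U] unfolding eq by blast+
    \<comment> \<open>The intermediate pair occurs once on each side of the sum of the two
      relations, and is cancelled.\<close>
    have "{#p, q'#} + {#p', q''#} = {#p, q''#} + {#p', q'#}"
      "{#p', q#} + {#p'', q'#} = {#p'', q#} + {#p', q'#}" by simp_all
    with stably_equiv_add[OF U 1] have "stably_equiv U {#p, q''#} {#p'', q#}"
      by (metis stably_equiv_cancel[OF U])
    then show "(x, z) \<in> K0_rel U"
      using xy yz K0_rel_iff[OF U] unfolding eq by blast
  qed
qed

abbreviation (input) K0_diff :: "'a :: star_algebra set \<Rightarrow> 'a mat \<Rightarrow> 'a mat \<Rightarrow> ('a mat \<times> 'a mat) set" where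
  "K0_diff U p q \<equiv> K0_rel U `` {(p, q)}"

lemma K0_diff_eqI:
  assumes "star_subring U" "((p, q), (p', q')) \<in> K0_rel U"
  shows "K0_diff U p q = K0_diff U p' q'"
  using equiv_class_eq[OF equiv_K0_rel] assms by blast

text \<open>The operations on classes are defined by unions over representatives. A class is
  nonempty, so such a union collapses once its members are shown to be independent of the
  representative.\<close>

lemma UN_K0_diff:
  assumes U: "star_subring U" and "p \<in> mat_projections U" "q \<in> mat_projections U"
    and "\<And>p' q'. ((p, q), (p', q')) \<in> K0_rel U \<Longrightarrow> F p' q' = X"
  shows "(\<Union>(p', q')\<in>K0_diff U p q. F p' q') = X"
proof -
  have "(p, q) \<in> K0_diff U p q"
    by (rule equiv_class_self[OF equiv_K0_rel[OF U]]) (use assms in auto)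
  then show ?thesis using assms(4) by fast
qed

lemma carrier_K0_unital: "carrier (K0_unital U) = {K0_diff U p q | p q. p \<in> mat_projections U \<and> q \<in> mat_projections U}"
  by (auto simp: K0_unital_def quotient_def)

lemma K0_unital_mult:
  assumes U: "star_subring U" and "p \<in> mat_projections U" "q \<in> mat_projections U"
    "p' \<in> mat_projections U" "q' \<in> mat_projections U"
  shows "K0_diff U p q \<otimes>\<^bsub>K0_unital U\<^esub> K0_diff U p' q' = K0_diff U (p \<oplus>\<^sub>m p') (q \<oplus>\<^sub>m q')"
  unfolding K0_unital_def monoid.simps
proof (intro UN_K0_diff[OF U assms(2,3)] UN_K0_diff[OF U assms(4,5)] K0_diff_eqI[OF U])
  fix a b a' b' assume 1: "((p, q), (a, b)) \<in> K0_rel U" and 2: "((p', q'), (a', b')) \<in> K0_rel U"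
  note 1 = 1[unfolded K0_rel_iff[OF U]] and 2 = 2[unfolded K0_rel_iff[OF U]]
  have sum: "stably_equiv U {#x \<oplus>\<^sub>m x', y \<oplus>\<^sub>m y'#} ({#x, y#} + {#x', y'#})"
    if "x \<in> mat_projections U" "y \<in> mat_projections U" "x' \<in> mat_projections U" "y' \<in> mat_projections U" for x y x' y'
    using stably_equiv_add[OF U stably_equiv_direct_sum[OF U, of x x'] stably_equiv_direct_sum[OF U, of y y']] that
    by (simp add: add_mset_commute)
  have "stably_equiv U ({#a, q#} + {#a', q'#}) ({#p, b#} + {#p', b'#})"
    using 1 2 by (intro stably_equiv_add U) (auto intro: stably_equiv_sym[OF U])
  then have "stably_equiv U {#a \<oplus>\<^sub>m a', q \<oplus>\<^sub>m q'#} {#p \<oplus>\<^sub>m p', b \<oplus>\<^sub>m b'#}"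
    using 1 2 by (meson sum stably_equiv_trans[OF U] stably_equiv_sym[OF U])
  then show "((a \<oplus>\<^sub>m a', b \<oplus>\<^sub>m b'), (p \<oplus>\<^sub>m p', q \<oplus>\<^sub>m q')) \<in> K0_rel U"
    using 1 2 by (auto simp: K0_rel_iff[OF U] mat_projections_direct_sum[OF U])
qed

section \<open>Functoriality for homomorphisms of star-subrings\<close>

definition star_ring_hom :: "'a :: star_algebra set \<Rightarrow> 'b :: star_algebra set \<Rightarrow> ('a \<Rightarrow> 'b) \<Rightarrow> bool" where
  "star_ring_hom U V f \<longleftrightarrow> (\<forall>x\<in>U. f x \<in> V \<and> f (star x) = star (f x)) \<and>
    (\<forall>x\<in>U. \<forall>y\<in>U. f (x + y) = f x + f y \<and> f (x * y) = f x * f y)"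

lemma star_ring_homD:
  assumes "star_ring_hom U V f"
  shows "x \<in> U \<Longrightarrow> f x \<in> V" "x \<in> U \<Longrightarrow> f (star x) = star (f x)"
    "x \<in> U \<Longrightarrow> y \<in> U \<Longrightarrow> f (x + y) = f x + f y" "x \<in> U \<Longrightarrow> y \<in> U \<Longrightarrow> f (x * y) = f x * f y"
    "0 \<in> U \<Longrightarrow> f 0 = 0"
proof -
  show "f 0 = 0" if "0 \<in> U"
    using assms that unfolding star_ring_hom_def by (metis add_cancel_right_right)
qed (use assms in \<open>auto simp: star_ring_hom_def\<close>)

lemma star_ring_hom_sum:
  assumes "star_subring U" "star_ring_hom U V f"
  shows "(\<And>i. i \<in> F \<Longrightarrow> g i \<in> U) \<Longrightarrow> f (sum g F) = (\<Sum>i\<in>F. f (g i))"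
  by (induction F rule: infinite_finite_induct)
    (auto simp: star_ring_homD[OF assms(2)] star_subringD[OF assms(1)] star_subring_sum[OF assms(1)])

lemma map_mat_mult:
  assumes U: "star_subring U" and f: "star_ring_hom U V f"
    and "elements_mat P \<subseteq> U" "elements_mat Q \<subseteq> U" "dim_col P = dim_row Q"
  shows "map_mat f (P * Q) = map_mat f P * map_mat f Q"
proof (rule eq_matI)
  fix i j assume ij: "i < dim_row (map_mat f P * map_mat f Q)" "j < dim_col (map_mat f P * map_mat f Q)"
  then have "map_mat f (P * Q) $$ (i, j) = f (\<Sum>k\<in>{0..<dim_row Q}. P $$ (i, k) * Q $$ (k, j))"
    using assms(5) by (simp add: scalar_prod_def)
  also have "\<dots> = (\<Sum>k\<in>{0..<dim_row Q}. f (P $$ (i, k)) * f (Q $$ (k, j)))"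
    using assms(3-5) ij
    by (subst star_ring_hom_sum[OF U f])
      (auto simp: elements_mat_subset_iff star_subringD(4)[OF U] star_ring_homD(4)[OF f] intro!: sum.cong)
  also have "\<dots> = (map_mat f P * map_mat f Q) $$ (i, j)"
    using ij assms(5) by (simp add: scalar_prod_def)
  finally show "map_mat f (P * Q) $$ (i, j) = (map_mat f P * map_mat f Q) $$ (i, j)" .
qed auto

lemma map_mat_star:
  "star_ring_hom U V f \<Longrightarrow> elements_mat P \<subseteq> U \<Longrightarrow> map_mat f (mat_star P) = mat_star (map_mat f P)"
  by (rule eq_matI) (auto simp: elements_mat_subset_iff star_ring_homD(2))

lemma elements_map_mat:
  "star_ring_hom U V f \<Longrightarrow> elements_mat P \<subseteq> U \<Longrightarrow> elements_mat (map_mat f P) \<subseteq> V"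
  by (auto simp: elements_mat_subset_iff star_ring_homD(1))

lemma map_mat_projections:
  assumes U: "star_subring U" and f: "star_ring_hom U V f" and p: "p \<in> mat_projections U"
  shows "map_mat f p \<in> mat_projections V"
proof -
  note P = mat_projectionsD[OF p]
  show ?thesis
  proof (rule mat_projectionsI)
    show "map_mat f p \<in> carrier_mat (dim_row p) (dim_row p)"
      using P(1) by (intro carrier_matI) simp_all
    show "elements_mat (map_mat f p) \<subseteq> V"
      using f P(2) by (rule elements_map_mat)
    show "map_mat f p * map_mat f p = map_mat f p"
      using map_mat_mult[OF U f P(2) P(2) P(1)] P(3) by simp
    show "mat_star (map_mat f p) = map_mat f p"
      using map_mat_star[OF f P(2)] P(4) by simp
  qed
qed

lemma map_diag_block_mat:
  "f 0 = 0 \<Longrightarrow> map_mat f (diag_block_mat ps) = diag_block_mat (map (map_mat f) ps)"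
proof (induction ps)
  case (Cons p ps)
  have "map_mat f (p \<oplus>\<^sub>m q) = map_mat f p \<oplus>\<^sub>m map_mat f q" for q
    unfolding direct_sum_eq by (rule eq_matI) (use Cons.prems in auto)
  then show ?case
    using Cons by (simp add: diag_block_mat_Cons[of p ps] diag_block_mat_Cons[of "map_mat f p" "map (map_mat f) ps"])
qed (auto intro!: eq_matI)

lemma map_mat_mvn:
  assumes U: "star_subring U" and f: "star_ring_hom U V f" and "mvn_equiv U p q"
  shows "mvn_equiv V (map_mat f p) (map_mat f q)"
proof -
  obtain v where v: "v \<in> carrier_mat (dim_row q) (dim_row p)" "elements_mat v \<subseteq> U"
    "mat_star v * v = p" "v * mat_star v = q"
    using assms(3) by (auto simp: mvn_equiv_def)
  have sv: "elements_mat (mat_star v) \<subseteq> U"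
    by (rule elements_mat_star[OF U v(2)])
  show ?thesis
  proof (rule mvn_equivI)
    show "map_mat f v \<in> carrier_mat (dim_row (map_mat f q)) (dim_row (map_mat f p))"
      using v(1) by simp
    show "elements_mat (map_mat f v) \<subseteq> V"
      using f v(2) by (rule elements_map_mat)
    show "mat_star (map_mat f v) * map_mat f v = map_mat f p"
      using map_mat_mult[OF U f sv v(2)] map_mat_star[OF f v(2)] v(3) by simp
    show "map_mat f v * mat_star (map_mat f v) = map_mat f q"
      using map_mat_mult[OF U f v(2) sv] map_mat_star[OF f v(2)] v(4) by simp
  qed
qed

lemma map_mat_K0_rel:
  assumes U: "star_subring U" and V: "star_subring V" and f: "star_ring_hom U V f"
    and "((p, q), (p', q')) \<in> K0_rel U"
  shows "((map_mat f p, map_mat f q), (map_mat f p', map_mat f q')) \<in> K0_rel V"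
proof -
  note 1 = assms(4)[unfolded K0_rel_iff[OF U]]
  then obtain Z xs ys where 2: "mset xs = {#p, q'#} + Z" "mset ys = {#p', q#} + Z"
    "mvn_equiv U (diag_block_mat xs) (diag_block_mat ys)"
    "set xs \<subseteq> mat_projections U" "set ys \<subseteq> mat_projections U"
    by (meson stably_equivE)
  note proj = map_mat_projections[OF U f]
  have "stably_equiv V {#map_mat f p, map_mat f q'#} {#map_mat f p', map_mat f q#}"
  proof (rule stably_equivI)
    show "mvn_equiv V (diag_block_mat (map (map_mat f) xs)) (diag_block_mat (map (map_mat f) ys))"
      using map_mat_mvn[OF U f 2(3)] star_ring_homD(5)[OF f] star_subringD(1)[OF U]
      by (simp add: map_diag_block_mat)
    show "mset (map (map_mat f) xs) = {#map_mat f p, map_mat f q'#} + image_mset (map_mat f) Z"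
      "mset (map (map_mat f) ys) = {#map_mat f p', map_mat f q#} + image_mset (map_mat f) Z"
      by (simp_all add: 2)
  qed (use 2 proj in auto)
  then show ?thesis
    using 1 proj by (simp add: K0_rel_iff[OF V])
qed

lemma K0_unital_map_diff:
  assumes U: "star_subring U" and V: "star_subring V" and f: "star_ring_hom U V f"
    and "p \<in> mat_projections U" "q \<in> mat_projections U"
  shows "K0_unital_map V f (K0_diff U p q) = K0_diff V (map_mat f p) (map_mat f q)"
  unfolding K0_unital_map_def
  using map_mat_K0_rel[OF U V f] equiv_K0_rel[OF V]
  by (intro UN_K0_diff[OF U assms(4,5)] K0_diff_eqI[OF V]) (meson equivE symE)

text \<open>Multiplication by the diagonal matrix all of whose diagonal entries are
  \<open>a\<close>.\<close>

definition mat_lmul :: "'a :: star_algebra \<Rightarrow> 'a mat \<Rightarrow> 'a mat" where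
  "mat_lmul a P = map_mat (\<lambda>x. a * x) P"

definition mat_rmul :: "'a :: star_algebra mat \<Rightarrow> 'a \<Rightarrow> 'a mat" where
  "mat_rmul P a = map_mat (\<lambda>x. x * a) P"

lemma mat_lrmul_dim [simp]:
  "dim_row (mat_lmul a P) = dim_row P" "dim_col (mat_lmul a P) = dim_col P"
  "dim_row (mat_rmul P a) = dim_row P" "dim_col (mat_rmul P a) = dim_col P"
  "P \<in> carrier_mat m n \<Longrightarrow> mat_lmul a P \<in> carrier_mat m n"
  "P \<in> carrier_mat m n \<Longrightarrow> mat_rmul P a \<in> carrier_mat m n"
  by (auto simp: mat_lmul_def mat_rmul_def)

lemma mat_lrmul_index [simp]:
  "i < dim_row P \<Longrightarrow> j < dim_col P \<Longrightarrow> mat_lmul a P $$ (i, j) = a * P $$ (i, j)"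
  "i < dim_row P \<Longrightarrow> j < dim_col P \<Longrightarrow> mat_rmul P a $$ (i, j) = P $$ (i, j) * a"
  by (auto simp: mat_lmul_def mat_rmul_def)

lemma mat_star_lmul: "mat_star (mat_lmul a P) = mat_rmul (mat_star P) (star a)"
  by (rule eq_matI) (auto simp: star_mult)

lemma mat_lrmul_mult:
  assumes "dim_col P = dim_row Q"
  shows "mat_lmul a P * Q = mat_lmul a (P * Q)" "P * mat_rmul Q a = mat_rmul (P * Q) a"
    "mat_rmul P a * mat_lmul b Q = P * mat_lmul (a * b) Q"
  by (rule eq_matI; use assms in \<open>simp add: scalar_prod_def sum_distrib_left sum_distrib_right mult.assoc\<close>)+

lemma mat_lmul_zero: "P \<in> carrier_mat m n \<Longrightarrow> mat_lmul 0 P = 0\<^sub>m m n"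
  by (rule eq_matI) auto

text \<open>The partial isometry is the product of the diagonal matrix with entries \<open>F p\<close> and \<open>s p\<close> and the unitary
  matrix with rows \<open>(y, 1 - y y\<^sup>*)\<close> and \<open>(1 - y\<^sup>* y, y\<^sup>*)\<close>. The summand \<open>s p\<close> compensates for the
  effect of \<open>x \<mapsto> y x y\<^sup>*\<close> on the scalars.\<close>
lemma mvn_conj:
  fixes F G s :: "'a :: star_algebra \<Rightarrow> 'b :: star_algebra"
  assumes W: "star_subring W" and U: "star_subring U"
    and F: "star_ring_hom W U F" and G: "star_ring_hom W U G" and s: "star_ring_hom W U s"
    and y: "y \<in> U" "y * star y * y = y"
    and central: "\<And>u z. u \<in> W \<Longrightarrow> z \<in> U \<Longrightarrow> s u * z = z * s u"
    and supp: "\<And>u. u \<in> W \<Longrightarrow> star y * y * (F u - s u) = F u - s u"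
      "\<And>u. u \<in> W \<Longrightarrow> (F u - s u) * (star y * y) = F u - s u"
    and G_eq: "\<And>u. u \<in> W \<Longrightarrow> G u = y * (F u - s u) * star y + s u"
    and p: "p \<in> mat_projections W"
  shows "mvn_equiv U (map_mat F p \<oplus>\<^sub>m map_mat s p) (map_mat G p \<oplus>\<^sub>m map_mat s p)"
proof -
  define n P S Q where "n = dim_row p" and "P = map_mat F p" and "S = map_mat s p" and "Q = map_mat G p"
  have dims: "dim_row P = n" "dim_col P = n" "dim_row S = n" "dim_col S = n" "dim_row Q = n" "dim_col Q = n"
    "dim_row p = n" "dim_col p = n"
    using mat_projectionsD(1)[OF p] by (auto simp: P_def S_def Q_def n_def)
  have Pc: "P \<in> carrier_mat n n" and Sc: "S \<in> carrier_mat n n" and Qc: "Q \<in> carrier_mat n n"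
    using dims by auto
  note P = mat_projectionsD[OF map_mat_projections[OF W F p], folded P_def]
  note S = mat_projectionsD[OF map_mat_projections[OF W s p], folded S_def]
  define h k where "h = star y * y" and "k = y * star y"
  have sy: "star y * y * star y = star y"
    using arg_cong[OF y(2), of star] by (simp add: star_mult star_star mult.assoc)
  have hk: "y * h = y" "h * star y = star y" "k * y = y" "star y * k = star y" "h * h = h" "k * k = k"
    "star h = h" "star k = k"
    using y(2) sy by (simp_all add: h_def k_def star_mult star_star mult.assoc[symmetric])
  have mem: "h \<in> U" "k \<in> U" "1 - h \<in> U" "1 - k \<in> U" "star y \<in> U"
    by (simp_all add: h_def k_def star_subringD[OF U] y(1))
  have idem: "(1 - h) * (1 - h) = 1 - h" "(1 - k) * (1 - k) = 1 - k" "star y * (1 - k) = 0"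
    "(1 - h) * star y = 0" "(1 - k) * y = 0" "y * (1 - h) = 0"
    by (simp_all add: algebra_simps hk)
  define V where "V = four_block_mat (mat_lmul y P) (mat_lmul (1 - k) S) (mat_lmul (1 - h) P) (mat_lmul (star y) S)"
  have sV: "mat_star V = four_block_mat (mat_rmul P (star y)) (mat_rmul P (1 - h)) (mat_rmul S (1 - k)) (mat_rmul S y)"
    unfolding V_def
    by (subst mat_star_four_block[of _ n n _ n _ n])
      (use Pc Sc P(4) S(4) in \<open>simp_all add: mat_star_lmul star_diff hk star_star\<close>)
  have split: "mat_lmul h P + mat_lmul (1 - h) P = P" "mat_lmul (1 - k) S + mat_lmul k S = S"
    by (rule eq_matI; simp add: algebra_simps)+
  have "mat_star V * V = four_block_mat P (0\<^sub>m n n) (0\<^sub>m n n) S"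
  proof -
    have "P * mat_lmul h P + P * mat_lmul (1 - h) P = P" "S * mat_lmul (1 - k) S + S * mat_lmul k S = S"
      using Pc Sc P(3) S(3) split
      by (simp_all add: mult_add_distrib_mat[symmetric, of _ n n _ n])
    then show ?thesis
      unfolding sV unfolding V_def
      by (subst mult_four_block_mat[of _ n n _ n _ n _ _ n _ n])
        (use Pc Sc dims in \<open>simp_all add: mat_lrmul_mult(3) idem mat_lmul_zero[OF Pc] mat_lmul_zero[OF Sc]
          h_def[symmetric] k_def[symmetric]\<close>)
  qed
  then have VV: "mat_star V * V = P \<oplus>\<^sub>m S"
    by (simp add: direct_sum_eq dims)
  \<comment> \<open>The entries of the three matrices at one position come from a common
    \<open>u\<close>, so the blocks of \<open>V * mat_star V\<close> reduce to the four identities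
    \<open>E\<close> between elements.\<close>
  have entries: "\<exists>u\<in>W. P $$ (i, j) = F u \<and> S $$ (i, j) = s u \<and> Q $$ (i, j) = G u" if "i < n" "j < n" for i j
    using mat_projectionsD(2)[OF p] that
    by (intro bexI[of _ "p $$ (i, j)"]) (auto simp: P_def S_def Q_def dims elements_mat_subset_iff)
  have E: "y * (F u * star y) + (1 - k) * (s u * (1 - k)) = G u"
    "y * (F u * (1 - h)) + (1 - k) * (s u * y) = 0"
    "(1 - h) * (F u * star y) + star y * (s u * (1 - k)) = 0"
    "(1 - h) * (F u * (1 - h)) + star y * (s u * y) = s u" if u: "u \<in> W" for u
  proof -
    \<comment> \<open>\<open>F u\<close> splits into \<open>D\<close>, on which \<open>h\<close>
      acts as a unit from both sides, and \<open>s u\<close>, which commutes with everything in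
      \<open>U\<close>. The factors \<open>1 - h\<close> kill \<open>D\<close>; the terms with
      \<open>s u\<close> are sorted by moving it to the right end.\<close>
    define D where "D = F u - s u"
    have Fu: "F u = D + s u" by (simp add: D_def)
    have D: "h * D = D" "D * h = D" using supp[OF u] by (simp_all add: D_def h_def)
    have D': "(1 - h) * D = 0" "D * (1 - h) = 0" by (simp_all add: left_diff_distrib right_diff_distrib D)
    note c = central[OF u y(1)] central[OF u mem(5)] central[OF u mem(3)] central[OF u mem(4)]
    have "y * (F u * star y) + (1 - k) * (s u * (1 - k)) = y * D * star y + (y * star y * s u + (1 - k) * (1 - k) * s u)"
      by (simp only: Fu c distrib_left distrib_right mult.assoc add.assoc)
    also have "\<dots> = G u"
      using G_eq[OF u] by (simp add: D_def idem k_def[symmetric] distrib_right[symmetric])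
    finally show "y * (F u * star y) + (1 - k) * (s u * (1 - k)) = G u" .
    have "y * (F u * (1 - h)) + (1 - k) * (s u * y) = y * (D * (1 - h)) + (y * (1 - h) * s u + (1 - k) * y * s u)"
      by (simp only: Fu c distrib_left distrib_right mult.assoc add.assoc)
    then show "y * (F u * (1 - h)) + (1 - k) * (s u * y) = 0"
      by (simp only: idem D' mult_zero_left mult_zero_right add_0)
    have "(1 - h) * (F u * star y) + star y * (s u * (1 - k)) =
        (1 - h) * D * star y + ((1 - h) * star y * s u + star y * (1 - k) * s u)"
      by (simp only: Fu c distrib_left distrib_right mult.assoc add.assoc)
    then show "(1 - h) * (F u * star y) + star y * (s u * (1 - k)) = 0"
      by (simp only: idem D' mult_zero_left mult_zero_right add_0)
    have "(1 - h) * (F u * (1 - h)) + star y * (s u * y) =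
        (1 - h) * D * (1 - h) + ((1 - h) * (1 - h) * s u + star y * y * s u)"
      by (simp only: Fu c distrib_left distrib_right mult.assoc add.assoc)
    then show "(1 - h) * (F u * (1 - h)) + star y * (s u * y) = s u"
      by (simp add: idem D' h_def[symmetric] distrib_right[symmetric])
  qed
  have E': "y * P $$ (i, j) * star y + (1 - k) * S $$ (i, j) * (1 - k) = Q $$ (i, j)"
    "y * P $$ (i, j) * (1 - h) + (1 - k) * S $$ (i, j) * y = 0"
    "(1 - h) * P $$ (i, j) * star y + star y * S $$ (i, j) * (1 - k) = 0"
    "(1 - h) * P $$ (i, j) * (1 - h) + star y * S $$ (i, j) * y = S $$ (i, j)" if ij: "i < n" "j < n" for i j
  proof -
    obtain u where u: "u \<in> W" and eqs: "P $$ (i, j) = F u" "S $$ (i, j) = s u" "Q $$ (i, j) = G u"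
      using entries[OF ij] by blast
    show "y * P $$ (i, j) * star y + (1 - k) * S $$ (i, j) * (1 - k) = Q $$ (i, j)"
      "y * P $$ (i, j) * (1 - h) + (1 - k) * S $$ (i, j) * y = 0"
      "(1 - h) * P $$ (i, j) * star y + star y * S $$ (i, j) * (1 - k) = 0"
      "(1 - h) * P $$ (i, j) * (1 - h) + star y * S $$ (i, j) * y = S $$ (i, j)"
      unfolding eqs mult.assoc by (fact E[OF u])+
  qed
  have "V * mat_star V = four_block_mat Q (0\<^sub>m n n) (0\<^sub>m n n) S"
  proof -
    have blocks: "mat_lmul y P * mat_rmul P (star y) + mat_lmul (1 - k) S * mat_rmul S (1 - k) = Q"
      "mat_lmul y P * mat_rmul P (1 - h) + mat_lmul (1 - k) S * mat_rmul S y = 0\<^sub>m n n"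
      "mat_lmul (1 - h) P * mat_rmul P (star y) + mat_lmul (star y) S * mat_rmul S (1 - k) = 0\<^sub>m n n"
      "mat_lmul (1 - h) P * mat_rmul P (1 - h) + mat_lmul (star y) S * mat_rmul S y = S"
      by (rule eq_matI; simp add: mat_lrmul_mult(1,2) P(3) S(3) dims E')+
    show ?thesis
      unfolding sV unfolding V_def
      by (subst mult_four_block_mat[of _ n n _ n _ n _ _ n _ n]) (use Pc Sc in \<open>simp_all add: blocks\<close>)
  qed
  then have VV': "V * mat_star V = Q \<oplus>\<^sub>m S"
    by (simp add: direct_sum_eq dims)
  have "elements_mat P \<subseteq> U" "elements_mat S \<subseteq> U"
    using P(2) S(2) by auto
  then have "elements_mat V \<subseteq> U"
    unfolding V_def using Pc Sc mem y(1)
    by (intro elements_four_block[of _ n n _ n _ n])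
      (auto simp: elements_mat_subset_iff dims star_subringD(4)[OF U])
  moreover have "V \<in> carrier_mat (dim_row (Q \<oplus>\<^sub>m S)) (dim_row (P \<oplus>\<^sub>m S))"
    using Pc Sc by (simp add: V_def direct_sum_eq dims)
  ultimately show ?thesis
    using VV VV' unfolding P_def[symmetric] Q_def[symmetric] S_def[symmetric]
    by (intro mvn_equivI[of V])
qed

section \<open>K0 of algebras through their unitizations\<close>

definition star_subalgebra :: "'a :: star_algebra set \<Rightarrow> bool" where
  "star_subalgebra B \<longleftrightarrow> 0 \<in> B \<and> (\<forall>x\<in>B. \<forall>y\<in>B. x + y \<in> B \<and> x * y \<in> B) \<and>
    (\<forall>c. \<forall>x\<in>B. c *\<^sub>C x \<in> B) \<and> (\<forall>x\<in>B. star x \<in> B)"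

lemma star_subalgebraD:
  assumes "star_subalgebra B"
  shows "0 \<in> B" "x \<in> B \<Longrightarrow> y \<in> B \<Longrightarrow> x + y \<in> B" "x \<in> B \<Longrightarrow> y \<in> B \<Longrightarrow> x * y \<in> B"
    "x \<in> B \<Longrightarrow> c *\<^sub>C x \<in> B" "x \<in> B \<Longrightarrow> star x \<in> B" "x \<in> B \<Longrightarrow> - x \<in> B" "x \<in> B \<Longrightarrow> y \<in> B \<Longrightarrow> x - y \<in> B"
proof -
  show m: "- x \<in> B" if "x \<in> B" for x
    using assms that scaleC_minus_one[of x] unfolding star_subalgebra_def by metis
  show "x - y \<in> B" if "x \<in> B" "y \<in> B"
    using assms that m unfolding diff_conv_add_uminus star_subalgebra_def by blast
qed (use assms in \<open>simp_all add: star_subalgebra_def\<close>)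

lemma star_homD:
  assumes "star_hom B C f"
  shows "x \<in> B \<Longrightarrow> f x \<in> C" "x \<in> B \<Longrightarrow> y \<in> B \<Longrightarrow> f (x + y) = f x + f y" "x \<in> B \<Longrightarrow> f (c *\<^sub>C x) = c *\<^sub>C f x"
    "x \<in> B \<Longrightarrow> y \<in> B \<Longrightarrow> f (x * y) = f x * f y" "x \<in> B \<Longrightarrow> f (star x) = star (f x)"
  using assms by (auto simp: star_hom_def)

lemmas unitization_defs = zero_unitization_def one_unitization_def plus_unitization_def minus_unitization_def
  uminus_unitization_def times_unitization_def scaleC_unitization_def star_unitization_def

lemma star_subring_unitize: "star_subalgebra B \<Longrightarrow> star_subring (unitize B)"
  unfolding star_subring_def unitize_def by (auto simp: unitization_defs star_subalgebraD)

lemma star_subring_UNIV: "star_subring UNIV"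
  by (simp add: star_subring_def)

lemma star_ring_hom_unitize_map:
  "star_subalgebra B \<Longrightarrow> star_hom B C f \<Longrightarrow> star_ring_hom (unitize B) (unitize C) (unitize_map f)"
  unfolding star_ring_hom_def unitize_def unitize_map_def
  by (auto simp: unitization_defs star_subalgebraD star_homD)

lemma star_ring_hom_scalar_part: "star_ring_hom (unitize B) UNIV scalar_part"
  by (auto simp: star_ring_hom_def unitization_defs star_complex_def)

text \<open>The kernel condition is kept as an equation on representatives, because
  \<open>unitize_map\<close> preserves scalar parts and hence passes it on unchanged.\<close>

lemma K0_carrierE:
  assumes B: "star_subalgebra B" and "X \<in> carrier (K0 B)"
  obtains p q where "p \<in> mat_projections (unitize B)" "q \<in> mat_projections (unitize B)"
    "X = K0_diff (unitize B) p q"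
    "K0_diff UNIV (map_mat scalar_part p) (map_mat scalar_part q) = \<one>\<^bsub>K0_unital UNIV\<^esub>"
proof -
  from assms obtain p q where pq: "p \<in> mat_projections (unitize B)" "q \<in> mat_projections (unitize B)"
    and X: "X = K0_diff (unitize B) p q" "K0_unital_map UNIV scalar_part X = \<one>\<^bsub>K0_unital UNIV\<^esub>"
    by (auto simp: K0_def kernel_def carrier_K0_unital)
  show ?thesis
    by (rule that[OF pq X(1)])
      (use X K0_unital_map_diff[OF star_subring_unitize[OF B] star_subring_UNIV star_ring_hom_scalar_part pq] in simp)
qed

lemma K0_carrierI:
  assumes B: "star_subalgebra B" and pq: "p \<in> mat_projections (unitize B)" "q \<in> mat_projections (unitize B)"
    and "K0_diff UNIV (map_mat scalar_part p) (map_mat scalar_part q) = \<one>\<^bsub>K0_unital UNIV\<^esub>"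
  shows "K0_diff (unitize B) p q \<in> carrier (K0 B)"
  using assms K0_unital_map_diff[OF star_subring_unitize[OF B] star_subring_UNIV star_ring_hom_scalar_part pq]
  by (auto simp: K0_def kernel_def carrier_K0_unital)

lemma K0_map_diff:
  assumes "star_subalgebra B" "star_subalgebra C" "star_hom B C f"
    and "p \<in> mat_projections (unitize B)" "q \<in> mat_projections (unitize B)"
  shows "K0_map C f (K0_diff (unitize B) p q) =
    K0_diff (unitize C) (map_mat (unitize_map f) p) (map_mat (unitize_map f) q)"
  unfolding K0_map_def
  by (rule K0_unital_map_diff[OF star_subring_unitize star_subring_unitize star_ring_hom_unitize_map])
    (use assms in auto)

lemma map_mat_comp: "map_mat f (map_mat g M) = map_mat (\<lambda>x. f (g x)) M"
  by (rule eq_matI) auto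

lemma scalar_part_unitize_map [simp]: "scalar_part (unitize_map f u) = scalar_part u"
  by (simp add: unitize_map_def)

lemma K0_map_closed:
  assumes B: "star_subalgebra B" and C: "star_subalgebra C" and f: "star_hom B C f" and "X \<in> carrier (K0 B)"
  shows "K0_map C f X \<in> carrier (K0 C)"
proof -
  from K0_carrierE[OF B assms(4)] obtain p q where pq: "p \<in> mat_projections (unitize B)" "q \<in> mat_projections (unitize B)"
    and X: "X = K0_diff (unitize B) p q"
    and one: "K0_diff UNIV (map_mat scalar_part p) (map_mat scalar_part q) = \<one>\<^bsub>K0_unital UNIV\<^esub>" .
  note proj = map_mat_projections[OF star_subring_unitize[OF B] star_ring_hom_unitize_map[OF B f]]
  show ?thesis
    unfolding X K0_map_diff[OF B C f pq]
    by (rule K0_carrierI[OF C proj[OF pq(1)] proj[OF pq(2)]]) (simp add: map_mat_comp one)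
qed

lemma K0_map_hom:
  assumes B: "star_subalgebra B" and C: "star_subalgebra C" and f: "star_hom B C f"
  shows "K0_map C f \<in> hom (K0 B) (K0 C)"
proof (rule homI)
  show "K0_map C f X \<in> carrier (K0 C)" if "X \<in> carrier (K0 B)" for X
    using K0_map_closed[OF assms that] .
  fix X Y assume XY: "X \<in> carrier (K0 B)" "Y \<in> carrier (K0 B)"
  obtain p q where pq: "p \<in> mat_projections (unitize B)" "q \<in> mat_projections (unitize B)"
    and X: "X = K0_diff (unitize B) p q" using K0_carrierE[OF B XY(1)] .
  obtain p' q' where pq': "p' \<in> mat_projections (unitize B)" "q' \<in> mat_projections (unitize B)"
    and Y: "Y = K0_diff (unitize B) p' q'" using K0_carrierE[OF B XY(2)] .
  note UB = star_subring_unitize[OF B] and UC = star_subring_unitize[OF C]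
  note proj = map_mat_projections[OF UB star_ring_hom_unitize_map[OF B f]]
  have mult: "x \<otimes>\<^bsub>K0 D\<^esub> y = x \<otimes>\<^bsub>K0_unital (unitize D)\<^esub> y" for x y and D :: "'c :: star_algebra set"
    by (simp add: K0_def)
  have "unitize_map f 0 = 0"
    using star_ring_homD(5)[OF star_ring_hom_unitize_map[OF B f]] star_subringD(1)[OF UB] by blast
  then have sum: "map_mat (unitize_map f) (x \<oplus>\<^sub>m y) = map_mat (unitize_map f) x \<oplus>\<^sub>m map_mat (unitize_map f) y" for x y
    by (simp add: map_diag_block_mat)
  show "K0_map C f (X \<otimes>\<^bsub>K0 B\<^esub> Y) = K0_map C f X \<otimes>\<^bsub>K0 C\<^esub> K0_map C f Y"
    unfolding X Y mult
    by (simp add: K0_unital_mult[OF UB] K0_unital_mult[OF UC] K0_map_diff[OF B C f] pq pq' proj sum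
        mat_projections_direct_sum[OF UB])
qed

lemma K0_map_comp:
  assumes B: "star_subalgebra B" and C: "star_subalgebra C" and D: "star_subalgebra D"
    and f: "star_hom B C f" and g: "star_hom C D g" and X: "X \<in> carrier (K0 B)"
  shows "K0_map D g (K0_map C f X) = K0_map D (\<lambda>x. g (f x)) X"
proof -
  obtain p q where pq: "p \<in> mat_projections (unitize B)" "q \<in> mat_projections (unitize B)"
    and X: "X = K0_diff (unitize B) p q" using K0_carrierE[OF B X] .
  note proj = map_mat_projections[OF star_subring_unitize[OF B] star_ring_hom_unitize_map[OF B f]]
  have gf: "star_hom B D (\<lambda>x. g (f x))"
    using f g by (auto simp: star_hom_def)
  have "unitize_map g (unitize_map f u) = unitize_map (\<lambda>x. g (f x)) u" for u
    by (simp add: unitize_map_def)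
  then show ?thesis
    unfolding X
    by (simp add: K0_map_diff[OF B C f] K0_map_diff[OF C D g] K0_map_diff[OF B D gf] pq proj map_mat_comp)
qed

lemma K0_map_id:
  assumes B: "star_subalgebra B" and X: "X \<in> carrier (K0 B)"
  shows "K0_map B (\<lambda>x. x) X = X"
proof -
  obtain p q where pq: "p \<in> mat_projections (unitize B)" "q \<in> mat_projections (unitize B)"
    and X: "X = K0_diff (unitize B) p q" using K0_carrierE[OF B X] .
  have id: "star_hom B B (\<lambda>x. x)" by (simp add: star_hom_def)
  have "map_mat (unitize_map (\<lambda>x. x)) M = M" for M :: "'a unitization mat"
    by (rule eq_matI) (auto simp: unitize_map_def)
  then show ?thesis
    unfolding X by (simp add: K0_map_diff[OF B B id] pq)
qed

text \<open>An instance of \<open>mvn_conj\<close> in which the scalars of the unitization are the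
  central part: subtracting them from \<open>unitize_map f u\<close> leaves
  \<open>f (alg_part u)\<close>, where \<open>y\<close> acts as an honest partial isometry. It
  serves three times: for both composites of the corner inclusion with its inverse, and for the
  comparison of that inclusion with the stable isomorphism.\<close>

lemma K0_map_conj:
  assumes C: "star_subalgebra C" and B: "star_subalgebra B"
    and f: "star_hom C B f" and g: "star_hom C B g" and y: "y \<in> B" "y * star y * y = y"
    and supp: "\<And>c. c \<in> C \<Longrightarrow> star y * y * f c = f c"
    and g_eq: "\<And>c. c \<in> C \<Longrightarrow> g c = y * f c * star y"
    and X: "X \<in> carrier (K0 C)"
  shows "K0_map B f X = K0_map B g X"
proof -
  obtain p q where pq: "p \<in> mat_projections (unitize C)" "q \<in> mat_projections (unitize C)"
    and X: "X = K0_diff (unitize C) p q" using K0_carrierE[OF C X] .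
  note UC = star_subring_unitize[OF C] and UB = star_subring_unitize[OF B]
  note hf = star_ring_hom_unitize_map[OF C f] and hg = star_ring_hom_unitize_map[OF C g]
  define s :: "'a unitization \<Rightarrow> 'b unitization" where "s u = Unitization 0 (scalar_part u)" for u
  have hs: "star_ring_hom (unitize C) (unitize B) s"
    by (auto simp: star_ring_hom_def s_def unitization_defs unitize_def star_subalgebraD(1)[OF B])
  define y' where "y' = Unitization y 0"
  have supp': "f c * (star y * y) = f c" if "c \<in> C" for c
    using arg_cong[OF supp[of "star c"], of star] that
    by (simp add: star_homD(5)[OF f] star_subalgebraD(5)[OF C] star_mult star_star mult.assoc)
  have mvn: "mvn_equiv (unitize B) (map_mat (unitize_map f) r \<oplus>\<^sub>m map_mat s r) (map_mat (unitize_map g) r \<oplus>\<^sub>m map_mat s r)"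
    if "r \<in> mat_projections (unitize C)" for r
  proof (rule mvn_conj[OF UC UB hf hg hs _ _ _ _ _ _ that, of y'])
    show "y' \<in> unitize B" "y' * star y' * y' = y'"
      using y by (simp_all add: y'_def unitize_def unitization_defs)
    fix u assume "u \<in> unitize C"
    then have u: "alg_part u \<in> C" by (simp add: unitize_def)
    have diff: "unitize_map f u - s u = Unitization (f (alg_part u)) 0"
      by (simp add: unitize_map_def s_def unitization_defs)
    show "star y' * y' * (unitize_map f u - s u) = unitize_map f u - s u"
      "(unitize_map f u - s u) * (star y' * y') = unitize_map f u - s u"
      unfolding diff by (simp_all add: y'_def unitization_defs supp[OF u] supp'[OF u])
    show "unitize_map g u = y' * (unitize_map f u - s u) * star y' + s u"
      unfolding diff by (simp add: y'_def s_def unitization_defs unitize_map_def g_eq[OF u])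
    fix z
    show "s u * z = z * s u"
      by (simp add: s_def unitization_defs mult.commute)
  qed
  let ?f = "map_mat (unitize_map f)" and ?g = "map_mat (unitize_map g)" and ?s = "map_mat s"
  \<comment> \<open>The common summand \<open>?s r\<close> is singled out here so that it can be
    cancelled.\<close>
  have eq: "stably_equiv (unitize B) ({#?f r#} + {#?s r#}) ({#?g r#} + {#?s r#})"
    if r: "r \<in> mat_projections (unitize C)" for r
    using stably_equiv_mvn[of "[?f r, ?s r]" "unitize B" "[?g r, ?s r]"] mvn[OF r]
      map_mat_projections[OF UC hf r] map_mat_projections[OF UC hg r] map_mat_projections[OF UC hs r]
    by (simp add: add_mset_commute)
  have "stably_equiv (unitize B) ({#?f p#} + {#?g q#}) ({#?g p#} + {#?f q#})"
    using stably_equiv_cancel[OF UB eq[OF pq(1)]] stably_equiv_cancel[OF UB eq[OF pq(2)]]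
    by (intro stably_equiv_add UB) (auto intro: stably_equiv_sym[OF UB])
  then have "((?f p, ?f q), (?g p, ?g q)) \<in> K0_rel (unitize B)"
    using pq map_mat_projections[OF UC hf] map_mat_projections[OF UC hg]
    by (simp add: K0_rel_iff[OF UB] add_mset_commute)
  from K0_diff_eqI[OF UB this] show ?thesis
    unfolding X by (simp add: K0_map_diff[OF C B f pq] K0_map_diff[OF C B g pq])
qed

section \<open>Isometries in Cuntz--Krieger algebras\<close>

lemma cinner_star: "cinner (star T \<cdot> x) y = cinner x (T \<cdot> y)"
  unfolding star_bop_def using theI'[OF ex1_adjoint[of T]] by blast

lemma inner_star: "inner (star T \<cdot> x) y = inner x (T \<cdot> y)"
  using cinner_star[of T x y] by (metis Re_cinner)

lemma bop_apply_sum: "(\<Sum>i\<in>F. T i) \<cdot> x = (\<Sum>i\<in>F. T i \<cdot> x)"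
  by (induction F rule: infinite_finite_induct) auto

text \<open>The Cuntz--Krieger relations only say that the range projections add up to 1. For
  \<open>z\<close> in the range of \<open>q j\<close>, the squared norms of all
  \<open>q l \<cdot> z\<close> add up to the squared norm of \<open>z\<close>, which the term at
  \<open>j\<close> already exhausts.\<close>

lemma projections_orthogonal:
  fixes q :: "'a \<Rightarrow> 'i bop"
  assumes F: "finite F" and q: "\<And>i. i \<in> F \<Longrightarrow> is_projection (q i)" and sum: "(\<Sum>i\<in>F. q i) = 1"
    and ij: "i \<in> F" "j \<in> F" "i \<noteq> j"
  shows "q i * q j = 0"
proof (rule bop_eqI)
  fix x
  define z where "z = q j \<cdot> x"
  have idem: "q l \<cdot> q l \<cdot> y = q l \<cdot> y" and sa: "star (q l) = q l" if "l \<in> F" for l y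
    using q[OF that] by (auto simp: is_projection_def simp flip: bop_apply_simps(6))
  have "(\<Sum>l\<in>F. (norm (q l \<cdot> z))\<^sup>2) = (\<Sum>l\<in>F. inner z (q l \<cdot> z))"
  proof (rule sum.cong)
    fix l assume l: "l \<in> F"
    show "(norm (q l \<cdot> z))\<^sup>2 = inner z (q l \<cdot> z)"
      using inner_star[of "q l" z "q l \<cdot> z"] by (simp add: power2_norm_eq_inner sa[OF l] idem[OF l])
  qed simp
  also have "\<dots> = inner z ((\<Sum>l\<in>F. q l) \<cdot> z)"
    by (simp add: bop_apply_sum inner_sum_right)
  also have "\<dots> = (norm (q j \<cdot> z))\<^sup>2"
    using ij by (simp add: sum power2_norm_eq_inner z_def idem)
  finally have "(\<Sum>l\<in>F - {j}. (norm (q l \<cdot> z))\<^sup>2) = 0"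
    using F ij by (simp add: sum.remove[of F j])
  then have "(norm (q i \<cdot> z))\<^sup>2 = 0"
    using F ij by (subst (asm) sum_nonneg_eq_0_iff) auto
  then show "(q i * q j) \<cdot> x = 0 \<cdot> x" by (simp add: z_def)
qed

section \<open>The directed graph of a 0-1 matrix\<close>

definition edges :: "nat mat \<Rightarrow> (nat \<times> nat) set" where
  "edges A = {(i, j). i < dim_row A \<and> j < dim_col A \<and> A $$ (i, j) \<noteq> 0}"

lemma edges_transpose: "edges (transpose_mat A) = (edges A)\<inverse>"
  by (auto simp: edges_def)

lemma pow_mat_trancl:
  assumes A: "A \<in> carrier_mat N N"
  shows "i < N \<Longrightarrow> j < N \<Longrightarrow> (A ^\<^sub>m Suc k) $$ (i, j) > 0 \<Longrightarrow> (i, j) \<in> (edges A)\<^sup>+"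
proof (induction k arbitrary: j)
  case 0
  then show ?case using A by (auto simp: edges_def)
next
  case (Suc k)
  have c: "A ^\<^sub>m Suc k \<in> carrier_mat N N" using A by (rule pow_carrier_mat)
  have "(A ^\<^sub>m Suc (Suc k)) $$ (i, j) = (\<Sum>m\<in>{0..<N}. (A ^\<^sub>m Suc k) $$ (i, m) * A $$ (m, j))"
    unfolding pow_mat.simps(2)[of A "Suc k"] using A c Suc.prems
    by (simp add: scalar_prod_def del: pow_mat.simps)
  with Suc.prems(3) obtain m where m: "m < N" "(A ^\<^sub>m Suc k) $$ (i, m) * A $$ (m, j) \<noteq> 0"
    by (metis (mono_tags, lifting) atLeastLessThan_iff less_numeral_extra(3) sum.neutral)
  have "(i, m) \<in> (edges A)\<^sup>+" using Suc.IH[OF Suc.prems(1) m(1)] m(2) by simp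
  moreover have "(m, j) \<in> edges A" using m A Suc.prems by (auto simp: edges_def)
  ultimately show ?case by (rule trancl_into_trancl)
qed

lemma irreducible_trancl:
  assumes "A \<in> carrier_mat N N" "irreducible_matrix A" "i < N" "j < N"
  shows "(i, j) \<in> (edges A)\<^sup>+"
proof -
  obtain k where "k > 0" "(A ^\<^sub>m k) $$ (i, j) > 0"
    using assms by (auto simp: irreducible_matrix_def)
  then show ?thesis
    using pow_mat_trancl[OF assms(1,3,4), of "k - 1"] by simp
qed

text \<open>Used in contrapositive form to find a vertex with two outgoing edges. Strong
  connectivity gives each vertex an outgoing and an incoming edge; with unique outgoing edges, the
  successor map is then a surjection of a finite set onto itself, hence a permutation.\<close>

lemma permutation_matrixI:
  assumes A: "A \<in> carrier_mat N N" and A01: "elements_mat A \<subseteq> {0, 1}"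
    and conn: "\<And>i j. i < N \<Longrightarrow> j < N \<Longrightarrow> (i, j) \<in> (edges A)\<^sup>+"
    and unique: "\<And>l j j'. (l, j) \<in> edges A \<Longrightarrow> (l, j') \<in> edges A \<Longrightarrow> j = j'"
  shows "permutation_matrix A"
proof -
  \<comment> \<open>Outside the vertex set \<open>\<pi>\<close> is the identity, as
    \<open>permutes\<close> demands.\<close>
  define \<pi> where "\<pi> i = (if i < N then THE j. (i, j) \<in> edges A else i)" for i
  have dim: "i < N" "j < N" if "(i, j) \<in> edges A" for i j
    using that A by (auto simp: edges_def)
  have \<pi>: "(i, j) \<in> edges A \<longleftrightarrow> j = \<pi> i" if i: "i < N" for i j
  proof -
    obtain j' where "(i, j') \<in> edges A" using tranclD[OF conn[OF i i]] by blast
    then show ?thesis using unique[of i] i by (auto simp: \<pi>_def intro: theI2)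
  qed
  have "\<pi> ` {..<N} = {..<N}"
  proof
    show "\<pi> ` {..<N} \<subseteq> {..<N}" using \<pi> dim by blast
    show "{..<N} \<subseteq> \<pi> ` {..<N}"
    proof
      fix j assume "j \<in> {..<N}"
      then obtain i where "(i, j) \<in> edges A" using conn[of j j] by (metis lessThan_iff tranclD2)
      then show "j \<in> \<pi> ` {..<N}" using \<pi> dim by blast
    qed
  qed
  then have "bij_betw \<pi> {..<N} {..<N}"
    by (simp add: bij_betw_def eq_card_imp_inj_on)
  then have perm: "\<pi> permutes {..<N}"
    by (rule bij_imp_permutes) (simp add: \<pi>_def)
  have "A $$ (i, j) = (if j = \<pi> i then 1 else 0)" if ij: "i < N" "j < N" for i j
  proof -
    have "A $$ (i, j) \<in> {0, 1}" using A01 A ij by (auto simp: elements_mat_subset_iff)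
    then show ?thesis using \<pi>[OF ij(1), of j] A ij by (auto simp: edges_def)
  qed
  then have "A = mat (dim_row A) (dim_row A) (\<lambda>(i, j). if j = \<pi> i then 1 else 0)"
    using A by (intro eq_matI) auto
  with perm A show ?thesis unfolding permutation_matrix_def by auto
qed

text \<open>Transposition turns the matrix of a permutation into that of its inverse. This carries
  the assumption on \<open>A\<close> over to the transpose.\<close>

lemma permutation_matrix_transpose:
  assumes "square_mat A" "permutation_matrix (transpose_mat A)"
  shows "permutation_matrix A"
proof -
  define N where "N = dim_row A"
  have N: "dim_row A = N" "dim_col A = N" using assms(1) by (simp_all add: N_def)
  obtain \<pi> where \<pi>: "\<pi> permutes {..<N}" and At: "transpose_mat A = mat N N (\<lambda>(i, j). if j = \<pi> i then 1 else 0)"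
    using assms(2) N by (auto simp: permutation_matrix_def)
  have "A $$ (i, j) = (if j = inv_into UNIV \<pi> i then 1 else 0)" if "i < N" "j < N" for i j
  proof -
    have "j = inv_into UNIV \<pi> i \<longleftrightarrow> i = \<pi> j"
      using permutes_inv_eq[OF \<pi>, of i j] by auto
    then show ?thesis
      using arg_cong[OF At, of "\<lambda>M. M $$ (j, i)"] that N by simp
  qed
  then have "A = mat N N (\<lambda>(i, j). if j = inv_into UNIV \<pi> i then 1 else 0)"
    using N by (intro eq_matI) auto
  then show ?thesis
    using permutes_inv[OF \<pi>] N unfolding permutation_matrix_def by auto
qed

text \<open>Instantiated for \<open>A\<close> and for its transpose. The isometries are finite sums
  of products of generators and their adjoints, so the algebraic closure properties of
  \<open>B\<close> suffice.\<close>

locale ck_family =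
  fixes N :: nat and A :: "nat mat" and S :: "nat \<Rightarrow> 'i bop" and B :: "'i bop set"
  assumes A: "A \<in> carrier_mat N N" "elements_mat A \<subseteq> {0, 1}"
    and family: "cuntz_krieger_family A S"
    and B: "star_subring B" "\<And>i. i < N \<Longrightarrow> S i \<in> B"
begin

definition Q :: "nat \<Rightarrow> 'i bop" where
  "Q i = S i * star (S i)"

lemma S_partial_isometry: "i < N \<Longrightarrow> S i * star (S i) * S i = S i"
  and sum_Q: "(\<Sum>i<N. Q i) = 1"
  and S_initial: "i < N \<Longrightarrow> star (S i) * S i = (\<Sum>j<N. of_nat (A $$ (i, j)) * Q j)"
  using family A(1) by (auto simp: cuntz_krieger_family_def Q_def)

lemma Q_S: "i < N \<Longrightarrow> Q i * S i = S i"
  using S_partial_isometry by (simp add: Q_def)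

lemma Q_mem: "i < N \<Longrightarrow> Q i \<in> B"
  using B by (auto simp: Q_def star_subringD)

lemma Q_projection: "i < N \<Longrightarrow> is_projection (Q i)"
  using Q_S[of i] by (simp add: is_projection_def Q_def star_mult star_star mult.assoc[symmetric])

lemma Q_idem: "i < N \<Longrightarrow> Q i * Q i = Q i" and star_Q: "i < N \<Longrightarrow> star (Q i) = Q i"
  using Q_projection by (auto simp: is_projection_def)

lemma Q_orthogonal: "i < N \<Longrightarrow> j < N \<Longrightarrow> i \<noteq> j \<Longrightarrow> Q i * Q j = 0"
  using projections_orthogonal[of "{..<N}" Q i j] Q_projection sum_Q by auto

text \<open>Multiplying the relation for \<open>star (S i) * S i\<close> by \<open>Q j\<close>
  leaves, by orthogonality, one term; its coefficient \<open>A $$ (i, j)\<close> is 1 because the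
  entries are 0 or 1.\<close>

lemma S_initial_Q:
  assumes "(i, j) \<in> edges A"
  shows "star (S i) * S i * Q j = Q j"
proof -
  have ij: "i < N" "j < N" and "A $$ (i, j) \<noteq> 0" using assms A(1) by (auto simp: edges_def)
  moreover have "A $$ (i, j) \<in> {0, 1}" using A ij by (auto simp: elements_mat_subset_iff)
  ultimately have Aij: "A $$ (i, j) = 1" by auto
  have "star (S i) * S i * Q j = (\<Sum>k<N. of_nat (A $$ (i, k)) * (Q k * Q j))"
    by (simp add: S_initial[OF ij(1)] sum_distrib_right mult.assoc)
  also have "\<dots> = (\<Sum>k<N. if k = j then Q j else 0)"
    by (rule sum.cong) (use ij Aij in \<open>auto simp: Q_orthogonal Q_idem\<close>)
  finally show ?thesis using ij by simp
qed

text \<open>Such an \<open>x\<close> is the product of the generators along a path from \<open>i\<close> to \<open>j\<close>, the last vertex excluded, with \<open>Q j\<close>.\<close>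
definition path_isometry :: "nat \<Rightarrow> nat \<Rightarrow> 'i bop \<Rightarrow> bool" where
  "path_isometry i j x \<longleftrightarrow> x \<in> B \<and> star x * x = Q j \<and> Q i * x = x"

lemma path_isometry_edge:
  assumes "(i, j) \<in> edges A"
  shows "path_isometry i j (S i * Q j)"
proof -
  have ij: "i < N" "j < N" using assms A(1) by (auto simp: edges_def)
  have "star (S i * Q j) * (S i * Q j) = Q j * (star (S i) * S i * Q j)"
    using ij by (simp add: star_mult star_Q mult.assoc)
  then show ?thesis
    using ij B by (simp add: path_isometry_def S_initial_Q[OF assms] Q_idem Q_S Q_mem star_subringD
        mult.assoc[symmetric])
qed

lemma path_isometry_mult:
  assumes "path_isometry i j x" "path_isometry j k y"
  shows "path_isometry i k (x * y)"
proof -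
  have "star (x * y) * (x * y) = star y * (star x * x * y)"
    by (simp add: star_mult mult.assoc)
  then show ?thesis
    using assms B(1) by (simp add: path_isometry_def star_subringD mult.assoc[symmetric])
      (simp add: mult.assoc)
qed

lemma path_isometry_trancl: "(i, j) \<in> (edges A)\<^sup>+ \<Longrightarrow> \<exists>x. path_isometry i j x"
  by (induction rule: trancl_induct) (blast intro: path_isometry_edge path_isometry_mult)+

text \<open>At a vertex \<open>l\<close> with two outgoing edges there are two loops \<open>a\<close>, \<open>b\<close> with orthogonal ranges. The elements
  \<open>a\<^sup>k b x\<^sub>k\<close>, where \<open>x\<^sub>k\<close> leads from \<open>l\<close> to \<open>k\<close>, then have orthogonal ranges, and they add up to
  an isometry.\<close>
lemma ex_isometry_branching:
  assumes conn: "\<And>i j. i < N \<Longrightarrow> j < N \<Longrightarrow> (i, j) \<in> (edges A)\<^sup>+"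
    and branch: "(l, j) \<in> edges A" "(l, j') \<in> edges A" "j \<noteq> j'"
  shows "\<exists>w\<in>B. star w * w = 1 \<and> Q l * w = w"
proof -
  have N: "l < N" "j < N" "j' < N" using branch A(1) by (auto simp: edges_def)
  obtain y y' where y: "path_isometry j l y" "path_isometry j' l y'"
    using path_isometry_trancl conn N by meson
  define a b where "a = S l * Q j * y" and "b = S l * Q j' * y'"
  have ab: "path_isometry l l a" "path_isometry l l b"
    unfolding a_def b_def using path_isometry_mult path_isometry_edge branch y by blast+
  \<comment> \<open>The two loops leave \<open>l\<close> along different edges. The initial
    projection of \<open>S l\<close> fixes \<open>Q j'\<close>, so the product contains
    \<open>Q j * Q j'\<close>, which vanishes.\<close>
  have "star a * b = star y * (Q j * (star (S l) * S l * Q j') * y')"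
    using N by (simp add: a_def b_def star_mult star_Q mult.assoc)
  then have orth: "star a * b = 0"
    by (simp add: S_initial_Q[OF branch(2)] Q_orthogonal N branch(3))
  then have orth': "star b * a = 0"
    by (metis star_algebra_zero(3) star_mult star_star)
  have l: "star a * a = Q l" "star b * b = Q l" "Q l * a = a" "Q l * b = b" "a \<in> B" "b \<in> B"
    using ab by (auto simp: path_isometry_def)
  define u where "u k = a ^ k * b" for k
  have u_Suc: "u (Suc k) = a * u k" and u_0: "u 0 = b" for k by (simp_all add: u_def mult.assoc)
  have u_mem: "u k \<in> B" and Q_u: "Q l * u k = u k" for k
    by (induction k) (auto simp: u_0 u_Suc l star_subringD[OF B(1)] mult.assoc[symmetric])
  have uu: "star (u k) * u m = (if k = m then Q l else 0)" for k m
  proof (induction k arbitrary: m)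
    case 0
    show ?case
    proof (cases m)
      case (Suc m')
      have "star b * (a * u m') = star b * a * u m'" by (simp add: mult.assoc)
      with Suc show ?thesis by (simp add: u_0 u_Suc orth')
    qed (simp add: u_0 l)
  next
    case (Suc k)
    show ?case
    proof (cases m)
      case 0
      have "star (u k) * star a * b = star (u k) * (star a * b)" by (simp add: mult.assoc)
      with 0 show ?thesis by (simp add: u_0 u_Suc star_mult orth)
    next
      case (Suc m')
      have "star (u k) * star a * (a * u m') = star (u k) * (star a * a * u m')" by (simp add: mult.assoc)
      with Suc Suc.IH show ?thesis by (simp add: u_Suc star_mult l Q_u)
    qed
  qed
  have "\<forall>k\<in>{..<N}. \<exists>x. path_isometry l k x"
    using path_isometry_trancl conn N by blast
  then obtain x where x: "\<And>k. k < N \<Longrightarrow> path_isometry l k (x k)"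
    by (metis lessThan_iff)
  define w where "w = (\<Sum>k<N. u k * x k)"
  have "star w * w = (\<Sum>k<N. \<Sum>m<N. star (u k * x k) * (u m * x m))"
    by (simp add: w_def star_sum sum_product)
  also have "\<dots> = (\<Sum>k<N. \<Sum>m<N. if m = k then Q k else 0)"
  proof (intro sum.cong refl)
    fix k m assume km: "k \<in> {..<N}" "m \<in> {..<N}"
    have "star (u k * x k) * (u m * x m) = star (x k) * (star (u k) * u m * x m)"
      by (simp add: star_mult mult.assoc)
    then show "star (u k * x k) * (u m * x m) = (if m = k then Q k else 0)"
      using x[of m] km by (auto simp: uu path_isometry_def)
  qed
  also have "\<dots> = 1" by (simp add: sum_Q)
  finally have "star w * w = 1" .
  moreover have "w \<in> B"
    unfolding w_def using x by (intro star_subring_sum B) (auto simp: path_isometry_def u_mem star_subringD[OF B(1)])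
  moreover have "Q l * w = w"
    by (simp add: w_def sum_distrib_left mult.assoc[symmetric] Q_u)
  ultimately show ?thesis by blast
qed

text \<open>An isometry below \<open>Q l\<close> at a branching vertex is carried to
  \<open>i\<close> along a path: the path element \<open>z\<close> has initial projection
  \<open>Q l\<close>, which fixes \<open>w\<close>, so \<open>z * w\<close> is again an
  isometry.\<close>

lemma ex_isometry:
  assumes conn: "\<And>i j. i < N \<Longrightarrow> j < N \<Longrightarrow> (i, j) \<in> (edges A)\<^sup>+"
    and "\<not> permutation_matrix A" and i: "i < N"
  shows "\<exists>w\<in>B. star w * w = 1 \<and> Q i * w = w"
proof -
  obtain l j j' where branch: "(l, j) \<in> edges A" "(l, j') \<in> edges A" "j \<noteq> j'"
    using permutation_matrixI[OF A conn] assms(2) by blast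
  then have l: "l < N" using A(1) by (auto simp: edges_def)
  obtain w where w: "w \<in> B" "star w * w = 1" "Q l * w = w"
    using ex_isometry_branching[OF conn branch] by blast
  obtain z where z: "path_isometry i l z"
    using path_isometry_trancl[OF conn[OF i l]] by blast
  have "star (z * w) * (z * w) = star w * (star z * z * w)"
    by (simp add: star_mult mult.assoc)
  moreover have "Q i * (z * w) = Q i * z * w" by (simp add: mult.assoc)
  ultimately show ?thesis
    using w z B(1) by (intro bexI[of _ "z * w"]) (auto simp: path_isometry_def star_subringD)
qed

end

lemma cstar_subalgebra_hull: "cstar_subalgebra (cstar_subalgebra hull G)"
  by (rule hull_in) (auto simp: cstar_subalgebra_def intro: closed_Inter)

lemma star_subring_cstar_subalgebra: 
  assumes "cstar_subalgebra B" "1 \<in> B"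
  shows "star_subring B"
proof -
  have "- x \<in> B" if "x \<in> B" for x
    using assms(1) that scaleC_minus_one[of x] unfolding cstar_subalgebra_def by metis
  then show ?thesis
    using assms unfolding cstar_subalgebra_def star_subring_def by blast
qed

lemma cstar_subalgebra_sum:
  "cstar_subalgebra B \<Longrightarrow> (\<And>i. i \<in> F \<Longrightarrow> f i \<in> B) \<Longrightarrow> sum f F \<in> B"
  by (induction F rule: infinite_finite_induct) (auto simp: cstar_subalgebra_def)

text \<open>The hull does not contain 1 by definition; the relation that writes 1 as the sum of the
  range projections puts it there.\<close>

lemma ck_family_cuntz_krieger_algebra:
  assumes "A \<in> carrier_mat N N" "elements_mat A \<subseteq> {0, 1}" "cuntz_krieger_algebra A B S"
  shows "ck_family N A S B"
proof -
  have B: "B = cstar_subalgebra hull (S ` {..<N})" and fam: "cuntz_krieger_family A S"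
    using assms by (auto simp: cuntz_krieger_algebra_def)
  have sub: "cstar_subalgebra B" unfolding B by (rule cstar_subalgebra_hull)
  have S: "S i \<in> B" if "i < N" for i
    unfolding B using that by (intro hull_inc) auto
  have "(\<Sum>i<N. S i * star (S i)) \<in> B"
    using S sub by (intro cstar_subalgebra_sum) (auto simp: cstar_subalgebra_def)
  then have "1 \<in> B" using fam assms(1) by (simp add: cuntz_krieger_family_def)
  then show ?thesis
    using assms fam S star_subring_cstar_subalgebra[OF sub] by unfold_locales auto
qed

section \<open>Tensor products of operators and compact operators\<close>

lemma tensor_unit_ell2: "tensor_ell2 (unit_ell2 i) (unit_ell2 j) = unit_ell2 (i, j)"
  by (rule ell2_eqI) (auto simp: tensor_ell2.rep_eq unit_ell2.rep_eq split: prod.splits)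

lemma bop_eqI_unit:
  fixes T T' :: "'i bop"
  assumes "\<And>i. T \<cdot> unit_ell2 i = T' \<cdot> unit_ell2 i"
  shows "T = T'"
proof (rule bop_eqI)
  fix x :: "'i ell2"
  have hs: "((\<lambda>p. V \<cdot> ell2_coord x p *\<^sub>C unit_ell2 p) has_sum V \<cdot> x) UNIV" for V
    by (rule has_sum_bounded_linear[OF bounded_linear_bop_apply has_sum_unit_ell2])
  show "T \<cdot> x = T' \<cdot> x"
    by (rule has_sum_unique[OF _ hs]) (use hs[of T] in \<open>simp add: assms\<close>)
qed

lemma ell2_coord_star: "ell2_coord (star T \<cdot> x) i = cnj (cinner x (T \<cdot> unit_ell2 i))"
  by (metis cinner_commute cinner_star cinner_unit_ell2)

lemma tensor_bop_unit: "(a \<otimes>\<^sub>B b) \<cdot> unit_ell2 (i, j) = tensor_ell2 (a \<cdot> unit_ell2 i) (b \<cdot> unit_ell2 j)"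
  unfolding tensor_unit_ell2[symmetric] by (rule tensor_bop_apply)

text \<open>Comparison of matrix coefficients, by which identities for tensor products of operators
  are reduced to coordinates.\<close>

lemma tensor_bop_eqI:
  assumes "\<And>i j k l. ell2_coord (T \<cdot> unit_ell2 (i, j)) (k, l) = ell2_coord (T' \<cdot> unit_ell2 (i, j)) (k, l)"
  shows "T = T'"
proof (rule bop_eqI_unit, rule ell2_eqI)
  fix p r :: "'a \<times> 'b"
  show "ell2_coord (T \<cdot> unit_ell2 p) r = ell2_coord (T' \<cdot> unit_ell2 p) r"
    by (cases p; cases r) (simp add: assms)
qed

lemma tensor_bop_mult: "(a \<otimes>\<^sub>B b) * (c \<otimes>\<^sub>B d) = (a * c) \<otimes>\<^sub>B (b * d)"
proof (rule bop_eqI_unit)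
  fix p :: "'a \<times> 'b"
  show "((a \<otimes>\<^sub>B b) * (c \<otimes>\<^sub>B d)) \<cdot> unit_ell2 p = ((a * c) \<otimes>\<^sub>B (b * d)) \<cdot> unit_ell2 p"
    by (cases p) (simp add: tensor_bop_unit tensor_bop_apply)
qed

lemma tensor_bop_star: "star (a \<otimes>\<^sub>B b) = star a \<otimes>\<^sub>B star b"
proof (rule tensor_bop_eqI)
  fix i j k l
  show "ell2_coord (star (a \<otimes>\<^sub>B b) \<cdot> unit_ell2 (i, j)) (k, l) =
      ell2_coord ((star a \<otimes>\<^sub>B star b) \<cdot> unit_ell2 (i, j)) (k, l)"
    by (simp add: ell2_coord_star tensor_bop_unit)
qed

lemma tensor_bop_linear:
  "(a + a') \<otimes>\<^sub>B b = a \<otimes>\<^sub>B b + a' \<otimes>\<^sub>B b" "a \<otimes>\<^sub>B (b + b') = a \<otimes>\<^sub>B b + a \<otimes>\<^sub>B b'"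
  "(c *\<^sub>C a) \<otimes>\<^sub>B b = c *\<^sub>C (a \<otimes>\<^sub>B b)" "0 \<otimes>\<^sub>B b = 0" "a \<otimes>\<^sub>B 0 = 0" "1 \<otimes>\<^sub>B 1 = 1"
  by (rule tensor_bop_eqI; simp add: tensor_bop_unit tensor_unit_ell2 algebra_simps)+

text \<open>Reading coordinates along \<open>h\<close> gives a formula on all vectors; injectivity
  means that no coordinate is counted twice, so the norm does not grow. The isometry itself is
  obtained as the adjoint.\<close>

lemma ex_coisometry_reindex:
  fixes h :: "nat \<Rightarrow> nat"
  assumes "inj h"
  shows "\<exists>a :: nat bop. \<forall>x n. ell2_coord (a \<cdot> x) n = ell2_coord x (h n)"
proof -
  have bd: "(\<Sum>i\<in>F. (cmod (ell2_coord x (h i)))\<^sup>2) \<le> (norm x)\<^sup>2" if "finite F" for x :: "nat ell2" and F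
  proof -
    have "(\<Sum>i\<in>F. (cmod (ell2_coord x (h i)))\<^sup>2) = (\<Sum>i\<in>h ` F. (cmod (ell2_coord x i))\<^sup>2)"
      using assms by (subst sum.reindex) (auto intro: inj_on_subset)
    then show ?thesis using sum_ell2_coord_le[of "h ` F" x] that by simp
  qed
  note mem = ell2I_bounded[OF bd norm_ge_zero]
  define f where "f x = Abs_ell2 (\<lambda>n. ell2_coord x (h n))" for x
  have f: "ell2_coord (f x) n = ell2_coord x (h n)" for x n
    using mem(1)[of x] by (simp add: f_def Abs_ell2_inverse)
  obtain a :: "nat bop" where "\<And>x. a \<cdot> x = f x"
    by (rule bopI[of f 1]) (use mem(2) in \<open>auto intro!: ell2_eqI simp: f, auto simp: f_def\<close>)
  then show ?thesis by (intro exI[of _ a]) (simp add: f)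
qed

text \<open>These are the adjoints of the isometries of \<open>\<ell>\<^sup>2(\<nat>)\<close> onto the even and the odd coordinates.\<close>
lemma ex_complementary_coisometries:
  obtains a1 a2 :: "nat bop" where "a1 * star a1 = 1" "a2 * star a2 = 1" "a1 * star a2 = 0" "a2 * star a1 = 0"
    "star a1 * a1 + star a2 * a2 = 1"
proof -
  have "inj (\<lambda>n :: nat. 2 * n)" "inj (\<lambda>n :: nat. 2 * n + 1)" by (auto simp: inj_def)
  from this[THEN ex_coisometry_reindex] obtain a1 a2 :: "nat bop"
    where a: "\<And>x n. ell2_coord (a1 \<cdot> x) n = ell2_coord x (2 * n)" "\<And>x n. ell2_coord (a2 \<cdot> x) n = ell2_coord x (2 * n + 1)"
    by blast
  have u: "a1 \<cdot> unit_ell2 m = (if even m then unit_ell2 (m div 2) else 0)"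
    "a2 \<cdot> unit_ell2 m = (if odd m then unit_ell2 (m div 2) else 0)" for m
    by (rule ell2_eqI; auto simp: a unit_ell2.rep_eq elim!: evenE oddE; presburger)+
  have s: "ell2_coord (star a1 \<cdot> x) m = (if even m then ell2_coord x (m div 2) else 0)"
    "ell2_coord (star a2 \<cdot> x) m = (if odd m then ell2_coord x (m div 2) else 0)" for x m
  proof -
    have c: "cnj (cinner x (unit_ell2 n)) = ell2_coord x n" "cinner x 0 = 0" for x :: "nat ell2" and n
      using cinner_commute[of x "unit_ell2 n"] cinner_scaleC(2)[of x 0 0] by (auto simp: ell2_scaleC_rules)
    show "ell2_coord (star a1 \<cdot> x) m = (if even m then ell2_coord x (m div 2) else 0)"
      "ell2_coord (star a2 \<cdot> x) m = (if odd m then ell2_coord x (m div 2) else 0)"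
      by (simp_all add: ell2_coord_star u c)
  qed
  show thesis
    by (rule that[of a1 a2]; rule bop_eqI; rule ell2_eqI; simp add: a s)
qed

section \<open>Compact operators\<close>

lemma compact_operators_ideal:
  fixes a b k :: "'i bop"
  assumes k: "k \<in> compact_operators"
  shows "a * k * b \<in> compact_operators"
proof -
  \<comment> \<open>\<open>b\<close> maps the unit ball into the ball of radius \<open>M\<close>;
    adding 1 allows division by \<open>M\<close> even if \<open>b\<close> is 0.\<close>
  define M where "M = norm b + 1"
  have M: "M > 0" unfolding M_def using norm_ge_zero[of b] by linarith
  let ?C = "closure ((\<lambda>x. k \<cdot> x) ` cball 0 1)"
  let ?g = "\<lambda>y. a \<cdot> (M *\<^sub>R y)"
  have "continuous_on UNIV ?g"
    by (intro linear_continuous_on bounded_linear_compose[OF bounded_linear_bop_apply bounded_linear_scaleR_right])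
  then have cpt: "compact (?g ` ?C)"
    using k by (intro compact_continuous_image) (auto simp: compact_operators_def intro: continuous_on_subset)
  have "(\<lambda>x. (a * k * b) \<cdot> x) ` cball 0 1 \<subseteq> ?g ` ?C"
  proof (rule image_subsetI)
    fix x :: "'i ell2" assume "x \<in> cball 0 1"
    then have x: "norm x \<le> 1" by simp
    define z where "z = (b \<cdot> x) /\<^sub>R M"
    have "norm (b \<cdot> x) \<le> norm b * norm x" by (rule norm_bop_apply_le)
    also have "\<dots> \<le> M" using x mult_left_le[of "norm x" "norm b"] by (simp add: M_def)
    finally have "norm z \<le> 1" using M by (simp add: z_def field_simps)
    then have "k \<cdot> z \<in> ?C" by (intro closure_subset[THEN subsetD]) auto
    moreover have "(a * k * b) \<cdot> x = ?g (k \<cdot> z)" using M by (simp add: z_def)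
    ultimately show "(a * k * b) \<cdot> x \<in> ?g ` ?C" by blast
  qed
  then have "closure ((\<lambda>x. (a * k * b) \<cdot> x) ` cball 0 1) \<subseteq> ?g ` ?C"
    by (rule closure_minimal) (rule compact_imp_closed[OF cpt])
  then show ?thesis
    unfolding compact_operators_def using cpt by (metis closed_closure compact_Int_closed inf.absorb_iff2 mem_Collect_eq)
qed

text \<open>The image of the unit ball lies in a compact disc of multiples of the spanning vector.
  This makes \<open>b \<otimes>\<^sub>B e\<close> an element of the stabilization for every
  \<open>e\<close> that \<open>induced_K0_iso\<close> quantifies over.\<close>

lemma rank_one_projection_compact:
  fixes e :: "'i bop"
  assumes "rank_one_projection e"
  shows "e \<in> compact_operators"
proof -
  obtain x where x: "x \<noteq> 0" "range (\<lambda>y. e \<cdot> y) = range (\<lambda>c. c *\<^sub>C x)"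
    using assms by (auto simp: rank_one_projection_def)
  define M where "M = norm e / norm x"
  have "bounded_linear (\<lambda>c. c *\<^sub>C x)"
    by (rule bounded_linear_intro[where K = "norm x"]) (auto simp: ell2_scaleC_rules norm_scaleC_ell2 scaleR_conv_of_real)
  then have cpt: "compact ((\<lambda>c. c *\<^sub>C x) ` cball 0 M)"
    by (intro compact_continuous_image linear_continuous_on) auto
  have "(\<lambda>y. e \<cdot> y) ` cball 0 1 \<subseteq> (\<lambda>c. c *\<^sub>C x) ` cball 0 M"
  proof (clarsimp)
    fix y :: "'i ell2" assume y: "norm y \<le> 1"
    obtain c where c: "e \<cdot> y = c *\<^sub>C x" using x(2) by blast
    have "cmod c * norm x \<le> norm e * norm y"
      using norm_bop_apply_le[of e y] by (simp add: c norm_scaleC_ell2)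
    also have "\<dots> \<le> norm e" using y by (simp add: mult_left_le)
    finally have "cmod c \<le> M" using x(1) by (simp add: M_def field_simps)
    then show "e \<cdot> y \<in> (\<lambda>c. c *\<^sub>C x) ` cball 0 M" using c by auto
  qed
  then have "closure ((\<lambda>y. e \<cdot> y) ` cball 0 1) \<subseteq> (\<lambda>c. c *\<^sub>C x) ` cball 0 M"
    by (rule closure_minimal) (rule compact_imp_closed[OF cpt])
  then show ?thesis
    unfolding compact_operators_def using cpt by (metis closed_closure compact_Int_closed inf.absorb_iff2 mem_Collect_eq)
qed

section \<open>Tensor products of algebras and subalgebras cut out by conjugation\<close>

lemma star_subalgebra_cstar_subalgebra: "cstar_subalgebra B \<Longrightarrow> star_subalgebra B"
  by (simp add: cstar_subalgebra_def star_subalgebra_def)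

lemma cstar_tensor_cstar_subalgebra: "cstar_subalgebra (B \<otimes>\<^sub>C C)"
  unfolding cstar_tensor_def by (rule cstar_subalgebra_hull)

lemma cstar_tensorI: "b \<in> B \<Longrightarrow> c \<in> C \<Longrightarrow> b \<otimes>\<^sub>B c \<in> B \<otimes>\<^sub>C C"
  unfolding cstar_tensor_def by (rule hull_inc) blast

lemma cstar_tensor_minimal:
  "(\<And>b c. b \<in> B \<Longrightarrow> c \<in> C \<Longrightarrow> b \<otimes>\<^sub>B c \<in> D) \<Longrightarrow> cstar_subalgebra D \<Longrightarrow> B \<otimes>\<^sub>C C \<subseteq> D"
  unfolding cstar_tensor_def by (rule hull_minimal) auto

text \<open>Conjugation by a partial isometry with initial projection \<open>g\<close> is multiplicative on the corner of \<open>g\<close>.\<close>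
lemma cstar_subalgebra_conj:
  fixes u :: "'i bop"
  assumes B: "cstar_subalgebra B" and g: "is_projection g" "star u * u = g"
  shows "cstar_subalgebra {x. g * x = x \<and> x * g = x \<and> u * x * star u \<in> B}"
proof -
  let ?X = "{x. g * x = x \<and> x * g = x \<and> u * x * star u \<in> B}"
  have cont: "continuous_on UNIV (\<lambda>x. p * x * q)" for p q :: "'i bop"
    by (intro continuous_intros)
  have "closed B" using B by (simp add: cstar_subalgebra_def)
  then have "closed ((\<lambda>x. u * x * star u) -` B)"
    by (rule closed_vimage[OF _ cont])
  moreover have "closed {x. g * x = x}" "closed {x. x * g = x}"
    by (intro closed_Collect_eq continuous_intros)+
  moreover have "?X = {x. g * x = x} \<inter> {x. x * g = x} \<inter> ((\<lambda>x. u * x * star u) -` B)" by auto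
  ultimately have closed: "closed ?X" by auto
  have left: "g * (x * y) = x * y" if "g * x = x" for x y
    using that by (metis mult.assoc)
  have mult: "u * (x * (y * star u)) \<in> B" if "g * y = y" "u * (x * star u) \<in> B" "u * (y * star u) \<in> B" for x y
  proof -
    \<comment> \<open>\<open>g\<close>, which acts as a unit on \<open>y\<close>, is inserted
      between the factors in the form \<open>star u * u\<close>.\<close>
    have "u * (x * (y * star u)) = u * (x * star u) * (u * (y * star u))"
      using that(1) unfolding g(2)[symmetric] by (metis mult.assoc)
    then show ?thesis using B that by (simp add: cstar_subalgebra_def)
  qed
  have star: "g * star x = star x" "star x * g = star x" if "x * g = x" "g * x = x" for x
    using arg_cong[OF that(1), of star] arg_cong[OF that(2), of star] g(1)
    by (simp_all add: star_mult is_projection_def)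
  have star': "u * (star x * star u) \<in> B" if "u * (x * star u) \<in> B" for x
  proof -
    have "u * (star x * star u) = star (u * (x * star u))" by (simp add: star_mult star_star mult.assoc)
    then show ?thesis using B that by (simp add: cstar_subalgebra_def)
  qed
  show ?thesis
    using B closed unfolding cstar_subalgebra_def
    by (auto simp: distrib_left distrib_right mult_scaleC_left mult_scaleC_right left mult star star' mult.assoc)
qed

section \<open>Stable isomorphism of a corner\<close>

text \<open>The isometry \<open>w\<close> makes 1 equivalent to a subprojection of \<open>E\<close>,
  a strong form of fullness of the corner. Through \<open>star w * w\<close> it also shows that
  \<open>D\<close> contains 1.\<close>

locale full_corner =
  fixes D :: "'k bop set" and E w :: "'k bop"
  assumes D: "cstar_subalgebra D" and E_mem: "E \<in> D" and E: "is_projection E"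
    and w_mem: "w \<in> D" and w: "star w * w = 1" and E_w: "E * w = w"
begin

abbreviation R :: "'k bop set" where
  "R \<equiv> corner E D"

lemma D_closed:
  "x \<in> D \<Longrightarrow> y \<in> D \<Longrightarrow> x + y \<in> D" "x \<in> D \<Longrightarrow> y \<in> D \<Longrightarrow> x - y \<in> D" "x \<in> D \<Longrightarrow> y \<in> D \<Longrightarrow> x * y \<in> D"
  "x \<in> D \<Longrightarrow> star x \<in> D" "1 \<in> D"
proof -
  note sub = star_subalgebraD[OF star_subalgebra_cstar_subalgebra[OF D]]
  show "x \<in> D \<Longrightarrow> y \<in> D \<Longrightarrow> x + y \<in> D" "x \<in> D \<Longrightarrow> y \<in> D \<Longrightarrow> x - y \<in> D" "x \<in> D \<Longrightarrow> y \<in> D \<Longrightarrow> x * y \<in> D"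
    "x \<in> D \<Longrightarrow> star x \<in> D" by (fact sub)+
  show "1 \<in> D" unfolding w[symmetric] using w_mem by (intro sub)
qed

lemma E_simps: "E * E = E" "star E = E"
  using E by (auto simp: is_projection_def)

lemma R_iff: "x \<in> R \<longleftrightarrow> x \<in> D \<and> E * x = x \<and> x * E = x"
proof
  assume "x \<in> R"
  then obtain d where "d \<in> D" "x = E * d * E" by (auto simp: corner_def)
  moreover have "E * (E * d * E) = E * E * d * E" "E * d * E * E = E * d * (E * E)"
    by (simp_all only: mult.assoc)
  ultimately show "x \<in> D \<and> E * x = x \<and> x * E = x"
    using E_mem by (auto simp: E_simps D_closed)
next
  assume "x \<in> D \<and> E * x = x \<and> x * E = x"
  then show "x \<in> R" unfolding corner_def by (intro CollectI exI[of _ x]) auto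
qed

lemma R_subalgebra: "star_subalgebra R"
proof -
  have left: "E * (x * y) = x * y" if "E * x = x" for x y
    using that by (metis mult.assoc)
  have st: "E * star x = star x" "star x * E = star x" if "E * x = x" "x * E = x" for x
    using arg_cong[OF that(1), of star] arg_cong[OF that(2), of star] by (simp_all add: star_mult E_simps)
  show ?thesis
    using D unfolding star_subalgebra_def cstar_subalgebra_def
    by (auto simp: R_iff distrib_left distrib_right mult_scaleC_left mult_scaleC_right st mult.assoc left)
qed

lemma alg_unit_R: "alg_unit R = E"
  unfolding alg_unit_def
proof (rule the_equality)
  show "E \<in> R \<and> (\<forall>x\<in>R. E * x = x \<and> x * E = x)"
    by (simp add: R_iff E_mem E_simps)
  show "u = E" if "u \<in> R \<and> (\<forall>x\<in>R. u * x = x \<and> x * u = x)" for u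
    using that by (metis R_iff E_mem E_simps(1))
qed

lemma inclusion_hom: "star_hom R D (\<lambda>x. x)"
  by (simp add: star_hom_def R_iff)

lemma D_subalgebra: "star_subalgebra D"
  using D by (rule star_subalgebra_cstar_subalgebra)

lemma w_E: "star w * E = star w"
  using arg_cong[OF E_w, of star] by (simp add: star_mult E_simps)

lemma compression_hom: "star_hom D R (\<lambda>x. w * x * star w)"
proof -
  have mult: "w * (x * y) * star w = w * x * star w * (w * y * star w)" for x y
  proof -
    have "w * x * star w * (w * y * star w) = w * x * (star w * w) * y * star w"
      by (simp only: mult.assoc)
    then show ?thesis by (simp add: w mult.assoc)
  qed
  have E_conj: "E * (w * x * star w) = w * x * star w" "w * x * star w * E = w * x * star w" for x
  proof -
    have "E * (w * x * star w) = E * w * x * star w" "w * x * star w * E = w * x * (star w * E)"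
      by (simp_all only: mult.assoc)
    then show "E * (w * x * star w) = w * x * star w" "w * x * star w * E = w * x * star w"
      by (simp_all add: E_w w_E)
  qed
  show ?thesis
    unfolding star_hom_def R_iff
    by (intro conjI ballI allI)
      (simp_all only: D_closed w_mem E_conj mult, simp_all add: star_mult star_star distrib_left distrib_right
        mult_scaleC_left mult_scaleC_right mult.assoc)
qed

text \<open>Both composites of inclusion and compression are conjugation by \<open>w\<close>, once
  regarded on \<open>R\<close> and once on \<open>D\<close>, and \<open>K0_map_conj\<close>
  identifies them with the identity.\<close>

lemma inclusion_iso: "K0_map D (\<lambda>x. x) \<in> iso (K0 R) (K0 D)"
proof (rule isoI)
  show "K0_map D (\<lambda>x. x) \<in> hom (K0 R) (K0 D)"
    by (rule K0_map_hom[OF R_subalgebra D_subalgebra inclusion_hom])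
  show "bij_betw (K0_map D (\<lambda>x. x)) (carrier (K0 R)) (carrier (K0 D))"
  proof (rule bij_betw_byWitness[where f' = "K0_map R (\<lambda>x. w * x * star w)"])
    have idR: "star_hom R R (\<lambda>x. x)" and idD: "star_hom D D (\<lambda>x. x)" by (auto simp: star_hom_def)
    have compR: "star_hom R R (\<lambda>x. w * x * star w)" and compD: "star_hom D D (\<lambda>x. w * x * star w)"
      using compression_hom by (auto simp: star_hom_def R_iff)
    have EwwE: "star (w * E) * (w * E) = E"
    proof -
      have "star (w * E) * (w * E) = E * (star w * w) * E"
        by (simp add: star_mult E_simps mult.assoc)
      then show ?thesis by (simp add: w E_simps)
    qed
    show "\<forall>X\<in>carrier (K0 R). K0_map R (\<lambda>x. w * x * star w) (K0_map D (\<lambda>x. x) X) = X"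
    proof
      fix X assume X: "X \<in> carrier (K0 R)"
      have "K0_map R (\<lambda>x. w * x * star w) (K0_map D (\<lambda>x. x) X) = K0_map R (\<lambda>x. w * x * star w) X"
        by (rule K0_map_comp[OF R_subalgebra D_subalgebra R_subalgebra inclusion_hom compression_hom X])
      \<comment> \<open>\<open>w\<close> need not lie in \<open>R\<close>. The element
        \<open>w * E\<close> does, conjugates elements of \<open>R\<close> in the same way, and has
        the unit \<open>E\<close> of \<open>R\<close> as its initial projection.\<close>
      also have "\<dots> = K0_map R (\<lambda>x. x) X"
      proof (rule K0_map_conj[OF R_subalgebra R_subalgebra idR compR, symmetric, where y = "w * E"])
        show "w * E \<in> R"
          using w_mem E_mem by (simp add: R_iff D_closed mult.assoc E_simps) (simp add: mult.assoc[symmetric] E_w)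
        show "w * E * star (w * E) * (w * E) = w * E"
          unfolding mult.assoc EwwE by (simp add: E_simps)
        show "star (w * E) * (w * E) * c = c" if "c \<in> R" for c
          using that unfolding EwwE R_iff by simp
        show "w * c * star w = w * E * c * star (w * E)" if "c \<in> R" for c
        proof -
          have "w * E * c * star (w * E) = w * (E * c * E) * star w" by (simp add: star_mult E_simps mult.assoc)
          then show ?thesis using that by (simp add: R_iff)
        qed
      qed (rule X)
      also have "\<dots> = X" by (rule K0_map_id[OF R_subalgebra X])
      finally show "K0_map R (\<lambda>x. w * x * star w) (K0_map D (\<lambda>x. x) X) = X" .
    qed
    show "\<forall>X\<in>carrier (K0 D). K0_map D (\<lambda>x. x) (K0_map R (\<lambda>x. w * x * star w) X) = X"
    proof
      fix X assume X: "X \<in> carrier (K0 D)"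
      have "K0_map D (\<lambda>x. x) (K0_map R (\<lambda>x. w * x * star w) X) = K0_map D (\<lambda>x. w * x * star w) X"
        by (rule K0_map_comp[OF D_subalgebra R_subalgebra D_subalgebra compression_hom inclusion_hom X])
      also have "\<dots> = K0_map D (\<lambda>x. x) X"
        by (rule K0_map_conj[OF D_subalgebra D_subalgebra idD compD, symmetric, where y = w])
          (use w_mem w X in \<open>simp_all add: mult.assoc\<close>)
      also have "\<dots> = X" by (rule K0_map_id[OF D_subalgebra X])
      finally show "K0_map D (\<lambda>x. x) (K0_map R (\<lambda>x. w * x * star w) X) = X" .
    qed
    show "K0_map D (\<lambda>x. x) ` carrier (K0 R) \<subseteq> carrier (K0 D)"
      using K0_map_closed[OF R_subalgebra D_subalgebra inclusion_hom] by blast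
    show "K0_map R (\<lambda>x. w * x * star w) ` carrier (K0 D) \<subseteq> carrier (K0 R)"
      using K0_map_closed[OF D_subalgebra R_subalgebra compression_hom] by blast
  qed
qed

lemma inclusion_class: "K0_map D (\<lambda>x. x) (K0_class R (alg_unit R)) = K0_class D E"
proof -
  have 1: "mat 1 1 (\<lambda>_. Unitization E 0) \<in> mat_projections (unitize R)"
  proof (rule mat_projectionsI)
    show "mat 1 1 (\<lambda>_. Unitization E 0) * mat 1 1 (\<lambda>_. Unitization E 0) = mat 1 1 (\<lambda>_. Unitization E 0)"
      by (rule eq_matI) (auto simp: scalar_prod_def unitization_defs E_simps scaleC_one)
    show "mat_star (mat 1 1 (\<lambda>_. Unitization E 0)) = mat 1 1 (\<lambda>_. Unitization E 0)"
      by (rule eq_matI) (auto simp: unitization_defs E_simps)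
  qed (auto simp: elements_mat_subset_iff unitize_def R_iff E_mem E_simps scaleC_one)
  have "map_mat (unitize_map (\<lambda>x. x)) M = M" for M :: "'k bop unitization mat"
    by (rule eq_matI) (auto simp: unitize_map_def)
  then show ?thesis
    unfolding K0_class_def alg_unit_R
    by (simp only: K0_map_diff[OF R_subalgebra D_subalgebra inclusion_hom 1 mat_projections_empty])
qed

text \<open>With \<open>f = E - w w\<^sup>*\<close>, the Hilbert space splits as the sum of the ranges of \<open>1 - f\<close> and \<open>f\<close>, and the
  range of \<open>E\<close> as the sum of the images of these under \<open>w\<close> and another copy of the range of \<open>f\<close>. After tensoring
  with \<open>\<ell>\<^sup>2(\<nat>)\<close>, one copy of the range of \<open>f\<close> is isomorphic to two of them.\<close>
lemma ex_stable_isometry: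
  obtains v :: "('k \<times> nat) bop" where "star v * v = 1" "v * star v = E \<otimes>\<^sub>B 1"
    "\<And>d k. d \<in> D \<Longrightarrow> k \<in> \<K> \<Longrightarrow> v * (d \<otimes>\<^sub>B k) * star v \<in> R \<otimes>\<^sub>C \<K>"
    "\<And>d k. d \<in> D \<Longrightarrow> k \<in> \<K> \<Longrightarrow> star v * (d \<otimes>\<^sub>B k) \<in> D \<otimes>\<^sub>C \<K>"
    "\<And>d k. d \<in> D \<Longrightarrow> k \<in> \<K> \<Longrightarrow> star v * (d \<otimes>\<^sub>B k) * v \<in> D \<otimes>\<^sub>C \<K>"
proof -
  obtain a1 a2 :: "nat bop" where a: "a1 * star a1 = 1" "a2 * star a2 = 1" "a1 * star a2 = 0" "a2 * star a1 = 0"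
    "star a1 * a1 + star a2 * a2 = 1"
    by (rule ex_complementary_coisometries)
  define f where "f = E - w * star w"
  have ww: "w * star w * (w * star w) = w * star w"
    by (metis w mult.assoc mult_1)
  have Eww: "E * (w * star w) = w * star w" "w * star w * E = w * star w"
    by (simp add: mult.assoc[symmetric] E_w, simp add: mult.assoc w_E)
  have f_mem: "f \<in> D" unfolding f_def by (intro D_closed E_mem w_mem)
  have sf: "star f = f" by (simp add: f_def star_diff star_mult star_star E_simps)
  have ff: "f * f = f" unfolding f_def by (simp add: left_diff_distrib right_diff_distrib E_simps Eww ww)
  have Ef: "E * f = f" unfolding f_def by (simp add: right_diff_distrib E_simps Eww)
  have fw: "f * w = 0" unfolding f_def by (simp add: left_diff_distrib E_w mult.assoc w)
  have wf: "star w * f = 0" using arg_cong[OF fw, of star] by (simp add: star_mult sf)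
  define X where "X i = (if i = 0 then w * (1 - f) else if i = 1 then w * f else f)" for i :: nat
  define b where "b i = (if i = 0 then 1 else if i = 1 then a1 else a2)" for i :: nat
  \<comment> \<open>Written out, \<open>v\<close> is \<open>(w * (1 - f)) \<otimes>\<^sub>B 1 + (w *
    f) \<otimes>\<^sub>B a1 + f \<otimes>\<^sub>B a2\<close>: the even half of the stabilized range
    of \<open>f\<close> fills the image under \<open>w\<close>, the odd half fills the second
    copy.\<close>
  define v where "v = (\<Sum>i<3. X i \<otimes>\<^sub>B b i)"
  have sv: "star v = (\<Sum>i<3. star (X i) \<otimes>\<^sub>B star (b i))"
    by (simp add: v_def star_sum tensor_bop_star)
  have XD: "X i \<in> D" and EX: "E * X i = X i" for i
    by (auto simp: X_def D_closed w_mem f_mem Ef E_w mult.assoc[symmetric])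
  have XE: "star (X i) * E = star (X i)" for i
    using arg_cong[OF EX[of i], of star] by (simp add: star_mult E_simps)
  show thesis
  proof (rule that)
    have 3: "(\<Sum>i<3. g i) = g 0 + g 1 + g 2" for g :: "nat \<Rightarrow> 'z :: comm_monoid_add"
      by (simp add: numeral_3_eq_3 numeral_2_eq_2)
    have wwf: "star w * (w * x) = x" "star w * (f * x) = 0" "f * (w * x) = 0" "f * (f * x) = f * x" for x
      by (simp_all add: mult.assoc[symmetric] w wf fw ff)
    have cross: "star (X i) * X j = (if i = j then (if i = 0 then 1 - f else f) else 0)" if "i < 3" "j < 3" for i j
      using that by (auto simp: X_def star_mult star_diff sf left_diff_distrib right_diff_distrib mult.assoc wwf ff fw wf w)
    have "star v * v = (\<Sum>i<3. \<Sum>j<3. (star (X i) * X j) \<otimes>\<^sub>B (star (b i) * b j))"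
      unfolding sv unfolding v_def by (simp add: sum_product tensor_bop_mult)
    also have "\<dots> = (\<Sum>i<3. \<Sum>j<3. if j = i then (if i = 0 then 1 - f else f) \<otimes>\<^sub>B (star (b i) * b i) else 0)"
      by (intro sum.cong refl) (auto simp: cross tensor_bop_linear)
    also have "\<dots> = (1 - f) \<otimes>\<^sub>B 1 + (f \<otimes>\<^sub>B (star a1 * a1) + f \<otimes>\<^sub>B (star a2 * a2))"
      by (simp add: 3 b_def add.assoc)
    also have "\<dots> = 1"
      by (simp add: tensor_bop_linear(2)[symmetric] tensor_bop_linear(1)[symmetric] tensor_bop_linear(6) a(5))
    finally show "star v * v = 1" .
    \<comment> \<open>\<open>X 1\<close> and \<open>X 2\<close> share the initial projection
      \<open>f\<close>, so their mixed terms vanish because \<open>a1 * star a2 = 0\<close>; those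
      with \<open>X 0\<close> vanish because \<open>(1 - f) * f = 0\<close>.\<close>
    have "v * star v = (\<Sum>i<3. \<Sum>j<3. (X i * star (X j)) \<otimes>\<^sub>B (b i * star (b j)))"
      unfolding sv unfolding v_def by (simp add: sum_product tensor_bop_mult)
    also have "\<dots> = (w * (1 - f) * star w) \<otimes>\<^sub>B 1 + ((w * f * star w) \<otimes>\<^sub>B 1 + f \<otimes>\<^sub>B 1)"
    proof -
      have ffx: "f * (f * x) = f * x" for x by (simp add: mult.assoc[symmetric] ff)
      show ?thesis
        by (simp add: 3 X_def b_def a star_mult star_diff sf mult.assoc left_diff_distrib right_diff_distrib ff ffx
            tensor_bop_linear)
    qed
    also have "\<dots> = (w * (1 - f) * star w + (w * f * star w + f)) \<otimes>\<^sub>B 1"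
      by (simp add: tensor_bop_linear)
    also have "w * (1 - f) * star w + (w * f * star w + f) = E"
      by (simp add: f_def algebra_simps)
    finally show "v * star v = E \<otimes>\<^sub>B 1" .
    fix d k assume d: "d \<in> D" and k: "k \<in> \<K>"
    have ideal: "x * k * y \<in> \<K>" "x * k \<in> \<K>" for x y
      using compact_operators_ideal[OF k] compact_operators_ideal[OF k, of x 1] by auto
    have "v * (d \<otimes>\<^sub>B k) * star v = (\<Sum>i<3. \<Sum>j<3. (X i * d * star (X j)) \<otimes>\<^sub>B (b i * k * star (b j)))"
      unfolding sv unfolding v_def by (simp add: sum_distrib_right sum_distrib_left tensor_bop_mult) (rule sum.swap)
    also have "\<dots> \<in> R \<otimes>\<^sub>C \<K>"
      using d by (intro cstar_subalgebra_sum cstar_tensor_cstar_subalgebra cstar_tensorI ideal)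
        (auto simp: R_iff D_closed XD EX XE mult.assoc simp flip: mult.assoc[of E])
    finally show "v * (d \<otimes>\<^sub>B k) * star v \<in> R \<otimes>\<^sub>C \<K>" .
    have "star v * (d \<otimes>\<^sub>B k) = (\<Sum>i<3. (star (X i) * d) \<otimes>\<^sub>B (star (b i) * k))"
      unfolding sv by (simp add: sum_distrib_right tensor_bop_mult)
    also have "\<dots> \<in> D \<otimes>\<^sub>C \<K>"
      using d by (intro cstar_subalgebra_sum cstar_tensor_cstar_subalgebra cstar_tensorI ideal D_closed XD)
    finally show "star v * (d \<otimes>\<^sub>B k) \<in> D \<otimes>\<^sub>C \<K>" .
    have "star v * (d \<otimes>\<^sub>B k) * v = (\<Sum>i<3. \<Sum>j<3. (star (X i) * d * X j) \<otimes>\<^sub>B (star (b i) * k * b j))"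
      unfolding sv unfolding v_def by (simp add: sum_distrib_right sum_distrib_left tensor_bop_mult) (rule sum.swap)
    also have "\<dots> \<in> D \<otimes>\<^sub>C \<K>"
      using d by (intro cstar_subalgebra_sum cstar_tensor_cstar_subalgebra cstar_tensorI ideal D_closed XD)
    finally show "star v * (d \<otimes>\<^sub>B k) * v \<in> D \<otimes>\<^sub>C \<K>" .
  qed
qed

lemma stable_iso:
  "\<exists>\<Phi>. star_iso (R \<otimes>\<^sub>C \<K>) (D \<otimes>\<^sub>C \<K>) \<Phi> \<and> induced_K0_iso R D \<Phi> (K0_map D (\<lambda>x. x))"
proof -
  obtain v :: "('k \<times> nat) bop" where v: "star v * v = 1" "v * star v = E \<otimes>\<^sub>B 1"
    and v_R: "\<And>d k. d \<in> D \<Longrightarrow> k \<in> \<K> \<Longrightarrow> v * (d \<otimes>\<^sub>B k) * star v \<in> R \<otimes>\<^sub>C \<K>"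
    and v_D: "\<And>d k. d \<in> D \<Longrightarrow> k \<in> \<K> \<Longrightarrow> star v * (d \<otimes>\<^sub>B k) \<in> D \<otimes>\<^sub>C \<K>"
      "\<And>d k. d \<in> D \<Longrightarrow> k \<in> \<K> \<Longrightarrow> star v * (d \<otimes>\<^sub>B k) * v \<in> D \<otimes>\<^sub>C \<K>"
    using ex_stable_isometry by blast
  define \<Phi> where "\<Phi> x = star v * x * v" for x
  define G :: "('k \<times> nat) bop" where "G = E \<otimes>\<^sub>B 1"
  have G: "is_projection G"
    by (simp add: G_def is_projection_def tensor_bop_mult tensor_bop_star E_simps)
  have vv: "star (star v) * star v = G" by (simp add: star_star v(2) G_def)
  have one: "is_projection (1 :: ('k \<times> nat) bop)" by (simp add: is_projection_def)
  \<comment> \<open>The right side is a C*-subalgebra, so the inclusion of the whole hull is checked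
    on elementary tensors alone.\<close>
  have RK: "R \<otimes>\<^sub>C \<K> \<subseteq> {x. G * x = x \<and> x * G = x \<and> star v * x * star (star v) \<in> D \<otimes>\<^sub>C \<K>}"
    by (rule cstar_tensor_minimal[OF _ cstar_subalgebra_conj[OF cstar_tensor_cstar_subalgebra G vv]])
      (auto simp: G_def tensor_bop_mult R_iff star_star v_D)
  have DK: "D \<otimes>\<^sub>C \<K> \<subseteq> {x. 1 * x = x \<and> x * 1 = x \<and> v * x * star v \<in> R \<otimes>\<^sub>C \<K>}"
    by (rule cstar_tensor_minimal[OF _ cstar_subalgebra_conj[OF cstar_tensor_cstar_subalgebra one v(1)]])
      (auto simp: v_R)
  have RKD: "G * x = x" "x * G = x" "\<Phi> x \<in> D \<otimes>\<^sub>C \<K>" if "x \<in> R \<otimes>\<^sub>C \<K>" for x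
    using RK that by (auto simp: \<Phi>_def star_star)
  have \<Phi>_mult: "\<Phi> (x * y) = \<Phi> x * \<Phi> y" if "x \<in> R \<otimes>\<^sub>C \<K>" for x y
  proof -
    have "\<Phi> x * \<Phi> y = star v * (x * (v * star v)) * y * v" by (simp add: \<Phi>_def mult.assoc)
    also have "x * (v * star v) = x" using RKD(2)[OF that] by (simp only: v(2) G_def)
    finally show ?thesis by (simp add: \<Phi>_def mult.assoc)
  qed
  have \<Phi>_hom: "star_hom (R \<otimes>\<^sub>C \<K>) (D \<otimes>\<^sub>C \<K>) \<Phi>"
    using \<Phi>_mult RKD(3)
    by (auto simp: star_hom_def) (auto simp: \<Phi>_def distrib_left distrib_right mult_scaleC_left mult_scaleC_right
        star_mult star_star mult.assoc)
  have \<Phi>_bij: "bij_betw \<Phi> (R \<otimes>\<^sub>C \<K>) (D \<otimes>\<^sub>C \<K>)"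
  proof (rule bij_betw_byWitness[where f' = "\<lambda>y. v * y * star v"])
    show "\<forall>x\<in>R \<otimes>\<^sub>C \<K>. v * \<Phi> x * star v = x"
    proof
      fix x assume x: "x \<in> R \<otimes>\<^sub>C \<K>"
      have "v * \<Phi> x * star v = (v * star v) * x * (v * star v)" by (simp add: \<Phi>_def mult.assoc)
      then show "v * \<Phi> x * star v = x" using RKD(1,2)[OF x] by (simp add: v(2) G_def)
    qed
    show "\<forall>y\<in>D \<otimes>\<^sub>C \<K>. \<Phi> (v * y * star v) = y"
    proof
      fix y
      have "\<Phi> (v * y * star v) = (star v * v) * y * (star v * v)" by (simp add: \<Phi>_def mult.assoc)
      then show "\<Phi> (v * y * star v) = y" by (simp add: v(1))
    qed
  qed (use RKD(3) DK in auto)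
  have "induced_K0_iso R D \<Phi> (K0_map D (\<lambda>x. x))"
    unfolding induced_K0_iso_def
  proof (intro conjI allI impI ballI inclusion_iso)
    fix e :: "nat bop" and X assume "rank_one_projection e" and X: "X \<in> carrier (K0 R)"
    then have e: "e \<in> \<K>" "e * e = e" "star e = e"
      using rank_one_projection_compact by (auto simp: rank_one_projection_def is_projection_def)
    note sub = star_subalgebra_cstar_subalgebra[OF cstar_tensor_cstar_subalgebra]
    have hR: "star_hom R (R \<otimes>\<^sub>C \<K>) (\<lambda>b. b \<otimes>\<^sub>B e)" and hD: "star_hom D (D \<otimes>\<^sub>C \<K>) (\<lambda>b. b \<otimes>\<^sub>B e)"
      using e by (auto simp: star_hom_def cstar_tensorI tensor_bop_linear tensor_bop_mult tensor_bop_star)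
    have hRD: "star_hom R (D \<otimes>\<^sub>C \<K>) (\<lambda>b. b \<otimes>\<^sub>B e)"
      using hD by (auto simp: star_hom_def R_iff)
    have h\<Phi>: "star_hom R (D \<otimes>\<^sub>C \<K>) (\<lambda>b. \<Phi> (b \<otimes>\<^sub>B e))"
      using hR \<Phi>_hom by (auto simp: star_hom_def)
    \<comment> \<open>Unlike \<open>v\<close>, this \<open>y\<close> lies in the stabilization,
      since \<open>E \<otimes>\<^sub>B e\<close> does. On \<open>b \<otimes>\<^sub>B e\<close> with
      \<open>b\<close> in \<open>R\<close> the cut-down is invisible, so conjugation by
      \<open>y\<close> agrees with \<open>\<Phi>\<close> there.\<close>
    define y where "y = star v * (E \<otimes>\<^sub>B e)"
    have yy: "star y * y = E \<otimes>\<^sub>B e"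
    proof -
      have "star y * y = (E \<otimes>\<^sub>B e) * (v * star v) * (E \<otimes>\<^sub>B e)"
        by (simp add: y_def star_mult star_star tensor_bop_star E_simps e mult.assoc)
      then show ?thesis by (simp add: v(2) tensor_bop_mult E_simps e)
    qed
    have "K0_map (D \<otimes>\<^sub>C \<K>) (\<lambda>c. c \<otimes>\<^sub>B e) (K0_map D (\<lambda>x. x) X) = K0_map (D \<otimes>\<^sub>C \<K>) (\<lambda>c. c \<otimes>\<^sub>B e) X"
      by (rule K0_map_comp[OF R_subalgebra D_subalgebra sub inclusion_hom hD X])
    also have "\<dots> = K0_map (D \<otimes>\<^sub>C \<K>) (\<lambda>b. \<Phi> (b \<otimes>\<^sub>B e)) X"
    proof (rule K0_map_conj[OF R_subalgebra sub hRD h\<Phi> _ _ _ _ X])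
      show "y \<in> D \<otimes>\<^sub>C \<K>" unfolding y_def by (rule v_D(1)[OF E_mem e(1)])
      show "y * star y * y = y"
        unfolding mult.assoc yy by (simp add: y_def mult.assoc tensor_bop_mult E_simps e)
      fix c assume c: "c \<in> R"
      show "star y * y * (c \<otimes>\<^sub>B e) = c \<otimes>\<^sub>B e"
        using c by (simp add: yy tensor_bop_mult R_iff e)
      have "y * (c \<otimes>\<^sub>B e) * star y = star v * ((E \<otimes>\<^sub>B e) * (c \<otimes>\<^sub>B e) * (E \<otimes>\<^sub>B e)) * v"
        by (simp add: y_def star_mult star_star tensor_bop_star E_simps e mult.assoc)
      then show "\<Phi> (c \<otimes>\<^sub>B e) = y * (c \<otimes>\<^sub>B e) * star y"
        using c by (simp add: \<Phi>_def tensor_bop_mult R_iff e)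
    qed
    also have "\<dots> = K0_map (D \<otimes>\<^sub>C \<K>) \<Phi> (K0_map (R \<otimes>\<^sub>C \<K>) (\<lambda>b. b \<otimes>\<^sub>B e) X)"
      by (rule K0_map_comp[OF R_subalgebra sub sub hR \<Phi>_hom X, symmetric])
    finally show "K0_map (D \<otimes>\<^sub>C \<K>) (\<lambda>c. c \<otimes>\<^sub>B e) (K0_map D (\<lambda>x. x) X) =
        K0_map (D \<otimes>\<^sub>C \<K>) \<Phi> (K0_map (R \<otimes>\<^sub>C \<K>) (\<lambda>b. b \<otimes>\<^sub>B e) X)" .
  qed
  then show ?thesis
    using \<Phi>_hom \<Phi>_bij by (auto simp: star_iso_def)
qed

end

section \<open>The corner of \<open>E_A\<close>\<close>

theorem proposition5p2:
  fixes N :: nat and A :: "nat mat"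
    and S :: "nat \<Rightarrow> 'i bop" and OA :: "'i bop set"
    and T :: "nat \<Rightarrow> 'j bop" and OAt :: "'j bop set"
  assumes "A \<in> carrier_mat N N"
    and "elements_mat A \<subseteq> {0, 1}"
    and "irreducible_matrix A"
    and "\<not> permutation_matrix A"
    and "cuntz_krieger_algebra A OA S"
    and "cuntz_krieger_algebra (transpose_mat A) OAt T"
  shows "let E = E_A N T S; D = OAt \<otimes>\<^sub>C OA; R = corner E D in
    \<exists>\<Phi> \<Phi>\<^sub>0. star_iso (R \<otimes>\<^sub>C \<K>) (D \<otimes>\<^sub>C \<K>) \<Phi> \<and> induced_K0_iso R D \<Phi> \<Phi>\<^sub>0 \<and>
      \<Phi>\<^sub>0 (K0_class R (alg_unit R)) = K0_class D E"
proof -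
  define D E where "D = OAt \<otimes>\<^sub>C OA" and "E = E_A N T S"
  have At: "transpose_mat A \<in> carrier_mat N N" "elements_mat (transpose_mat A) \<subseteq> {0, 1}"
    using assms(1,2) by (auto simp: elements_mat_subset_iff)
  interpret S: ck_family N A S OA
    using assms by (intro ck_family_cuntz_krieger_algebra)
  interpret T: ck_family N "transpose_mat A" T OAt
    using assms At by (intro ck_family_cuntz_krieger_algebra)
  have conn: "(i, j) \<in> (edges A)\<^sup>+" if "i < N" "j < N" for i j
    using irreducible_trancl[OF assms(1,3) that] .
  then have conn': "(i, j) \<in> (edges (transpose_mat A))\<^sup>+" if "i < N" "j < N" for i j
    using that by (simp add: edges_transpose trancl_converse)
  have perm': "\<not> permutation_matrix (transpose_mat A)"
    using assms(1,4) permutation_matrix_transpose[of A] by auto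
  \<comment> \<open>The empty matrix is a permutation matrix and hence excluded; vertex 0 is
    available below.\<close>
  have "N > 0"
  proof (rule ccontr)
    assume "\<not> N > 0"
    then have "permutation_matrix A"
      using assms(1) by (intro permutation_matrixI[of A 0]) (auto simp: elements_mat_subset_iff edges_def)
    with assms(4) show False ..
  qed
  \<comment> \<open>The summand of \<open>E\<close> at index 0 has first leg \<open>P 0\<close>,
    which dominates \<open>T.Q j\<close> for this \<open>j\<close>. Hence the isometry of
    \<open>OAt\<close> is taken below \<open>T.Q j\<close> and that of \<open>OA\<close> below
    \<open>S.Q 0\<close>.\<close>
  then obtain j where ij: "(0, j) \<in> edges (transpose_mat A)"
    using tranclD[OF conn'[of 0 0]] by blast
  have j: "j < N" using ij assms(1) by (auto simp: edges_def)
  obtain wS where wS: "wS \<in> OA" "star wS * wS = 1" "S.Q 0 * wS = wS"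
    using S.ex_isometry[OF conn assms(4) \<open>N > 0\<close>] by blast
  obtain wT where wT: "wT \<in> OAt" "star wT * wT = 1" "T.Q j * wT = wT"
    using T.ex_isometry[OF conn' perm' j] by blast
  define P where "P i = star (T i) * T i" for i
  have E: "E = (\<Sum>i<N. P i \<otimes>\<^sub>B S.Q i)" by (simp add: E_def E_A_def P_def S.Q_def)
  have P_proj: "P i * P i = P i" "star (P i) = P i" if "i < N" for i
    using T.S_partial_isometry[OF that] by (simp_all add: P_def star_mult star_star mult.assoc)
  \<comment> \<open>Mixed terms vanish by orthogonality of the second legs; the \<open>P i\<close>
    may overlap.\<close>
  have "E * E = (\<Sum>i<N. \<Sum>k<N. (P i * P k) \<otimes>\<^sub>B (S.Q i * S.Q k))"
    by (simp add: E sum_product tensor_bop_mult)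
  also have "\<dots> = (\<Sum>i<N. \<Sum>k<N. if k = i then P i \<otimes>\<^sub>B S.Q i else 0)"
    by (intro sum.cong refl) (auto simp: S.Q_orthogonal S.Q_idem P_proj tensor_bop_linear)
  also have "\<dots> = E" by (simp add: E)
  finally have EE: "E * E = E" .
  have sE: "star E = E"
    unfolding E star_sum by (intro sum.cong refl) (simp add: tensor_bop_star P_proj S.star_Q)
  have PwT: "P 0 * wT = wT"
  proof -
    have "P 0 * wT = star (T 0) * T 0 * T.Q j * wT" by (simp add: P_def mult.assoc wT(3))
    then show ?thesis by (simp add: T.S_initial_Q[OF ij] wT(3))
  qed
  \<comment> \<open>Orthogonality singles out the summand of \<open>E\<close> at index 0.\<close>
  have QwS: "S.Q i * wS = (if i = 0 then wS else 0)" if "i < N" for i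
  proof (cases "i = 0")
    case False
    have "S.Q i * wS = S.Q i * S.Q 0 * wS" by (simp add: mult.assoc wS(3))
    then show ?thesis using False S.Q_orthogonal[OF that \<open>N > 0\<close>] by simp
  qed (simp add: wS(3))
  have "E * (wT \<otimes>\<^sub>B wS) = (\<Sum>i<N. (P i * wT) \<otimes>\<^sub>B (S.Q i * wS))"
    by (simp add: E sum_distrib_right tensor_bop_mult)
  also have "\<dots> = (\<Sum>i<N. if i = 0 then wT \<otimes>\<^sub>B wS else 0)"
    by (intro sum.cong refl) (auto simp: QwS PwT tensor_bop_linear)
  also have "\<dots> = wT \<otimes>\<^sub>B wS" using \<open>N > 0\<close> by simp
  finally have Ew: "E * (wT \<otimes>\<^sub>B wS) = wT \<otimes>\<^sub>B wS" .
  have D: "cstar_subalgebra D" unfolding D_def by (rule cstar_tensor_cstar_subalgebra)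
  have "P i \<in> OAt" if "i < N" for i
    using T.B that by (simp add: P_def star_subringD)
  then have "E \<in> D"
    unfolding E D_def by (intro cstar_subalgebra_sum cstar_tensor_cstar_subalgebra cstar_tensorI S.Q_mem) auto
  then interpret full_corner D E "wT \<otimes>\<^sub>B wS"
    using D EE sE Ew wT(1,2) wS(1,2)
    by unfold_locales (auto simp: is_projection_def D_def cstar_tensorI tensor_bop_star tensor_bop_mult tensor_bop_linear)
  show ?thesis
    unfolding Let_def D_def[symmetric] E_def[symmetric] using stable_iso inclusion_class by blast
qed

end
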